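(* Let $\mathfrak{M}=(\mathcal{Q},\mathcal{W},\mathcal{R})$ be an hereditary abelian model structure on an abelian category $\mathcal{A}$. For all objects $A$ and $B$ of $\mathcal{A}$ we have natural isomorphisms $$\mathrm{Ext}^1_{\mathcal{A}}(\Sigma QA,RB)\cong\mathrm{Ho}(\mathfrak{M})(A,B)\cong\mathrm{Ext}^1_{\mathcal{A}}(QA,\Omega RB).$$
   Context: $\mathrm{Ext}^n_{\mathcal{A}}$ denotes Yoneda Ext: the group of equivalence classes of $n$-fold exact sequences (no enough projectives or injectives assumed). A cotorsion pair is a pair of classes $(\mathcal{X},\mathcal{Y})$ with $\mathcal{Y}=\{Y:\mathrm{Ext}^1_{\mathcal{A}}(X,Y)=0\ \forall X\in\mathcal{X}\}$ and $\mathcal{X}=\{X:\mathrm{Ext}^1_{\mathcal{A}}(X,Y)=0\ \forall Y\in\mathcal{Y}\}$. It is complete if every object $A$ admits short exact sequences $0\to Y\to X\to A\to0$ and $0\to A\to Y'\to X'\to 0$ with $X,X'\in\mathcal{X}$, $Y,Y'\in\mathcal{Y}$; hereditary if $\mathrm{Ext}^i_{\mathcal{A}}(X,Y)=0$ for all $X\in\mathcal{X}$, $Y\in\mathcal{Y}$, $i\ge1$. An hereditary abelian model structure is a triple $\mathfrak{M}=(\mathcal{Q},\mathcal{W},\mathcal{R})$ of classes of objects such that $\mathcal{W}$ is thick (2 out of 3 property on short exact sequences) and, with $\mathcal{Q}_{\mathcal{W}}=\mathcal{Q}\cap\mathcal{W}$ and $\mathcal{R}_{\mathcal{W}}=\mathcal{W}\cap\mathcal{R}$,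 both $(\mathcal{Q},\mathcal{R}_{\mathcal{W}})$ and $(\mathcal{Q}_{\mathcal{W}},\mathcal{R})$ are complete hereditary cotorsion pairs. Objects of $\mathcal{Q}$ are cofibrant, objects of $\mathcal{R}$ fibrant. The core is $\omega=\mathcal{Q}\cap\mathcal{W}\cap\mathcal{R}$; $f\sim^\omega g$ means $g-f$ factors through an object of $\omega$, and $\underline{\mathrm{Hom}}_\omega(A,B)=\mathrm{Hom}_{\mathcal{A}}(A,B)/\sim^\omega$. A cofibrant replacement $QA$ is given by a short exact sequence $0\to F\to QA\to A\to0$ with $QA\in\mathcal{Q}$, $F\in\mathcal{R}_{\mathcal{W}}$; a fibrant replacement $RA$ by $0\to A\to RA\to C\to0$ with $RA\in\mathcal{R}$, $C\in\mathcal{Q}_{\mathcal{W}}$. $\mathrm{Ho}(\mathfrak{M})$ has the objects of $\mathcal{A}$ and $\mathrm{Ho}(\mathfrak{M})(A,B)=\underline{\mathrm{Hom}}_\omega(RQA,RQB)$. A suspension $\Sigma X$ of an object $X$ is any object fitting into a short exact sequence $0\to X\to W\to\Sigma X\to0$ with $W\in\mathcal{W}$, and a loop object $\Omega X$ is any object fitting into a short exact sequence $0\to\Omega X\to W'\to X\to0$ with $W'\in\mathcal{W}$; each is well-defined up to a canonical isomorphism in $\mathrm{Ho}(\mathfrak{M})$.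
   Formalization: The suspension ΣQA is required to be cofibrant and the loop object ΩRB fibrant; for arbitrary suspensions the claim fails (A = QA = 0: any W in 𝒲 is a suspension, yet Ext¹(W,RB) need not vanish), and the isomorphisms for all A, B force these conditions. *)

theory Defs
  imports "HOL-Algebra.Coset"
begin

section \<open>Abelian categories\<close>

text \<open>
  A category is given by its sets of objects and of arrows; \<open>g \<cdot> f\<close> (first \<open>f\<close>, then \<open>g\<close>) is
  only meaningful when \<open>Cod f = Dom g\<close>.  \<open>Nul A B\<close> is the zero arrow from \<open>A\<close> to \<open>B\<close>.
\<close>

record ('o, 'm) cat =
  Ob  :: "'o set"
  Ar  :: "'m set"
  Dom :: "'m \<Rightarrow> 'o"
  Cod :: "'m \<Rightarrow> 'o"
  Ide :: "'o \<Rightarrow> 'm"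
  Cmp :: "'m \<Rightarrow> 'm \<Rightarrow> 'm"  (infixr "\<cdot>\<index>" 75)
  Add :: "'m \<Rightarrow> 'm \<Rightarrow> 'm"  (infixl "\<oplus>\<index>" 65)
  Nul :: "'o \<Rightarrow> 'o \<Rightarrow> 'm"

definition Hom :: "('o, 'm) cat \<Rightarrow> 'o \<Rightarrow> 'o \<Rightarrow> 'm set" where
  "Hom C A B = {f \<in> Ar C. Dom C f = A \<and> Cod C f = B}"

definition Hom_group :: "('o, 'm) cat \<Rightarrow> 'o \<Rightarrow> 'o \<Rightarrow> 'm monoid" where
  "Hom_group C A B = \<lparr>carrier = Hom C A B, mult = Add C, one = Nul C A B\<rparr>"

definition Diff :: "('o, 'm) cat \<Rightarrow> 'm \<Rightarrow> 'm \<Rightarrow> 'm" where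
  "Diff C g f = g \<oplus>\<^bsub>C\<^esub> m_inv (Hom_group C (Dom C f) (Cod C f)) f"

definition is_mono :: "('o, 'm) cat \<Rightarrow> 'm \<Rightarrow> bool" where
  "is_mono C f \<longleftrightarrow> f \<in> Ar C \<and>
     (\<forall>T\<in>Ob C. \<forall>x\<in>Hom C T (Dom C f). \<forall>y\<in>Hom C T (Dom C f).
        f \<cdot>\<^bsub>C\<^esub> x = f \<cdot>\<^bsub>C\<^esub> y \<longrightarrow> x = y)"

definition is_epi :: "('o, 'm) cat \<Rightarrow> 'm \<Rightarrow> bool" where
  "is_epi C f \<longleftrightarrow> f \<in> Ar C \<and>
     (\<forall>T\<in>Ob C. \<forall>x\<in>Hom C (Cod C f) T. \<forall>y\<in>Hom C (Cod C f) T.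
        x \<cdot>\<^bsub>C\<^esub> f = y \<cdot>\<^bsub>C\<^esub> f \<longrightarrow> x = y)"

definition is_kernel :: "('o, 'm) cat \<Rightarrow> 'm \<Rightarrow> 'm \<Rightarrow> bool" where
  "is_kernel C k f \<longleftrightarrow> f \<in> Ar C \<and> k \<in> Ar C \<and> Cod C k = Dom C f \<and>
     f \<cdot>\<^bsub>C\<^esub> k = Nul C (Dom C k) (Cod C f) \<and>
     (\<forall>T\<in>Ob C. \<forall>h\<in>Hom C T (Dom C f). f \<cdot>\<^bsub>C\<^esub> h = Nul C T (Cod C f) \<longrightarrow>
        (\<exists>!x. x \<in> Hom C T (Dom C k) \<and> k \<cdot>\<^bsub>C\<^esub> x = h))"

definition is_cokernel :: "('o, 'm) cat \<Rightarrow> 'm \<Rightarrow> 'm \<Rightarrow> bool" where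
  "is_cokernel C c f \<longleftrightarrow> f \<in> Ar C \<and> c \<in> Ar C \<and> Dom C c = Cod C f \<and>
     c \<cdot>\<^bsub>C\<^esub> f = Nul C (Dom C f) (Cod C c) \<and>
     (\<forall>T\<in>Ob C. \<forall>h\<in>Hom C (Cod C f) T. h \<cdot>\<^bsub>C\<^esub> f = Nul C (Dom C f) T \<longrightarrow>
        (\<exists>!x. x \<in> Hom C (Cod C c) T \<and> x \<cdot>\<^bsub>C\<^esub> c = h))"

definition is_zero_object :: "('o, 'm) cat \<Rightarrow> 'o \<Rightarrow> bool" where
  "is_zero_object C Z \<longleftrightarrow> Z \<in> Ob C \<and>
     (\<forall>A\<in>Ob C. (\<exists>!f. f \<in> Hom C Z A) \<and> (\<exists>!f. f \<in> Hom C A Z))"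

definition is_biproduct ::
  "('o, 'm) cat \<Rightarrow> 'o \<Rightarrow> 'o \<Rightarrow> 'o \<Rightarrow> 'm \<Rightarrow> 'm \<Rightarrow> 'm \<Rightarrow> 'm \<Rightarrow> bool" where
  "is_biproduct C A B S i1 i2 p1 p2 \<longleftrightarrow>
     i1 \<in> Hom C A S \<and> i2 \<in> Hom C B S \<and> p1 \<in> Hom C S A \<and> p2 \<in> Hom C S B \<and>
     p1 \<cdot>\<^bsub>C\<^esub> i1 = Ide C A \<and> p2 \<cdot>\<^bsub>C\<^esub> i2 = Ide C B \<and>
     p2 \<cdot>\<^bsub>C\<^esub> i1 = Nul C A B \<and> p1 \<cdot>\<^bsub>C\<^esub> i2 = Nul C B A \<and>
     (i1 \<cdot>\<^bsub>C\<^esub> p1) \<oplus>\<^bsub>C\<^esub> (i2 \<cdot>\<^bsub>C\<^esub> p2) = Ide C S"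

locale category =
  fixes C :: "('o, 'm) cat" (structure)
  assumes Dom_in: "f \<in> Ar C \<Longrightarrow> Dom C f \<in> Ob C"
    and Cod_in: "f \<in> Ar C \<Longrightarrow> Cod C f \<in> Ob C"
    and Ide_in: "A \<in> Ob C \<Longrightarrow> Ide C A \<in> Hom C A A"
    and Cmp_in: "\<lbrakk>f \<in> Hom C A B; g \<in> Hom C B D\<rbrakk> \<Longrightarrow> g \<cdot> f \<in> Hom C A D"
    and Cmp_assoc: "\<lbrakk>f \<in> Hom C A B; g \<in> Hom C B D; h \<in> Hom C D E\<rbrakk> \<Longrightarrow>
                      (h \<cdot> g) \<cdot> f = h \<cdot> (g \<cdot> f)"
    and Ide_left: "f \<in> Hom C A B \<Longrightarrow> Ide C B \<cdot> f = f"
    and Ide_right: "f \<in> Hom C A B \<Longrightarrow> f \<cdot> Ide C A = f"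

locale preadditive_category = category +
  assumes Hom_comm_group: "\<lbrakk>A \<in> Ob C; B \<in> Ob C\<rbrakk> \<Longrightarrow> comm_group (Hom_group C A B)"
    and Cmp_Add: "\<lbrakk>f \<in> Hom C A B; f' \<in> Hom C A B; g \<in> Hom C B D\<rbrakk> \<Longrightarrow>
                    g \<cdot> (f \<oplus> f') = (g \<cdot> f) \<oplus> (g \<cdot> f')"
    and Add_Cmp: "\<lbrakk>f \<in> Hom C A B; g \<in> Hom C B D; g' \<in> Hom C B D\<rbrakk> \<Longrightarrow>
                    (g \<oplus> g') \<cdot> f = (g \<cdot> f) \<oplus> (g' \<cdot> f)"

locale abelian_category = preadditive_category +
  assumes ex_zero_object: "\<exists>Z. is_zero_object C Z"
    and ex_biproduct: "\<lbrakk>A \<in> Ob C; B \<in> Ob C\<rbrakk> \<Longrightarrow> \<exists>S i1 i2 p1 p2. is_biproduct C A B S i1 i2 p1 p2"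
    and ex_kernel: "f \<in> Ar C \<Longrightarrow> \<exists>k. is_kernel C k f"
    and ex_cokernel: "f \<in> Ar C \<Longrightarrow> \<exists>c. is_cokernel C c f"
    and mono_normal: "is_mono C f \<Longrightarrow> \<exists>g. is_kernel C f g"
    and epi_normal: "is_epi C f \<Longrightarrow> \<exists>g. is_cokernel C f g"


section \<open>Exact sequences\<close>

text \<open>Exactness of \<open>A \<rightarrow> B \<rightarrow> D\<close> at \<open>B\<close>: one and the same \<open>k\<close> is an image of \<open>f\<close>, that is a kernel
  of a cokernel of \<open>f\<close>, and a kernel of \<open>g\<close>.\<close>

definition exact_at :: "('o, 'm) cat \<Rightarrow> 'm \<Rightarrow> 'm \<Rightarrow> bool" where
  "exact_at C f g \<longleftrightarrow> f \<in> Ar C \<and> g \<in> Ar C \<and> Cod C f = Dom C g \<and>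
     (\<exists>c k. is_cokernel C c f \<and> is_kernel C k c \<and> is_kernel C k g)"

definition short_exact :: "('o, 'm) cat \<Rightarrow> 'm \<Rightarrow> 'm \<Rightarrow> bool" where
  "short_exact C f g \<longleftrightarrow> is_mono C f \<and> exact_at C f g \<and> is_epi C g"


section \<open>Yoneda Ext\<close>

text \<open>
  For \<open>n \<ge> 1\<close>, an \<open>n\<close>-fold exact sequence
  \<open>0 \<rightarrow> Y \<rightarrow> E\<^sub>1 \<rightarrow> \<dots> \<rightarrow> E\<^sub>n \<rightarrow> X \<rightarrow> 0\<close> is represented by the list of its \<open>n + 1\<close> arrows from left
  to right, the first one starting at \<open>Y\<close> and the last one ending at \<open>X\<close>.
\<close>

definition n_exact :: "('o, 'm) cat \<Rightarrow> nat \<Rightarrow> 'o \<Rightarrow> 'o \<Rightarrow> 'm list \<Rightarrow> bool" where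
  "n_exact C n X Y E \<longleftrightarrow> length E = Suc n \<and> Dom C (hd E) = Y \<and> Cod C (last E) = X \<and>
     is_mono C (hd E) \<and> (\<forall>i<n. exact_at C (E ! i) (E ! Suc i)) \<and> is_epi C (last E)"

text \<open>Morphisms of sequences: the list \<open>h\<close> contains one vertical arrow for each object of the
  sequence \<open>E\<close>, from left to right, hence one more than \<open>E\<close> has arrows.\<close>

definition seq_morphism :: "('o, 'm) cat \<Rightarrow> 'm list \<Rightarrow> 'm list \<Rightarrow> 'm list \<Rightarrow> bool" where
  "seq_morphism C E E' h \<longleftrightarrow> length E' = length E \<and> length h = Suc (length E) \<and>
     (\<forall>i<length E. h ! i \<in> Hom C (Dom C (E ! i)) (Dom C (E' ! i))) \<and>
     last h \<in> Hom C (Cod C (last E)) (Cod C (last E')) \<and>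
     (\<forall>i<length E. h ! Suc i \<cdot>\<^bsub>C\<^esub> E ! i = E' ! i \<cdot>\<^bsub>C\<^esub> h ! i)"

text \<open>Equivalence of \<open>n\<close>-fold sequences: generated by the morphisms that are the identity on both
  ends \<open>X\<close> and \<open>Y\<close>.\<close>

definition Ext_step :: "('o, 'm) cat \<Rightarrow> nat \<Rightarrow> 'o \<Rightarrow> 'o \<Rightarrow> 'm list rel" where
  "Ext_step C n X Y = {(E, E'). n_exact C n X Y E \<and> n_exact C n X Y E' \<and>
     (\<exists>h. seq_morphism C E E' h \<and> hd h = Ide C Y \<and> last h = Ide C X)}"

definition Ext_equiv :: "('o, 'm) cat \<Rightarrow> nat \<Rightarrow> 'o \<Rightarrow> 'o \<Rightarrow> 'm list rel" where
  "Ext_equiv C n X Y = (Ext_step C n X Y \<union> (Ext_step C n X Y)\<inverse>)\<^sup>*"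

text \<open>
  Functoriality of Ext: for \<open>f : Y \<rightarrow> Y'\<close> and \<open>g : X' \<rightarrow> X\<close>, a morphism from \<open>E\<close> to \<open>E'\<close> with
  ends \<open>(f, id)\<close> means that \<open>E'\<close> represents the push-forward of \<open>E\<close> along \<open>f\<close>, and one from \<open>E'\<close>
  to \<open>E\<close> with ends \<open>(id, g)\<close> that \<open>E'\<close> represents the pull-back of \<open>E\<close> along \<open>g\<close>.
\<close>

definition Ext_push ::
  "('o, 'm) cat \<Rightarrow> nat \<Rightarrow> 'o \<Rightarrow> 'm \<Rightarrow> 'm list set \<Rightarrow> 'm list set" where
  "Ext_push C n X f e = Ext_equiv C n X (Cod C f) ``
     {E'. n_exact C n X (Cod C f) E' \<and>
        (\<exists>E\<in>e. \<exists>h. seq_morphism C E E' h \<and> hd h = f \<and> last h = Ide C X)}"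

definition Ext_pull ::
  "('o, 'm) cat \<Rightarrow> nat \<Rightarrow> 'o \<Rightarrow> 'm \<Rightarrow> 'm list set \<Rightarrow> 'm list set" where
  "Ext_pull C n Y g e = Ext_equiv C n (Dom C g) Y ``
     {E'. n_exact C n (Dom C g) Y E' \<and>
        (\<exists>E\<in>e. \<exists>h. seq_morphism C E' E h \<and> hd h = Ide C Y \<and> last h = g)}"

text \<open>A choice of zero object and of biproducts; neither the zero class nor the Baer sum depends on it.\<close>

definition zero_ob :: "('o, 'm) cat \<Rightarrow> 'o" where
  "zero_ob C = (SOME Z. is_zero_object C Z)"

definition biprod :: "('o, 'm) cat \<Rightarrow> 'o \<Rightarrow> 'o \<Rightarrow> 'o \<times> 'm \<times> 'm \<times> 'm \<times> 'm" where
  "biprod C A B = (SOME (S, i1, i2, p1, p2). is_biproduct C A B S i1 i2 p1 p2)"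

definition bi_ob :: "('o, 'm) cat \<Rightarrow> 'o \<Rightarrow> 'o \<Rightarrow> 'o" where
  "bi_ob C A B = (case biprod C A B of (S, i1, i2, p1, p2) \<Rightarrow> S)"

definition bi_in1 :: "('o, 'm) cat \<Rightarrow> 'o \<Rightarrow> 'o \<Rightarrow> 'm" where
  "bi_in1 C A B = (case biprod C A B of (S, i1, i2, p1, p2) \<Rightarrow> i1)"

definition bi_in2 :: "('o, 'm) cat \<Rightarrow> 'o \<Rightarrow> 'o \<Rightarrow> 'm" where
  "bi_in2 C A B = (case biprod C A B of (S, i1, i2, p1, p2) \<Rightarrow> i2)"

definition bi_pr1 :: "('o, 'm) cat \<Rightarrow> 'o \<Rightarrow> 'o \<Rightarrow> 'm" where
  "bi_pr1 C A B = (case biprod C A B of (S, i1, i2, p1, p2) \<Rightarrow> p1)"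

definition bi_pr2 :: "('o, 'm) cat \<Rightarrow> 'o \<Rightarrow> 'o \<Rightarrow> 'm" where
  "bi_pr2 C A B = (case biprod C A B of (S, i1, i2, p1, p2) \<Rightarrow> p2)"

definition bi_map :: "('o, 'm) cat \<Rightarrow> 'm \<Rightarrow> 'm \<Rightarrow> 'm" where
  "bi_map C f g =
     (bi_in1 C (Cod C f) (Cod C g) \<cdot>\<^bsub>C\<^esub> f \<cdot>\<^bsub>C\<^esub> bi_pr1 C (Dom C f) (Dom C g)) \<oplus>\<^bsub>C\<^esub>
     (bi_in2 C (Cod C f) (Cod C g) \<cdot>\<^bsub>C\<^esub> g \<cdot>\<^bsub>C\<^esub> bi_pr2 C (Dom C f) (Dom C g))"

definition diagonal :: "('o, 'm) cat \<Rightarrow> 'o \<Rightarrow> 'm" where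
  "diagonal C A = bi_in1 C A A \<oplus>\<^bsub>C\<^esub> bi_in2 C A A"

definition codiagonal :: "('o, 'm) cat \<Rightarrow> 'o \<Rightarrow> 'm" where
  "codiagonal C A = bi_pr1 C A A \<oplus>\<^bsub>C\<^esub> bi_pr2 C A A"

definition Baer_sum ::
  "('o, 'm) cat \<Rightarrow> nat \<Rightarrow> 'o \<Rightarrow> 'o \<Rightarrow> 'm list set \<Rightarrow> 'm list set \<Rightarrow> 'm list set" where
  "Baer_sum C n X Y e e' =
     Ext_push C n X (codiagonal C Y) (Ext_pull C n (bi_ob C Y Y) (diagonal C X)
       (Ext_equiv C n (bi_ob C X X) (bi_ob C Y Y) `` {map2 (bi_map C) E E' | E E'. E \<in> e \<and> E' \<in> e'}))"

text \<open>The zero element of Ext: the split sequence \<open>Y \<rightarrow> Y \<oplus> X \<rightarrow> X\<close> for \<open>n = 1\<close>, and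
  \<open>Y = Y \<rightarrow> 0 \<rightarrow> \<dots> \<rightarrow> 0 \<rightarrow> X = X\<close> with \<open>n - 2\<close> zero objects for \<open>n \<ge> 2\<close>.\<close>

definition zero_seq :: "('o, 'm) cat \<Rightarrow> nat \<Rightarrow> 'o \<Rightarrow> 'o \<Rightarrow> 'm list" where
  "zero_seq C n X Y =
     (if n = 1 then [bi_in1 C Y X, bi_pr2 C Y X]
      else let Es = Y # replicate (n - 2) (zero_ob C) @ [X]
           in Ide C Y # map2 (Nul C) (butlast Es) (tl Es) @ [Ide C X])"

definition Ext :: "('o, 'm) cat \<Rightarrow> nat \<Rightarrow> 'o \<Rightarrow> 'o \<Rightarrow> 'm list set monoid" where
  "Ext C n X Y =
     \<lparr>carrier = {E. n_exact C n X Y E} // Ext_equiv C n X Y,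
      mult = Baer_sum C n X Y,
      one = Ext_equiv C n X Y `` {zero_seq C n X Y}\<rparr>"

definition Ext_vanishes :: "('o, 'm) cat \<Rightarrow> nat \<Rightarrow> 'o \<Rightarrow> 'o \<Rightarrow> bool" where
  "Ext_vanishes C n X Y \<longleftrightarrow> carrier (Ext C n X Y) = {\<one>\<^bsub>Ext C n X Y\<^esub>}"


section \<open>Hereditary abelian model structures\<close>

definition cotorsion_pair :: "('o, 'm) cat \<Rightarrow> 'o set \<Rightarrow> 'o set \<Rightarrow> bool" where
  "cotorsion_pair C \<X> \<Y> \<longleftrightarrow> \<X> \<subseteq> Ob C \<and> \<Y> \<subseteq> Ob C \<and>
     \<Y> = {Y \<in> Ob C. \<forall>X\<in>\<X>. Ext_vanishes C 1 X Y} \<and>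
     \<X> = {X \<in> Ob C. \<forall>Y\<in>\<Y>. Ext_vanishes C 1 X Y}"

definition complete_pair :: "('o, 'm) cat \<Rightarrow> 'o set \<Rightarrow> 'o set \<Rightarrow> bool" where
  "complete_pair C \<X> \<Y> \<longleftrightarrow> (\<forall>A\<in>Ob C.
     (\<exists>f g. short_exact C f g \<and> Dom C f \<in> \<Y> \<and> Dom C g \<in> \<X> \<and> Cod C g = A) \<and>
     (\<exists>f g. short_exact C f g \<and> Dom C f = A \<and> Cod C f \<in> \<Y> \<and> Cod C g \<in> \<X>))"

definition hereditary_pair :: "('o, 'm) cat \<Rightarrow> 'o set \<Rightarrow> 'o set \<Rightarrow> bool" where
  "hereditary_pair C \<X> \<Y> \<longleftrightarrow> (\<forall>X\<in>\<X>. \<forall>Y\<in>\<Y>. \<forall>i\<ge>1. Ext_vanishes C i X Y)"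

definition thick :: "('o, 'm) cat \<Rightarrow> 'o set \<Rightarrow> bool" where
  "thick C \<W> \<longleftrightarrow> \<W> \<subseteq> Ob C \<and> (\<forall>f g. short_exact C f g \<longrightarrow>
     (Dom C f \<in> \<W> \<and> Cod C f \<in> \<W> \<longrightarrow> Cod C g \<in> \<W>) \<and>
     (Dom C f \<in> \<W> \<and> Cod C g \<in> \<W> \<longrightarrow> Cod C f \<in> \<W>) \<and>
     (Cod C f \<in> \<W> \<and> Cod C g \<in> \<W> \<longrightarrow> Dom C f \<in> \<W>))"

definition hereditary_abelian_model_structure ::
  "('o, 'm) cat \<Rightarrow> 'o set \<Rightarrow> 'o set \<Rightarrow> 'o set \<Rightarrow> bool" where
  "hereditary_abelian_model_structure C \<Q> \<W> \<R> \<longleftrightarrow>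
     \<Q> \<subseteq> Ob C \<and> \<R> \<subseteq> Ob C \<and> thick C \<W> \<and>
     cotorsion_pair C \<Q> (\<W> \<inter> \<R>) \<and> complete_pair C \<Q> (\<W> \<inter> \<R>) \<and> hereditary_pair C \<Q> (\<W> \<inter> \<R>) \<and>
     cotorsion_pair C (\<Q> \<inter> \<W>) \<R> \<and> complete_pair C (\<Q> \<inter> \<W>) \<R> \<and> hereditary_pair C (\<Q> \<inter> \<W>) \<R>"

definition cofibrant_replacement ::
  "('o, 'm) cat \<Rightarrow> 'o set \<Rightarrow> 'o set \<Rightarrow> 'o set \<Rightarrow> 'o \<Rightarrow> 'm \<Rightarrow> bool" where
  "cofibrant_replacement C \<Q> \<W> \<R> A p \<longleftrightarrow>
     (\<exists>f. short_exact C f p \<and> Cod C p = A \<and> Dom C p \<in> \<Q> \<and> Dom C f \<in> \<W> \<inter> \<R>)"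

definition fibrant_replacement ::
  "('o, 'm) cat \<Rightarrow> 'o set \<Rightarrow> 'o set \<Rightarrow> 'o set \<Rightarrow> 'o \<Rightarrow> 'm \<Rightarrow> bool" where
  "fibrant_replacement C \<Q> \<W> \<R> A j \<longleftrightarrow>
     (\<exists>c. short_exact C j c \<and> Dom C j = A \<and> Cod C j \<in> \<R> \<and> Cod C c \<in> \<Q> \<inter> \<W>)"

text \<open>
  In \<open>0 \<rightarrow> X \<rightarrow> W \<rightarrow> \<Sigma>X \<rightarrow> 0\<close> and \<open>0 \<rightarrow> \<Omega>X \<rightarrow> W \<rightarrow> X \<rightarrow> 0\<close> the object \<open>W\<close> is an arbitrary object of
  \<open>\<W>\<close>, so that \<open>\<Sigma>X\<close> and \<open>\<Omega>X\<close> are only determined up to isomorphism in the homotopy category.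
  This does not determine a group such as \<open>Ext\<^sup>1(\<Sigma>QA, RB)\<close>: for \<open>QA = 0\<close> every \<open>W\<close> in \<open>\<W>\<close> is a
  suspension, whereas \<open>Ext\<^sup>1(W, RB)\<close> need not vanish unless \<open>W\<close> is cofibrant.  Inside \<open>Ext\<^sup>1\<close> one
  has to take a cofibrant suspension of a cofibrant object and a fibrant loop object of a fibrant
  object.
\<close>

definition suspension :: "('o, 'm) cat \<Rightarrow> 'o set \<Rightarrow> 'o \<Rightarrow> 'm \<Rightarrow> 'm \<Rightarrow> bool" where
  "suspension C \<W> X u v \<longleftrightarrow> short_exact C u v \<and> Dom C u = X \<and> Cod C u \<in> \<W>"

definition loop :: "('o, 'm) cat \<Rightarrow> 'o set \<Rightarrow> 'o \<Rightarrow> 'm \<Rightarrow> 'm \<Rightarrow> bool" where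
  "loop C \<W> X k l \<longleftrightarrow> short_exact C k l \<and> Cod C l = X \<and> Dom C l \<in> \<W>"

definition cofibrant_suspension ::
  "('o, 'm) cat \<Rightarrow> 'o set \<Rightarrow> 'o set \<Rightarrow> 'o \<Rightarrow> 'm \<Rightarrow> 'm \<Rightarrow> bool" where
  "cofibrant_suspension C \<Q> \<W> X u v \<longleftrightarrow> suspension C \<W> X u v \<and> Cod C v \<in> \<Q>"

definition fibrant_loop ::
  "('o, 'm) cat \<Rightarrow> 'o set \<Rightarrow> 'o set \<Rightarrow> 'o \<Rightarrow> 'm \<Rightarrow> 'm \<Rightarrow> bool" where
  "fibrant_loop C \<W> \<R> X k l \<longleftrightarrow> loop C \<W> X k l \<and> Dom C k \<in> \<R>"


section \<open>The homotopy category\<close>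

definition homotopy :: "('o, 'm) cat \<Rightarrow> 'o set \<Rightarrow> 'o \<Rightarrow> 'o \<Rightarrow> 'm rel" where
  "homotopy C \<omega> A B = {(f, g). f \<in> Hom C A B \<and> g \<in> Hom C A B \<and>
     (\<exists>J\<in>\<omega>. \<exists>a\<in>Hom C A J. \<exists>b\<in>Hom C J B. Diff C g f = b \<cdot>\<^bsub>C\<^esub> a)}"

definition stable_Hom :: "('o, 'm) cat \<Rightarrow> 'o set \<Rightarrow> 'o \<Rightarrow> 'o \<Rightarrow> 'm set monoid" where
  "stable_Hom C \<omega> A B =
     \<lparr>carrier = Hom C A B // homotopy C \<omega> A B,
      mult = (\<lambda>x y. homotopy C \<omega> A B `` {f \<oplus>\<^bsub>C\<^esub> g | f g. f \<in> x \<and> g \<in> y}),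
      one = homotopy C \<omega> A B `` {Nul C A B}\<rparr>"

text \<open>
  From here on \<open>p A : QA \<rightarrow> A\<close> and \<open>j A : A \<rightarrow> RA\<close> are a chosen cofibrant and a chosen fibrant
  replacement of each object \<open>A\<close>.
\<close>

definition Qo :: "('o, 'm) cat \<Rightarrow> ('o \<Rightarrow> 'm) \<Rightarrow> 'o \<Rightarrow> 'o" where
  "Qo C p A = Dom C (p A)"

definition Ro :: "('o, 'm) cat \<Rightarrow> ('o \<Rightarrow> 'm) \<Rightarrow> 'o \<Rightarrow> 'o" where
  "Ro C j A = Cod C (j A)"

definition RQ :: "('o, 'm) cat \<Rightarrow> ('o \<Rightarrow> 'm) \<Rightarrow> ('o \<Rightarrow> 'm) \<Rightarrow> 'o \<Rightarrow> 'o" where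
  "RQ C p j A = Ro C j (Qo C p A)"

definition Ho ::
  "('o, 'm) cat \<Rightarrow> 'o set \<Rightarrow> ('o \<Rightarrow> 'm) \<Rightarrow> ('o \<Rightarrow> 'm) \<Rightarrow> 'o \<Rightarrow> 'o \<Rightarrow> 'm set monoid" where
  "Ho C \<omega> p j A B = stable_Hom C \<omega> (RQ C p j A) (RQ C p j B)"

text \<open>Composition \<open>Ho(B, D) \<times> Ho(A, B) \<rightarrow> Ho(A, D)\<close>, induced by the composition of representatives.\<close>

definition Ho_comp ::
  "('o, 'm) cat \<Rightarrow> 'o set \<Rightarrow> ('o \<Rightarrow> 'm) \<Rightarrow> ('o \<Rightarrow> 'm) \<Rightarrow> 'o \<Rightarrow> 'o \<Rightarrow> 'm set \<Rightarrow> 'm set \<Rightarrow> 'm set" where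
  "Ho_comp C \<omega> p j A D y x =
     homotopy C \<omega> (RQ C p j A) (RQ C p j D) `` {g \<cdot>\<^bsub>C\<^esub> f | f g. f \<in> x \<and> g \<in> y}"

text \<open>Arrows \<open>Qf : QA \<rightarrow> QB\<close> over \<open>f : A \<rightarrow> B\<close>, and arrows \<open>Rf : RA \<rightarrow> RB\<close> under \<open>f\<close>.\<close>

definition Q_lift :: "('o, 'm) cat \<Rightarrow> ('o \<Rightarrow> 'm) \<Rightarrow> 'm \<Rightarrow> 'm \<Rightarrow> bool" where
  "Q_lift C p f q \<longleftrightarrow> q \<in> Hom C (Qo C p (Dom C f)) (Qo C p (Cod C f)) \<and>
     p (Cod C f) \<cdot>\<^bsub>C\<^esub> q = f \<cdot>\<^bsub>C\<^esub> p (Dom C f)"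

definition R_ext :: "('o, 'm) cat \<Rightarrow> ('o \<Rightarrow> 'm) \<Rightarrow> 'm \<Rightarrow> 'm \<Rightarrow> bool" where
  "R_ext C j f r \<longleftrightarrow> r \<in> Hom C (Ro C j (Dom C f)) (Ro C j (Cod C f)) \<and>
     r \<cdot>\<^bsub>C\<^esub> j (Dom C f) = j (Cod C f) \<cdot>\<^bsub>C\<^esub> f"

text \<open>The canonical functor to the homotopy category, identity on objects, \<open>f \<mapsto> [R(Qf)]\<close> on
  arrows.\<close>

definition Ho_map ::
  "('o, 'm) cat \<Rightarrow> 'o set \<Rightarrow> ('o \<Rightarrow> 'm) \<Rightarrow> ('o \<Rightarrow> 'm) \<Rightarrow> 'm \<Rightarrow> 'm set" where
  "Ho_map C \<omega> p j f = homotopy C \<omega> (RQ C p j (Dom C f)) (RQ C p j (Cod C f)) ``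
     {h. \<exists>q. Q_lift C p f q \<and> R_ext C j q h}"

end

theory Submission
  imports Defs
begin

text \<open>
  Push-out along arrows \<open>h : QA \<rightarrow> RB\<close> of the suspension sequence \<open>QA \<rightarrow> W \<rightarrow> \<Sigma>QA\<close> is a homomorphism
  \<open>Hom(QA, RB) \<rightarrow> Ext\<^sup>1(\<Sigma>QA, RB)\<close>. It is onto because \<open>Ext\<^sup>1(W, RB) = 0\<close>, and its kernel consists of the arrows
  that factor through \<open>QA \<rightarrow> W\<close>; by the two cotorsion pairs these are exactly the arrows that factor through an
  object of \<open>\<omega>\<close>. The loop sequence of \<open>RB\<close> is treated by pull-back, dually. It remains to compare
  \<open>Hom(QA, RB)/\<omega>\<close> with \<open>Hom(RQA, RQB)/\<omega>\<close>: the comparison map is \<open>y \<mapsto> \<pi> \<cdot> y \<cdot> j\<close>, where \<open>j : QA \<rightarrow> RQA\<close> and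
  \<open>\<pi> : RQB \<rightarrow> RB\<close> extends \<open>QB \<rightarrow> B \<rightarrow> RB\<close>. Composition with \<open>j\<close> is bijective modulo \<open>\<omega>\<close> because the cokernel
  of \<open>j\<close> lies in \<open>\<Q> \<inter> \<W>\<close>, composition with \<open>\<pi>\<close> because \<open>\<pi>\<close> becomes, after adding an object of \<open>\<Q> \<inter> \<W>\<close> to its
  domain, an epimorphism with kernel in \<open>\<W> \<inter> \<R>\<close>.
\<close>

section \<open>Arrow calculus\<close>

text \<open>The groups to be compared are presented differently: classes of sequences on one side,
  cosets of arrows on the other, and the sum in Ext is formed through chosen biproducts. This is
  overcome by knowing an extension only through the morphisms of sequences into and out of it. The
  sequences that receive a morphism with ends \<open>h\<close> and an identity from a fixed one form
  exactly one class, so additivity and naturality become composition of such morphisms. All three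
  groups are then images of the single group Hom(RQA, RQB), and an isomorphism amounts to equality
  of fibres; one proof that the comparison map preserves and reflects nullity serves both sides.
  Cofibrancy of the suspension enters because it makes W an extension of two cofibrant objects,
  hence an object of \<open>\<Q> \<inter> \<W>\<close>; the vanishing of Ext^1(W, RB) and the
  description of the kernel both rest on this. Passing to \<open>opp C\<close> exchanges
  \<open>\<Q>\<close> and \<open>\<R>\<close>, kernels and cokernels, pull-back and push-out, so
  that many statements are proved in one variance only.\<close>

definition opp :: "('o, 'm) cat \<Rightarrow> ('o, 'm) cat" where
  "opp C = \<lparr>Ob = Ob C, Ar = Ar C, Dom = Cod C, Cod = Dom C, Ide = Ide C,
            Cmp = (\<lambda>g f. f \<cdot>\<^bsub>C\<^esub> g), Add = Add C, Nul = (\<lambda>A B. Nul C B A)\<rparr>"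

definition Neg :: "('o, 'm) cat \<Rightarrow> 'm \<Rightarrow> 'm" where
  "Neg C f = m_inv (Hom_group C (Dom C f) (Cod C f)) f"

lemma Hom_iff: "f \<in> Hom C A B \<longleftrightarrow> f \<in> Ar C \<and> Dom C f = A \<and> Cod C f = B"
  by (simp add: Hom_def)

lemma Diff_Neg: "Diff C g f = g \<oplus>\<^bsub>C\<^esub> Neg C f"
  by (simp add: Diff_def Neg_def)

lemma opp_sel [simp]:
  "Ob (opp C) = Ob C" "Ar (opp C) = Ar C" "Dom (opp C) = Cod C" "Cod (opp C) = Dom C"
  "Ide (opp C) = Ide C" "g \<cdot>\<^bsub>opp C\<^esub> f = f \<cdot>\<^bsub>C\<^esub> g" "f \<oplus>\<^bsub>opp C\<^esub> g = f \<oplus>\<^bsub>C\<^esub> g"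
  "Nul (opp C) A B = Nul C B A"
  by (simp_all add: opp_def)

lemma Hom_opp [simp]: "Hom (opp C) A B = Hom C B A"
  by (auto simp: Hom_iff)

lemma Hom_group_opp [simp]: "Hom_group (opp C) A B = Hom_group C B A"
  by (simp add: Hom_group_def opp_def) (auto simp: Hom_iff)

lemma Neg_opp [simp]: "Neg (opp C) f = Neg C f"
  by (simp add: Neg_def)

lemma Diff_opp [simp]: "Diff (opp C) f g = Diff C f g"
  by (simp add: Diff_Neg)

lemma opp_opp [simp]: "opp (opp C) = C"
  by (simp add: opp_def)

lemma mono_opp [simp]: "is_mono (opp C) f \<longleftrightarrow> is_epi C f"
  by (simp add: is_mono_def is_epi_def)

lemma epi_opp [simp]: "is_epi (opp C) f \<longleftrightarrow> is_mono C f"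
  by (simp add: is_mono_def is_epi_def)

lemma kernel_opp [simp]: "is_kernel (opp C) k f \<longleftrightarrow> is_cokernel C k f"
  by (simp add: is_kernel_def is_cokernel_def)

lemma cokernel_opp [simp]: "is_cokernel (opp C) k f \<longleftrightarrow> is_kernel C k f"
  by (simp add: is_kernel_def is_cokernel_def)

lemma zero_object_opp [simp]: "is_zero_object (opp C) Z \<longleftrightarrow> is_zero_object C Z"
  by (auto simp: is_zero_object_def)

lemma biproduct_opp [simp]:
  "is_biproduct (opp C) A B S i1 i2 p1 p2 \<longleftrightarrow> is_biproduct C A B S p1 p2 i1 i2"
  by (auto simp: is_biproduct_def)

section \<open>Composition, monomorphisms and kernels\<close>

context category
begin

text \<open>The locale axioms speak of membership in \<open>Hom C A B\<close>, whose end objects a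
  rewriting step would have to guess. Here and below they are restated with \<open>Ar\<close>,
  \<open>Dom\<close> and \<open>Cod\<close>, so that all side conditions can be evaluated from the
  arrows alone.\<close>

lemma Ob_simps [simp]: "f \<in> Ar C \<Longrightarrow> Dom C f \<in> Ob C" "f \<in> Ar C \<Longrightarrow> Cod C f \<in> Ob C"
  by (rule Dom_in Cod_in; assumption)+

lemma Ide_simps [simp]:
  assumes "A \<in> Ob C"
  shows "Ide C A \<in> Ar C" "Dom C (Ide C A) = A" "Cod C (Ide C A) = A"
  using Ide_in[OF assms] by (auto simp: Hom_iff)

lemma Cmp_simps [simp]:
  assumes "f \<in> Ar C" "g \<in> Ar C" "Cod C f = Dom C g"
  shows "g \<cdot> f \<in> Ar C" "Dom C (g \<cdot> f) = Dom C f" "Cod C (g \<cdot> f) = Cod C g"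
  using Cmp_in[of f "Dom C f" "Cod C f" g "Cod C g"] assms by (auto simp: Hom_iff)

lemma assoc [simp]:
  assumes "f \<in> Ar C" "g \<in> Ar C" "h \<in> Ar C" "Cod C f = Dom C g" "Cod C g = Dom C h"
  shows "(h \<cdot> g) \<cdot> f = h \<cdot> g \<cdot> f"
  using Cmp_assoc[of f "Dom C f" "Cod C f" g "Cod C g" h "Cod C h"] assms by (auto simp: Hom_iff)

lemma Ide_Cmp [simp]: "f \<in> Ar C \<Longrightarrow> Cod C f = B \<Longrightarrow> Ide C B \<cdot> f = f"
  using Ide_left[of f "Dom C f" B] by (auto simp: Hom_iff)

lemma Cmp_Ide [simp]: "f \<in> Ar C \<Longrightarrow> Dom C f = A \<Longrightarrow> f \<cdot> Ide C A = f"
  using Ide_right[of f A "Cod C f"] by (auto simp: Hom_iff)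

text \<open>Composites are normalised to the right, which hides the left-hand side of a known
  equation \<open>g \<cdot> f = h\<close> as soon as a further arrow follows; this is the form of
  the equation that still applies.\<close>

lemma reassoc:
  assumes "g \<cdot> f = h" "f \<in> Ar C" "g \<in> Ar C" "Cod C f = Dom C g" "x \<in> Ar C" "Cod C x = Dom C f"
  shows "g \<cdot> f \<cdot> x = h \<cdot> x"
  using assoc[of x f g] assms by simp

lemma category_opp: "category (opp C)"
  by unfold_locales (auto simp: Hom_iff)

lemma monoD:
  assumes "is_mono C f" "f \<cdot> x = f \<cdot> y" "x \<in> Ar C" "y \<in> Ar C" "Cod C x = Dom C f" "Cod C y = Dom C f"
    "Dom C x = Dom C y"
  shows "x = y"
  using assms unfolding is_mono_def by (metis Hom_iff Ob_simps(1))

lemma epiD: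
  assumes "is_epi C f" "x \<cdot> f = y \<cdot> f" "x \<in> Ar C" "y \<in> Ar C" "Dom C x = Cod C f" "Dom C y = Cod C f"
    "Cod C x = Cod C y"
  shows "x = y"
  using assms unfolding is_epi_def by (metis Hom_iff Ob_simps(2))

lemma kernel_factor:
  assumes "is_kernel C k f" "h \<in> Ar C" "Cod C h = Dom C f" "f \<cdot> h = Nul C (Dom C h) (Cod C f)"
  obtains x where "x \<in> Ar C" "Dom C x = Dom C h" "Cod C x = Dom C k" "k \<cdot> x = h"
proof -
  have "\<exists>!x. x \<in> Hom C (Dom C h) (Dom C k) \<and> k \<cdot> x = h"
    using assms unfolding is_kernel_def by (simp add: Hom_iff)
  then show thesis using that by (auto simp: Hom_iff)
qed

lemma cokernel_factor:
  assumes "is_cokernel C c f" "h \<in> Ar C" "Dom C h = Cod C f" "h \<cdot> f = Nul C (Dom C f) (Cod C h)"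
  obtains x where "x \<in> Ar C" "Dom C x = Cod C c" "Cod C x = Cod C h" "x \<cdot> c = h"
  using category.kernel_factor[OF category_opp, of c f h] assms by auto

end

section \<open>Calculus of sums, negatives and differences of arrows\<close>

context preadditive_category
begin

lemma Nul_simps [simp]:
  assumes "A \<in> Ob C" "B \<in> Ob C"
  shows "Nul C A B \<in> Ar C" "Dom C (Nul C A B) = A" "Cod C (Nul C A B) = B"
proof -
  interpret comm_group "Hom_group C A B" using assms by (rule Hom_comm_group)
  have "Nul C A B \<in> Hom C A B" using one_closed by (simp add: Hom_group_def)
  then show "Nul C A B \<in> Ar C" "Dom C (Nul C A B) = A" "Cod C (Nul C A B) = B" by (auto simp: Hom_iff)
qed

lemma Add_simps [simp]:
  assumes "f \<in> Ar C" "g \<in> Ar C" "Dom C g = Dom C f" "Cod C g = Cod C f"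
  shows "f \<oplus> g \<in> Ar C" "Dom C (f \<oplus> g) = Dom C f" "Cod C (f \<oplus> g) = Cod C f"
proof -
  interpret comm_group "Hom_group C (Dom C f) (Cod C f)" using assms by (intro Hom_comm_group) auto
  have "f \<oplus> g \<in> Hom C (Dom C f) (Cod C f)"
    using m_closed[of f g] assms by (simp add: Hom_group_def Hom_iff)
  then show "f \<oplus> g \<in> Ar C" "Dom C (f \<oplus> g) = Dom C f" "Cod C (f \<oplus> g) = Cod C f" by (auto simp: Hom_iff)
qed

lemma Neg_simps [simp]:
  assumes "f \<in> Ar C"
  shows "Neg C f \<in> Ar C" "Dom C (Neg C f) = Dom C f" "Cod C (Neg C f) = Cod C f"
    "f \<oplus> Neg C f = Nul C (Dom C f) (Cod C f)" "Neg C f \<oplus> f = Nul C (Dom C f) (Cod C f)"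
proof -
  interpret comm_group "Hom_group C (Dom C f) (Cod C f)" using assms by (intro Hom_comm_group) auto
  have "Neg C f \<in> Hom C (Dom C f) (Cod C f)"
    using inv_closed[of f] assms by (simp add: Hom_group_def Hom_iff Neg_def)
  then show "Neg C f \<in> Ar C" "Dom C (Neg C f) = Dom C f" "Cod C (Neg C f) = Cod C f" by (auto simp: Hom_iff)
  show "f \<oplus> Neg C f = Nul C (Dom C f) (Cod C f)" "Neg C f \<oplus> f = Nul C (Dom C f) (Cod C f)"
    using r_inv[of f] l_inv[of f] assms by (auto simp: Hom_group_def Hom_iff Neg_def)
qed

lemma Add_assoc:
  assumes "f \<in> Ar C" "g \<in> Ar C" "h \<in> Ar C" "Dom C g = Dom C f" "Cod C g = Cod C f"
    "Dom C h = Dom C f" "Cod C h = Cod C f"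
  shows "(f \<oplus> g) \<oplus> h = f \<oplus> (g \<oplus> h)"
proof -
  interpret comm_group "Hom_group C (Dom C f) (Cod C f)" using assms by (intro Hom_comm_group) auto
  show ?thesis using m_assoc[of f g h] assms by (simp add: Hom_group_def Hom_iff)
qed

lemma Add_comm:
  assumes "f \<in> Ar C" "g \<in> Ar C" "Dom C g = Dom C f" "Cod C g = Cod C f"
  shows "f \<oplus> g = g \<oplus> f"
proof -
  interpret comm_group "Hom_group C (Dom C f) (Cod C f)" using assms by (intro Hom_comm_group) auto
  show ?thesis using m_comm[of f g] assms by (simp add: Hom_group_def Hom_iff)
qed

lemma Nul_Add [simp]:
  assumes "f \<in> Ar C" "Dom C f = A" "Cod C f = B"
  shows "Nul C A B \<oplus> f = f" "f \<oplus> Nul C A B = f"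
proof -
  interpret comm_group "Hom_group C A B" using assms by (intro Hom_comm_group) auto
  show "Nul C A B \<oplus> f = f" "f \<oplus> Nul C A B = f"
    using l_one[of f] r_one[of f] assms by (auto simp: Hom_group_def Hom_iff)
qed

lemma Cmp_Add_simp [simp]:
  assumes "f \<in> Ar C" "f' \<in> Ar C" "g \<in> Ar C" "Dom C f' = Dom C f" "Cod C f' = Cod C f" "Cod C f = Dom C g"
  shows "g \<cdot> (f \<oplus> f') = g \<cdot> f \<oplus> g \<cdot> f'"
  using Cmp_Add[of f "Dom C f" "Cod C f" f' g "Cod C g"] assms by (auto simp: Hom_iff)

lemma Add_Cmp_simp [simp]:
  assumes "f \<in> Ar C" "g \<in> Ar C" "g' \<in> Ar C" "Dom C g' = Dom C g" "Cod C g' = Cod C g" "Cod C f = Dom C g"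
  shows "(g \<oplus> g') \<cdot> f = g \<cdot> f \<oplus> g' \<cdot> f"
  using Add_Cmp[of f "Dom C f" "Cod C f" g "Cod C g" g'] assms by (auto simp: Hom_iff)

lemma Add_cancel:
  assumes "f \<oplus> g = f \<oplus> h" "f \<in> Ar C" "g \<in> Ar C" "h \<in> Ar C" "Dom C g = Dom C f" "Cod C g = Cod C f"
    "Dom C h = Dom C f" "Cod C h = Cod C f"
  shows "g = h"
proof -
  have "Neg C f \<oplus> f \<oplus> g = Neg C f \<oplus> f \<oplus> h" using assms by (simp del: Neg_simps(4,5) add: Add_assoc)
  then show ?thesis using assms by simp
qed

lemma idem_Nul:
  assumes "f \<oplus> f = f" "f \<in> Ar C" shows "f = Nul C (Dom C f) (Cod C f)"
  by (rule Add_cancel[of f]) (use assms in auto)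

lemma Neg_unique:
  assumes "f \<oplus> g = Nul C (Dom C f) (Cod C f)" "f \<in> Ar C" "g \<in> Ar C" "Dom C g = Dom C f" "Cod C g = Cod C f"
  shows "Neg C f = g"
  by (rule Add_cancel[of f]) (use assms in auto)

text \<open>By bilinearity the composite is its own double, and in a group only the neutral element
  has this property.\<close>

lemma Cmp_Nul [simp]:
  assumes "g \<in> Ar C" "Dom C g = B" "A \<in> Ob C"
  shows "g \<cdot> Nul C A B = Nul C A (Cod C g)"
proof -
  have "g \<cdot> Nul C A B \<oplus> g \<cdot> Nul C A B = g \<cdot> (Nul C A B \<oplus> Nul C A B)"
    by (rule Cmp_Add_simp[symmetric]) (use assms in auto)
  then have "g \<cdot> Nul C A B \<oplus> g \<cdot> Nul C A B = g \<cdot> Nul C A B" using assms by auto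
  from idem_Nul[OF this] show ?thesis using assms by auto
qed

lemma preadditive_category_opp: "preadditive_category (opp C)"
  by (intro preadditive_category.intro category_opp preadditive_category_axioms.intro)
    (auto simp: Hom_iff intro: Hom_comm_group)

lemma Nul_Cmp [simp]:
  assumes "f \<in> Ar C" "Cod C f = A" "B \<in> Ob C"
  shows "Nul C A B \<cdot> f = Nul C (Dom C f) B"
  using preadditive_category.Cmp_Nul[OF preadditive_category_opp, of f A B] assms by simp

lemma Cmp_Neg [simp]:
  assumes "f \<in> Ar C" "g \<in> Ar C" "Cod C f = Dom C g"
  shows "g \<cdot> Neg C f = Neg C (g \<cdot> f)"
proof (rule Neg_unique[symmetric])
  have "g \<cdot> f \<oplus> g \<cdot> Neg C f = g \<cdot> (f \<oplus> Neg C f)" by (rule Cmp_Add_simp[symmetric]) (use assms in auto)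
  then show "g \<cdot> f \<oplus> g \<cdot> Neg C f = Nul C (Dom C (g \<cdot> f)) (Cod C (g \<cdot> f))" using assms by simp
qed (use assms in auto)

lemma Neg_Cmp [simp]:
  assumes "f \<in> Ar C" "g \<in> Ar C" "Cod C f = Dom C g"
  shows "Neg C g \<cdot> f = Neg C (g \<cdot> f)"
  using preadditive_category.Cmp_Neg[OF preadditive_category_opp, of g f] assms by simp

lemma Neg_Neg [simp]: "f \<in> Ar C \<Longrightarrow> Neg C (Neg C f) = f"
  by (rule Neg_unique) auto

lemma Neg_Nul [simp]: "A \<in> Ob C \<Longrightarrow> B \<in> Ob C \<Longrightarrow> Neg C (Nul C A B) = Nul C A B"
  by (rule Neg_unique) auto

lemma Add_left_comm:
  assumes "f \<in> Ar C" "g \<in> Ar C" "h \<in> Ar C" "Dom C g = Dom C f" "Cod C g = Cod C f"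
    "Dom C h = Dom C f" "Cod C h = Cod C f"
  shows "f \<oplus> (g \<oplus> h) = g \<oplus> (f \<oplus> h)"
  using Add_assoc[of f g h] Add_assoc[of g f h] Add_comm[of f g] assms by simp

lemma Neg_Add:
  assumes "f \<in> Ar C" "g \<in> Ar C" "Dom C g = Dom C f" "Cod C g = Cod C f"
  shows "Neg C (f \<oplus> g) = Neg C f \<oplus> Neg C g"
proof (rule Neg_unique)
  have "f \<oplus> g \<oplus> (Neg C f \<oplus> Neg C g) = f \<oplus> Neg C f \<oplus> (g \<oplus> Neg C g)"
    using assms by (simp add: Add_assoc Add_left_comm[of g "Neg C f"] del: Neg_simps(4,5))
  then show "f \<oplus> g \<oplus> (Neg C f \<oplus> Neg C g) = Nul C (Dom C (f \<oplus> g)) (Cod C (f \<oplus> g))"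
    using assms by simp
qed (use assms in auto)

lemma Diff_simps [simp]:
  assumes "f \<in> Ar C" "g \<in> Ar C" "Dom C g = Dom C f" "Cod C g = Cod C f"
  shows "Diff C f g \<in> Ar C" "Dom C (Diff C f g) = Dom C f" "Cod C (Diff C f g) = Cod C f"
  using assms by (auto simp: Diff_Neg)

lemma Diff_self [simp]: "f \<in> Ar C \<Longrightarrow> Diff C f f = Nul C (Dom C f) (Cod C f)"
  by (simp add: Diff_Neg)

lemma Diff_eq_Nul:
  assumes "Diff C f g = Nul C A B" "f \<in> Ar C" "g \<in> Ar C" "Dom C f = A" "Cod C f = B" "Dom C g = A" "Cod C g = B"
  shows "f = g"
proof -
  have "Neg C g \<oplus> f = Neg C g \<oplus> g" using assms Add_comm[of f "Neg C g"] by (simp add: Diff_Neg)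
  from Add_cancel[OF this] show ?thesis using assms by simp
qed

lemma Cmp_Diff [simp]:
  assumes "f \<in> Ar C" "f' \<in> Ar C" "g \<in> Ar C" "Dom C f' = Dom C f" "Cod C f' = Cod C f" "Cod C f = Dom C g"
  shows "g \<cdot> Diff C f f' = Diff C (g \<cdot> f) (g \<cdot> f')"
  using assms by (simp add: Diff_Neg)

lemma Diff_Cmp [simp]:
  assumes "f \<in> Ar C" "g \<in> Ar C" "g' \<in> Ar C" "Dom C g' = Dom C g" "Cod C g' = Cod C g" "Cod C f = Dom C g"
  shows "Diff C g g' \<cdot> f = Diff C (g \<cdot> f) (g' \<cdot> f)"
  using assms by (simp add: Diff_Neg)

lemma Add_Diff_cancel [simp]:
  assumes "f \<in> Ar C" "g \<in> Ar C" "Dom C g = Dom C f" "Cod C g = Cod C f"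
  shows "g \<oplus> Diff C f g = f" "Diff C f g \<oplus> g = f"
proof -
  show *: "Diff C f g \<oplus> g = f" using assms by (simp add: Diff_Neg Add_assoc)
  show "g \<oplus> Diff C f g = f" using * Add_comm[of g "Diff C f g"] assms by simp
qed

lemma Diff_unique:
  assumes "f = g \<oplus> h" "g \<in> Ar C" "h \<in> Ar C" "Dom C g = Dom C h" "Cod C g = Cod C h"
  shows "Diff C f g = h"
  by (rule Add_cancel[of g]) (use assms in auto)

lemma Diff_Diff [simp]:
  assumes "f \<in> Ar C" "g \<in> Ar C" "Dom C g = Dom C f" "Cod C g = Cod C f"
  shows "Diff C f (Diff C f g) = g"
  by (rule Diff_unique) (use assms in auto)

text \<open>Additivity reduces cancellation to zero arrows: the criterion is applied to the
  difference of the two arrows to be compared.\<close>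

lemma monoI:
  assumes "f \<in> Ar C"
    and "\<And>x. x \<in> Ar C \<Longrightarrow> Cod C x = Dom C f \<Longrightarrow> f \<cdot> x = Nul C (Dom C x) (Cod C f) \<Longrightarrow> x = Nul C (Dom C x) (Dom C f)"
  shows "is_mono C f"
  unfolding is_mono_def
proof (intro conjI ballI impI)
  fix T x y assume "T \<in> Ob C" "x \<in> Hom C T (Dom C f)" "y \<in> Hom C T (Dom C f)" and eq: "f \<cdot> x = f \<cdot> y"
  then have xy: "x \<in> Ar C" "y \<in> Ar C" "Dom C y = Dom C x" "Cod C y = Dom C f" "Cod C x = Dom C f" by (auto simp: Hom_iff)
  have "Diff C x y = Nul C (Dom C x) (Dom C f)"
    using assms(2)[of "Diff C x y"] assms(1) xy eq by auto
  then show "x = y" by (rule Diff_eq_Nul) (use xy in auto)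
qed (fact assms(1))

lemma epiI:
  assumes "f \<in> Ar C"
    and "\<And>x. x \<in> Ar C \<Longrightarrow> Dom C x = Cod C f \<Longrightarrow> x \<cdot> f = Nul C (Dom C f) (Cod C x) \<Longrightarrow> x = Nul C (Cod C f) (Cod C x)"
  shows "is_epi C f"
  using preadditive_category.monoI[OF preadditive_category_opp, of f] assms by simp

lemma mono_NulD:
  assumes "is_mono C f" "f \<cdot> x = Nul C (Dom C x) (Cod C f)" "x \<in> Ar C" "Cod C x = Dom C f"
  shows "x = Nul C (Dom C x) (Dom C f)"
proof (rule monoD[OF assms(1)])
  have "f \<in> Ar C" using assms(1) by (simp add: is_mono_def)
  then show "f \<cdot> x = f \<cdot> Nul C (Dom C x) (Dom C f)" "Nul C (Dom C x) (Dom C f) \<in> Ar C"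
    "Cod C (Nul C (Dom C x) (Dom C f)) = Dom C f" "Dom C x = Dom C (Nul C (Dom C x) (Dom C f))"
    using assms by auto
qed (use assms in auto)

lemma epi_NulD:
  assumes "is_epi C f" "x \<cdot> f = Nul C (Dom C f) (Cod C x)" "x \<in> Ar C" "Dom C x = Cod C f"
  shows "x = Nul C (Cod C f) (Cod C x)"
  using preadditive_category.mono_NulD[OF preadditive_category_opp, of f x] assms by simp

lemma kernel_mono:
  assumes "is_kernel C k f"
  shows "is_mono C k"
  unfolding is_mono_def
proof (intro conjI ballI impI)
  show "k \<in> Ar C" using assms by (simp add: is_kernel_def)
  fix T x y assume a: "T \<in> Ob C" "x \<in> Hom C T (Dom C k)" "y \<in> Hom C T (Dom C k)" "k \<cdot> x = k \<cdot> y"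
  have k: "k \<in> Ar C" "f \<in> Ar C" "Cod C k = Dom C f" "f \<cdot> k = Nul C (Dom C k) (Cod C f)"
    using assms by (auto simp: is_kernel_def)
  have "k \<cdot> x \<in> Hom C T (Dom C f)" "f \<cdot> (k \<cdot> x) = Nul C T (Cod C f)"
    using a k reassoc[OF k(4), of x] by (auto simp: Hom_iff)
  then have "\<exists>!z. z \<in> Hom C T (Dom C k) \<and> k \<cdot> z = k \<cdot> x"
    using assms a(1) by (simp add: is_kernel_def)
  then show "x = y" using a by metis
qed

lemma cokernel_epi: "is_cokernel C c f \<Longrightarrow> is_epi C c"
  using preadditive_category.kernel_mono[OF preadditive_category_opp, of c f] by simp

text \<open>For a monomorphism the uniqueness part of the universal property is automatic, so only
  existence of factorisations remains to be checked.\<close>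

lemma kernelI:
  assumes "is_mono C k" "f \<in> Ar C" "Cod C k = Dom C f" "f \<cdot> k = Nul C (Dom C k) (Cod C f)"
    and "\<And>h. h \<in> Ar C \<Longrightarrow> Cod C h = Dom C f \<Longrightarrow> f \<cdot> h = Nul C (Dom C h) (Cod C f) \<Longrightarrow>
           \<exists>x\<in>Ar C. Dom C x = Dom C h \<and> Cod C x = Dom C k \<and> k \<cdot> x = h"
  shows "is_kernel C k f"
  unfolding is_kernel_def
proof (intro conjI ballI impI)
  show k: "k \<in> Ar C" using assms(1) by (simp add: is_mono_def)
  fix T h assume "T \<in> Ob C" "h \<in> Hom C T (Dom C f)" "f \<cdot> h = Nul C T (Cod C f)"
  then obtain x where x: "x \<in> Hom C T (Dom C k) \<and> k \<cdot> x = h" using assms(5)[of h] by (auto simp: Hom_iff)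
  then show "\<exists>!x. x \<in> Hom C T (Dom C k) \<and> k \<cdot> x = h"
    using monoD[OF assms(1)] by (intro ex1I[of _ x]) (auto simp: Hom_iff)
qed (use assms in auto)

end

section \<open>Short exact sequences\<close>

lemma (in category) mono_compD:
  assumes "is_mono C (g \<cdot> f)" "f \<in> Ar C" "g \<in> Ar C" "Cod C f = Dom C g"
  shows "is_mono C f"
  unfolding is_mono_def
proof (intro conjI ballI impI)
  fix T x y assume "x \<in> Hom C T (Dom C f)" "y \<in> Hom C T (Dom C f)" "f \<cdot> x = f \<cdot> y"
  then show "x = y" using monoD[OF assms(1), of x y] assms by (simp add: Hom_iff)
qed (fact assms(2))

lemma (in category) epi_compD:
  assumes "is_epi C (g \<cdot> f)" "f \<in> Ar C" "g \<in> Ar C" "Cod C f = Dom C g"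
  shows "is_epi C g"
  using category.mono_compD[OF category_opp, of f g] assms by simp

section \<open>Kernels, cokernels, the five lemma and pull-backs in an abelian category\<close>

context abelian_category
begin

lemma abelian_category_opp: "abelian_category (opp C)"
  by (intro abelian_category.intro preadditive_category_opp abelian_category_axioms.intro;
      simp add: ex_zero_object ex_kernel ex_cokernel mono_normal epi_normal)
    (meson ex_biproduct)

lemma biprod_is_biproduct:
  assumes "A \<in> Ob C" "B \<in> Ob C"
  shows "is_biproduct C A B (bi_ob C A B) (bi_in1 C A B) (bi_in2 C A B) (bi_pr1 C A B) (bi_pr2 C A B)"
proof -
  let ?P = "\<lambda>(S, i1, i2, p1, p2). is_biproduct C A B S i1 i2 p1 p2"
  have "\<exists>t. ?P t" using ex_biproduct[OF assms] by auto
  then have "?P (biprod C A B)" unfolding biprod_def by (rule someI_ex)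
  then show ?thesis
    by (simp add: bi_ob_def bi_in1_def bi_in2_def bi_pr1_def bi_pr2_def split: prod.splits)
qed

text \<open>Since \<open>f\<close> kills \<open>k\<close>, it factors through \<open>c\<close>;
  whatever \<open>c\<close> kills is therefore killed by \<open>f\<close> and lifts along
  \<open>k\<close>.\<close>

lemma kernel_cokernel:
  assumes "is_kernel C k f" "is_cokernel C c k"
  shows "is_kernel C k c"
proof (rule kernelI)
  have k: "k \<in> Ar C" "f \<in> Ar C" "Cod C k = Dom C f" "f \<cdot> k = Nul C (Dom C k) (Cod C f)"
    using assms(1) by (auto simp: is_kernel_def)
  have c: "c \<in> Ar C" "Dom C c = Cod C k" "c \<cdot> k = Nul C (Dom C k) (Cod C c)"
    using assms(2) by (auto simp: is_cokernel_def)
  show "is_mono C k" using assms(1) by (rule kernel_mono)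
  show "c \<in> Ar C" "Cod C k = Dom C c" "c \<cdot> k = Nul C (Dom C k) (Cod C c)" using c by auto
  fix h assume h: "h \<in> Ar C" "Cod C h = Dom C c" "c \<cdot> h = Nul C (Dom C h) (Cod C c)"
  obtain t where t: "t \<in> Ar C" "Dom C t = Cod C c" "Cod C t = Cod C f" "t \<cdot> c = f"
    using cokernel_factor[OF assms(2), of f] k by auto
  have "f \<cdot> h = Nul C (Dom C h) (Cod C f)" using reassoc[OF t(4), of h] h t c by simp
  then obtain x where "x \<in> Ar C" "Dom C x = Dom C h" "Cod C x = Dom C k" "k \<cdot> x = h"
    using kernel_factor[OF assms(1), of h] h c k by auto
  then show "\<exists>x\<in>Ar C. Dom C x = Dom C h \<and> Cod C x = Dom C k \<and> k \<cdot> x = h" by blast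
qed

lemma cokernel_kernel: "is_cokernel C c f \<Longrightarrow> is_kernel C k c \<Longrightarrow> is_cokernel C c k"
  using abelian_category.kernel_cokernel[OF abelian_category_opp, of c f k] by simp

text \<open>The arrow \<open>k\<close> shows that \<open>f\<close> and \<open>g\<close> kill the
  same arrows. This allows the auxiliary image in \<open>exact_at\<close>, known only to exist, to
  be replaced by a given kernel.\<close>

lemma kernel_unique:
  assumes "is_kernel C k f" "is_kernel C k g" "is_kernel C k' f"
  shows "is_kernel C k' g"
proof (rule kernelI)
  have k: "k \<in> Ar C" "f \<in> Ar C" "Cod C k = Dom C f" "f \<cdot> k = Nul C (Dom C k) (Cod C f)"
    using assms(1) by (auto simp: is_kernel_def)
  have g: "g \<in> Ar C" "Cod C k = Dom C g" "g \<cdot> k = Nul C (Dom C k) (Cod C g)"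
    using assms(2) by (auto simp: is_kernel_def)
  have k': "k' \<in> Ar C" "Cod C k' = Dom C f" "f \<cdot> k' = Nul C (Dom C k') (Cod C f)"
    using assms(3) by (auto simp: is_kernel_def)
  show "is_mono C k'" using assms(3) by (rule kernel_mono)
  obtain x where x: "x \<in> Ar C" "Dom C x = Dom C k'" "Cod C x = Dom C k" "k \<cdot> x = k'"
    using kernel_factor[OF assms(1), of k'] k' by auto
  have "g \<cdot> k' = Nul C (Dom C k') (Cod C g)" using reassoc[OF g(3), of x] x g k by simp
  then show "g \<in> Ar C" "Cod C k' = Dom C g" "g \<cdot> k' = Nul C (Dom C k') (Cod C g)" using x g k' k by auto
  fix h assume h: "h \<in> Ar C" "Cod C h = Dom C g" "g \<cdot> h = Nul C (Dom C h) (Cod C g)"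
  obtain y where y: "y \<in> Ar C" "Dom C y = Dom C h" "Cod C y = Dom C k" "k \<cdot> y = h"
    using kernel_factor[OF assms(2), of h] h by auto
  have "f \<cdot> h = Nul C (Dom C h) (Cod C f)" using reassoc[OF k(4), of y] k y by simp
  then obtain x where "x \<in> Ar C" "Dom C x = Dom C h" "Cod C x = Dom C k'" "k' \<cdot> x = h"
    using kernel_factor[OF assms(3), of h] h g k by auto
  then show "\<exists>x\<in>Ar C. Dom C x = Dom C h \<and> Cod C x = Dom C k' \<and> k' \<cdot> x = h" by blast
qed

text \<open>The definition of exactness involves an image \<open>k\<close> of \<open>f\<close>. A
  monomorphism is a kernel, hence a kernel of its own cokernel, so \<open>f\<close> itself may take
  the place of \<open>k\<close>; dually for \<open>g\<close>. The right-hand side is manifestly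
  self-dual.\<close>

lemma short_exact_iff: "short_exact C f g \<longleftrightarrow> is_kernel C f g \<and> is_cokernel C g f"
proof
  assume se: "short_exact C f g"
  then obtain c k where ck: "is_cokernel C c f" "is_kernel C k c" "is_kernel C k g"
    by (auto simp: short_exact_def exact_at_def)
  obtain f0 where "is_kernel C f f0" using se mono_normal by (auto simp: short_exact_def)
  then have "is_kernel C f c" using ck(1) by (rule kernel_cokernel)
  with ck(2,3) have fg: "is_kernel C f g" by (rule kernel_unique)
  obtain g0 where "is_cokernel C g g0" using se epi_normal by (auto simp: short_exact_def)
  then show "is_kernel C f g \<and> is_cokernel C g f" using fg cokernel_kernel by blast
next
  assume a: "is_kernel C f g \<and> is_cokernel C g f"
  then show "short_exact C f g"
    using kernel_mono cokernel_epi by (auto simp: short_exact_def exact_at_def is_kernel_def)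
qed

lemma short_exact_opp [simp]: "short_exact (opp C) f g \<longleftrightarrow> short_exact C g f"
  using abelian_category.short_exact_iff[OF abelian_category_opp, of f g] short_exact_iff[of g f] by auto

lemma short_exactD:
  assumes "short_exact C f g"
  shows "f \<in> Ar C" "g \<in> Ar C" "Cod C f = Dom C g" "g \<cdot> f = Nul C (Dom C f) (Cod C g)"
    "is_mono C f" "is_epi C g"
  using assms by (auto simp: short_exact_iff is_kernel_def kernel_mono cokernel_epi)

lemma short_exact_lift:
  assumes "short_exact C f g" "h \<in> Ar C" "Cod C h = Dom C g" "g \<cdot> h = Nul C (Dom C h) (Cod C g)"
  obtains x where "x \<in> Ar C" "Dom C x = Dom C h" "Cod C x = Dom C f" "f \<cdot> x = h"
  using kernel_factor[of f g h] assms by (auto simp: short_exact_iff)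

lemma short_exact_descend:
  assumes "short_exact C f g" "h \<in> Ar C" "Dom C h = Dom C g" "h \<cdot> f = Nul C (Dom C f) (Cod C h)"
  obtains x where "x \<in> Ar C" "Dom C x = Cod C g" "Cod C x = Cod C h" "x \<cdot> g = h"
  using cokernel_factor[of g f h] assms short_exactD[OF assms(1)] by (auto simp: short_exact_iff)

lemma epi_short_exact:
  assumes "is_epi C g" "is_kernel C f g"
  shows "short_exact C f g"
  using epi_normal[OF assms(1)] assms cokernel_kernel by (auto simp: short_exact_iff)

text \<open>The monomorphism is a kernel of some \<open>g\<close>, and the epimorphism property
  forces \<open>g = 0\<close>; hence the identity factors through \<open>f\<close>, and the factor
  is the inverse.\<close>

lemma mono_epi_iso:
  assumes "is_mono C f" "is_epi C f"
  obtains n where "n \<in> Ar C" "Dom C n = Cod C f" "Cod C n = Dom C f" "f \<cdot> n = Ide C (Cod C f)"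
    "n \<cdot> f = Ide C (Dom C f)"
proof -
  obtain g where g: "is_kernel C f g" using assms(1) mono_normal by blast
  then have f: "f \<in> Ar C" "g \<in> Ar C" "Cod C f = Dom C g" "g \<cdot> f = Nul C (Dom C f) (Cod C g)"
    by (auto simp: is_kernel_def)
  have "g = Nul C (Cod C f) (Cod C g)" by (rule epi_NulD[OF assms(2)]) (use f in auto)
  then have "g \<cdot> Ide C (Cod C f) = Nul C (Dom C (Ide C (Cod C f))) (Cod C g)" using f by simp
  then obtain n where n: "n \<in> Ar C" "Dom C n = Cod C f" "Cod C n = Dom C f" "f \<cdot> n = Ide C (Cod C f)"
    using kernel_factor[OF g, of "Ide C (Cod C f)"] f by auto
  have "f \<cdot> n \<cdot> f = f \<cdot> Ide C (Dom C f)" using n f by (simp add: reassoc[OF n(4)])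
  then have "n \<cdot> f = Ide C (Dom C f)" by (rule monoD[OF assms(1)]) (use n f in auto)
  then show thesis using that n by blast
qed

text \<open>An arrow killed by \<open>m\<close> is killed by \<open>g\<close>, so it comes from an
  arrow \<open>y\<close> into the left end; there \<open>m\<close> acts as the monomorphism
  \<open>f'\<close>, which forces \<open>y = 0\<close>.\<close>

lemma five_lemma_mono:
  assumes "short_exact C f g" "short_exact C f' g'" "m \<in> Ar C" "Dom C m = Dom C g" "Cod C m = Dom C g'"
    "m \<cdot> f = f'" "g' \<cdot> m = g"
  shows "is_mono C m"
proof (rule monoI)
  note fg = short_exactD[OF assms(1)] and fg' = short_exactD[OF assms(2)]
  fix x assume x: "x \<in> Ar C" "Cod C x = Dom C m" "m \<cdot> x = Nul C (Dom C x) (Cod C m)"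
  have "g \<cdot> x = Nul C (Dom C x) (Cod C g')"
    using reassoc[OF assms(7), of x] x fg fg' assms(3-5) by simp
  moreover have "Cod C g' = Cod C g" using assms(3,5,7) fg' Cmp_simps(3)[of m g'] by simp
  ultimately obtain y where y: "y \<in> Ar C" "Dom C y = Dom C x" "Cod C y = Dom C f" "f \<cdot> y = x"
    using short_exact_lift[OF assms(1), of x] x assms(4) by auto
  have "f' \<cdot> y = Nul C (Dom C y) (Cod C m)"
    using reassoc[OF assms(6), of y] y fg x assms(3-5) by simp
  moreover have "Dom C f' = Dom C f" using fg assms(3-6) Cmp_simps(2)[of f m] by simp
  ultimately have "y = Nul C (Dom C y) (Dom C f')"
    using mono_NulD[OF fg'(5), of y] y x assms(3-5) fg' by auto
  then have "x = f \<cdot> Nul C (Dom C y) (Dom C f')" using y by auto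
  then show "x = Nul C (Dom C x) (Dom C m)" using fg x assms(3-5) y \<open>Dom C f' = Dom C f\<close> by simp
qed (use assms in auto)

text \<open>The epimorphism half is the dual of the monomorphism half. The last two conclusions say
  that the inverse is again a morphism of sequences with identity ends.\<close>

lemma five_lemma:
  assumes "short_exact C f g" "short_exact C f' g'" "m \<in> Ar C" "Dom C m = Dom C g" "Cod C m = Dom C g'"
    "m \<cdot> f = f'" "g' \<cdot> m = g"
  obtains n where "n \<in> Ar C" "Dom C n = Dom C g'" "Cod C n = Dom C g" "m \<cdot> n = Ide C (Dom C g')"
    "n \<cdot> m = Ide C (Dom C g)" "n \<cdot> f' = f" "g \<cdot> n = g'"
proof -
  note fg = short_exactD[OF assms(1)] and fg' = short_exactD[OF assms(2)]
  have "is_mono C m" by (rule five_lemma_mono[OF assms])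
  moreover have "is_epi C m"
    using abelian_category.five_lemma_mono[OF abelian_category_opp, of g' f' g f m] assms fg fg' by simp
  ultimately obtain n where n: "n \<in> Ar C" "Dom C n = Dom C g'" "Cod C n = Dom C g"
    "m \<cdot> n = Ide C (Dom C g')" "n \<cdot> m = Ide C (Dom C g)"
    using mono_epi_iso[of m] assms(3-5) by metis
  have "n \<cdot> f' = f" using reassoc[OF n(5), of f] n fg assms(3-6) by simp
  moreover have "g \<cdot> n = g'" using reassoc[OF assms(7), of n] n fg fg' assms(3-5) by simp
  ultimately
  show thesis using that n by blast
qed

text \<open>The fibre product is realised as the kernel of
  \<open>g \<cdot> p1 - x \<cdot> p2\<close> on a biproduct. The final conclusion is only the
  existence part of its universal property; uniqueness is \<open>pullback_unique\<close>.\<close>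

lemma pullback:
  assumes se: "short_exact C f g" and x: "x \<in> Ar C" "Cod C x = Cod C g"
  obtains f' g' m where "short_exact C f' g'" "Dom C f' = Dom C f" "Cod C g' = Dom C x"
    "m \<in> Ar C" "Dom C m = Dom C g'" "Cod C m = Dom C g" "m \<cdot> f' = f" "g \<cdot> m = x \<cdot> g'"
    "\<And>a b. a \<in> Ar C \<Longrightarrow> b \<in> Ar C \<Longrightarrow> Dom C a = Dom C b \<Longrightarrow> Cod C a = Dom C g \<Longrightarrow> Cod C b = Dom C x \<Longrightarrow>
       g \<cdot> a = x \<cdot> b \<Longrightarrow> \<exists>t\<in>Ar C. Dom C t = Dom C b \<and> Cod C t = Dom C g' \<and> m \<cdot> t = a \<and> g' \<cdot> t = b"
proof -
  note fg = short_exactD[OF se]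
  obtain S i1 i2 p1 p2 where "is_biproduct C (Dom C g) (Dom C x) S i1 i2 p1 p2"
    using ex_biproduct[of "Dom C g" "Dom C x"] fg x by auto
  then have b: "i1 \<in> Ar C" "Dom C i1 = Dom C g" "Cod C i1 = S" "i2 \<in> Ar C" "Dom C i2 = Dom C x" "Cod C i2 = S"
    "p1 \<in> Ar C" "Dom C p1 = S" "Cod C p1 = Dom C g" "p2 \<in> Ar C" "Dom C p2 = S" "Cod C p2 = Dom C x"
    and bi: "p1 \<cdot> i1 = Ide C (Dom C g)" "p2 \<cdot> i2 = Ide C (Dom C x)" "p2 \<cdot> i1 = Nul C (Dom C g) (Dom C x)"
    "p1 \<cdot> i2 = Nul C (Dom C x) (Dom C g)"
    and sum: "(i1 \<cdot> p1) \<oplus> (i2 \<cdot> p2) = Ide C S"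
    by (auto simp: is_biproduct_def Hom_iff)
  have S: "S \<in> Ob C" using Ob_simps(2)[of i1] b by simp
  define s where "s = Diff C (g \<cdot> p1) (x \<cdot> p2)"
  have s: "s \<in> Ar C" "Dom C s = S" "Cod C s = Cod C g" unfolding s_def using fg b x by auto
  have si: "s \<cdot> i1 = g" unfolding s_def using fg b x bi by (simp add: Diff_Neg)
  obtain k where ker: "is_kernel C k s" using ex_kernel s by blast
  then have k: "k \<in> Ar C" "Cod C k = S" "s \<cdot> k = Nul C (Dom C k) (Cod C g)" using s by (auto simp: is_kernel_def)
  \<comment> \<open>On the first summand \<open>s\<close> restricts to the epimorphism
    \<open>g\<close>.\<close>
  have sepi: "is_epi C s" using epi_compD[of s i1] fg b s si by simp
  define m g' where "m = p1 \<cdot> k" and "g' = p2 \<cdot> k"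
  have m: "m \<in> Ar C" "Dom C m = Dom C k" "Cod C m = Dom C g"
    and g': "g' \<in> Ar C" "Dom C g' = Dom C k" "Cod C g' = Dom C x"
    using b k by (auto simp: m_def g'_def)
  have "s \<cdot> k = Diff C (g \<cdot> m) (x \<cdot> g')"
    unfolding s_def m_def g'_def using fg(1-3) b x k(1,2) by simp
  then have "Diff C (g \<cdot> m) (x \<cdot> g') = Nul C (Dom C k) (Cod C g)" using k by simp
  then have comm: "g \<cdot> m = x \<cdot> g'" by (rule Diff_eq_Nul) (use m g' x fg in simp_all)
  have univ: "\<exists>t\<in>Ar C. Dom C t = Dom C b' \<and> Cod C t = Dom C g' \<and> m \<cdot> t = a \<and> g' \<cdot> t = b'"
    if a: "a \<in> Ar C" "b' \<in> Ar C" "Dom C a = Dom C b'" "Cod C a = Dom C g" "Cod C b' = Dom C x" "g \<cdot> a = x \<cdot> b'" for a b'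
  proof -
    define t0 where "t0 = i1 \<cdot> a \<oplus> i2 \<cdot> b'"
    have t0: "t0 \<in> Ar C" "Dom C t0 = Dom C b'" "Cod C t0 = S" using a b by (auto simp: t0_def)
    have pt: "p1 \<cdot> t0 = a" "p2 \<cdot> t0 = b'"
      using a b fg x by (simp_all add: t0_def reassoc[OF bi(1)] reassoc[OF bi(2)] reassoc[OF bi(3)] reassoc[OF bi(4)])
    have "s \<cdot> t0 = Nul C (Dom C t0) (Cod C s)"
      unfolding s_def using t0 pt b x fg a by simp
    then obtain t where t: "t \<in> Ar C" "Dom C t = Dom C t0" "Cod C t = Dom C k" "k \<cdot> t = t0"
      using kernel_factor[OF ker, of t0] t0 s by auto
    then have "m \<cdot> t = a" "g' \<cdot> t = b'" using pt b k by (simp_all add: m_def g'_def)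
    then show ?thesis using t t0 g' by auto
  qed
  \<comment> \<open>The two coordinates \<open>m\<close> and \<open>g'\<close> of the monomorphism
    \<open>k\<close> jointly detect zero.\<close>
  have joint: "z = Nul C (Dom C z) (Dom C k)"
    if z: "z \<in> Ar C" "Cod C z = Dom C k" "m \<cdot> z = Nul C (Dom C z) (Dom C g)" "g' \<cdot> z = Nul C (Dom C z) (Dom C x)" for z
  proof (rule mono_NulD[OF kernel_mono[OF ker]])
    have "k \<cdot> z = ((i1 \<cdot> p1) \<oplus> (i2 \<cdot> p2)) \<cdot> k \<cdot> z" using sum z k by simp
    also have "\<dots> = i1 \<cdot> m \<cdot> z \<oplus> i2 \<cdot> g' \<cdot> z" using z(1,2) k(1,2) b by (simp add: m_def g'_def)
    also have "\<dots> = Nul C (Dom C z) (Cod C k)" using z b k S by simp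
    finally show "k \<cdot> z = Nul C (Dom C z) (Cod C k)" .
  qed (use z in auto)
  have "\<exists>t\<in>Ar C. Dom C t = Dom C (Nul C (Dom C f) (Dom C x)) \<and> Cod C t = Dom C g' \<and> m \<cdot> t = f \<and> g' \<cdot> t = Nul C (Dom C f) (Dom C x)"
    by (rule univ) (use fg x in auto)
  then obtain f' where f': "f' \<in> Ar C" "Dom C f' = Dom C f" "Cod C f' = Dom C k" "m \<cdot> f' = f" "g' \<cdot> f' = Nul C (Dom C f) (Dom C x)"
    using fg x g' by auto
  \<comment> \<open>Stability of epimorphisms under pull-back, where normality enters: if
    \<open>z \<cdot> g' = 0\<close>, then \<open>z \<cdot> p2\<close> kills \<open>k\<close> and
    descends along \<open>s\<close> to some \<open>y\<close>. Restricting to the first summand,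
    where \<open>p2\<close> vanishes and \<open>s\<close> is \<open>g\<close>, gives
    \<open>y \<cdot> g = 0\<close>; thus \<open>y = 0\<close> and then \<open>z = 0\<close>.\<close>
  have "is_epi C g'"
  proof (rule epiI)
    fix z assume z: "z \<in> Ar C" "Dom C z = Cod C g'" "z \<cdot> g' = Nul C (Dom C g') (Cod C z)"
    have "short_exact C k s" using sepi ker by (rule epi_short_exact)
    moreover have "(z \<cdot> p2) \<cdot> k = Nul C (Dom C k) (Cod C (z \<cdot> p2))" using z g' b k by (simp add: g'_def)
    ultimately obtain y where y: "y \<in> Ar C" "Dom C y = Cod C g" "Cod C y = Cod C z" "y \<cdot> s = z \<cdot> p2"
      using short_exact_descend[of k s "z \<cdot> p2"] s b z g' by auto
    have "y \<cdot> g = (y \<cdot> s) \<cdot> i1" using y(1-3) s b by (simp add: si)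
    also have "\<dots> = Nul C (Dom C g) (Cod C z)" unfolding y(4) using z(1,2) b bi fg g' by simp
    finally have "y = Nul C (Cod C g) (Cod C y)" using epi_NulD[OF fg(6), of y] y by simp
    then have zp: "z \<cdot> p2 = Nul C S (Cod C z)" using y s fg z by (metis Nul_Cmp Ob_simps(2))
    have "z \<cdot> p2 \<cdot> i2 = Nul C (Dom C x) (Cod C z)" using reassoc[OF zp, of i2] z(1,2) b g' by simp
    then show "z = Nul C (Cod C g') (Cod C z)" using bi z(1,2) g' by simp
  qed (use g' in auto)
  moreover have "is_kernel C f' g'"
  proof (rule kernelI)
    show "is_mono C f'" using mono_compD[of m f'] fg f' m by simp
    fix h assume h: "h \<in> Ar C" "Cod C h = Dom C g'" "g' \<cdot> h = Nul C (Dom C h) (Cod C g')"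
    have "g \<cdot> m \<cdot> h = Nul C (Dom C h) (Cod C g)" using reassoc[OF comm, of h] h m g' x fg by simp
    then obtain y where y: "y \<in> Ar C" "Dom C y = Dom C h" "Cod C y = Dom C f" "f \<cdot> y = m \<cdot> h"
      using short_exact_lift[OF se, of "m \<cdot> h"] h m g' by auto
    have "Diff C (f' \<cdot> y) h = Nul C (Dom C (Diff C (f' \<cdot> y) h)) (Dom C k)"
      by (rule joint) (use y h f' m g' x fg in \<open>simp_all add: reassoc[OF f'(4)] reassoc[OF f'(5)]\<close>)
    then have "f' \<cdot> y = h" by (intro Diff_eq_Nul[of "f' \<cdot> y" h "Dom C h" "Dom C k"]) (use y h f' g' in auto)
    then show "\<exists>x\<in>Ar C. Dom C x = Dom C h \<and> Cod C x = Dom C f' \<and> f' \<cdot> x = h" using y f' by auto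
  qed (use f' g' in auto)
  ultimately have "short_exact C f' g'" by (rule epi_short_exact)
  then show thesis using that[of f' g' m] f' g' m comm univ by auto
qed

text \<open>The difference of \<open>z\<close> and \<open>z'\<close> is killed by \<open>g'\<close>,
  so it factors through \<open>f'\<close>; there \<open>m\<close> is the monomorphism
  \<open>f\<close>, and \<open>m\<close> kills the difference as well.\<close>

lemma pullback_unique:
  assumes "short_exact C f g" "short_exact C f' g'"
    and m: "m \<in> Ar C" "Dom C m = Dom C g'" "Cod C m = Dom C g" "m \<cdot> f' = f"
    and z: "z \<in> Ar C" "z' \<in> Ar C" "Cod C z = Dom C m" "Cod C z' = Dom C m" "Dom C z = Dom C z'"
      "m \<cdot> z = m \<cdot> z'" "g' \<cdot> z = g' \<cdot> z'"
  shows "z = z'"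
proof -
  note fg = short_exactD[OF assms(1)] and fg' = short_exactD[OF assms(2)]
  let ?d = "Diff C z z'"
  have d: "?d \<in> Ar C" "Dom C ?d = Dom C z'" "Cod C ?d = Dom C m" using z by auto
  have "g' \<cdot> ?d = Nul C (Dom C ?d) (Cod C g')" using z m fg' by simp
  then obtain y where y: "y \<in> Ar C" "Dom C y = Dom C z'" "Cod C y = Dom C f'" "f' \<cdot> y = ?d"
    using short_exact_lift[OF assms(2), of ?d] d m by metis
  have df: "Dom C f' = Dom C f" using m fg' Cmp_simps(2)[of f' m] by simp
  have "f \<cdot> y = Nul C (Dom C y) (Cod C f)" using reassoc[OF m(4), of y] y z m fg fg' by simp
  then have "y = Nul C (Dom C y) (Dom C f)" using mono_NulD[OF fg(5), of y] y df by simp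
  then have "?d = Nul C (Dom C z') (Dom C m)" using y fg' df m by (metis Cmp_Nul Ob_simps)
  then show ?thesis by (rule Diff_eq_Nul) (use z in auto)
qed

text \<open>Every morphism of short exact sequences that is the identity on the left has a pull-back
  square on the right: the comparison with the constructed pull-back is invertible by the five
  lemma, and the universal property is transported along its inverse.\<close>

lemma pullback_univ:
  assumes se: "short_exact C f g" "short_exact C f' g'"
    and m: "m \<in> Ar C" "Dom C m = Dom C g'" "Cod C m = Dom C g" "m \<cdot> f' = f"
      "x \<in> Ar C" "Dom C x = Cod C g'" "Cod C x = Cod C g" "g \<cdot> m = x \<cdot> g'"
    and a: "a \<in> Ar C" "b \<in> Ar C" "Dom C a = Dom C b" "Cod C a = Dom C g" "Cod C b = Dom C x" "g \<cdot> a = x \<cdot> b"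
  obtains t where "t \<in> Ar C" "Dom C t = Dom C b" "Cod C t = Dom C g'" "m \<cdot> t = a" "g' \<cdot> t = b"
proof -
  note fg = short_exactD[OF se(1)] and fg' = short_exactD[OF se(2)]
  obtain F G M where P: "short_exact C F G" "Dom C F = Dom C f" "Cod C G = Dom C x"
    "M \<in> Ar C" "Dom C M = Dom C G" "Cod C M = Dom C g" "M \<cdot> F = f" "g \<cdot> M = x \<cdot> G"
    and univ: "\<And>a b. a \<in> Ar C \<Longrightarrow> b \<in> Ar C \<Longrightarrow> Dom C a = Dom C b \<Longrightarrow> Cod C a = Dom C g \<Longrightarrow> Cod C b = Dom C x \<Longrightarrow>
       g \<cdot> a = x \<cdot> b \<Longrightarrow> \<exists>t\<in>Ar C. Dom C t = Dom C b \<and> Cod C t = Dom C G \<and> M \<cdot> t = a \<and> G \<cdot> t = b"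
    using pullback[OF se(1) m(5,7)] by metis
  note FG = short_exactD[OF P(1)]
  obtain c where c: "c \<in> Ar C" "Dom C c = Dom C g'" "Cod C c = Dom C G" "M \<cdot> c = m" "G \<cdot> c = g'"
    using univ[of m g'] m fg' by auto
  have df: "Dom C f' = Dom C f" using m fg' Cmp_simps(2)[of f' m] by simp
  have "c \<cdot> f' = F"
    by (rule pullback_unique[OF se(1) P(1), of M])
      (use P FG fg' c df m in \<open>simp_all add: reassoc[OF c(4)] reassoc[OF c(5)]\<close>)
  then obtain n where n: "n \<in> Ar C" "Dom C n = Dom C G" "Cod C n = Dom C g'" "c \<cdot> n = Ide C (Dom C G)"
    using five_lemma[OF se(2) P(1), of c] c by auto
  obtain t where t: "t \<in> Ar C" "Dom C t = Dom C b" "Cod C t = Dom C G" "M \<cdot> t = a" "G \<cdot> t = b"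
    using univ[of a b] a by auto
  have 1: "m \<cdot> n \<cdot> t = a"
    using reassoc[OF c(4), of "n \<cdot> t"] reassoc[OF n(4), of t] n t c P by simp
  have 2: "g' \<cdot> n \<cdot> t = b"
    using reassoc[OF c(5), of "n \<cdot> t"] reassoc[OF n(4), of t] n t c FG by simp
  show thesis by (rule that[of "n \<cdot> t"]) (use n t 1 2 in auto)
qed

end

section \<open>Extensions of degree one\<close>

declare One_nat_def [simp del]

definition ses :: "('o, 'm) cat \<Rightarrow> 'o \<Rightarrow> 'o \<Rightarrow> 'm list \<Rightarrow> bool" where
  "ses C X Y E \<longleftrightarrow> (\<exists>f g. E = [f, g] \<and> short_exact C f g \<and> Dom C f = Y \<and> Cod C g = X)"

text \<open>The middle arrow is quantified away because push-out, pull-back and equivalence of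
  extensions are all determined by the two ends.\<close>

definition mor :: "('o, 'm) cat \<Rightarrow> 'm list \<Rightarrow> 'm list \<Rightarrow> 'm \<Rightarrow> 'm \<Rightarrow> bool" where
  "mor C E E' a b \<longleftrightarrow> (\<exists>m. seq_morphism C E E' [a, m, b])"

text \<open>A single morphism in one direction is enough here: in degree one it is invertible, so
  this set is already the full Yoneda class, see \<open>Ext_equiv_class\<close>.\<close>

definition ext_class :: "('o, 'm) cat \<Rightarrow> 'o \<Rightarrow> 'o \<Rightarrow> 'm list \<Rightarrow> 'm list set" where
  "ext_class C X Y E = {E'. ses C X Y E' \<and> mor C E E' (Ide C Y) (Ide C X)}"

lemma seq_morphism_pair:
  "seq_morphism C [f, g] [f', g'] [a, m, b] \<longleftrightarrow>
     a \<in> Hom C (Dom C f) (Dom C f') \<and> m \<in> Hom C (Dom C g) (Dom C g') \<and> b \<in> Hom C (Cod C g) (Cod C g') \<and>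
     m \<cdot>\<^bsub>C\<^esub> f = f' \<cdot>\<^bsub>C\<^esub> a \<and> b \<cdot>\<^bsub>C\<^esub> g = g' \<cdot>\<^bsub>C\<^esub> m"
proof -
  have "(\<forall>i<length [f, g]. P i) \<longleftrightarrow> P 0 \<and> P 1" for P by (auto simp: less_Suc_eq One_nat_def)
  then show ?thesis unfolding seq_morphism_def by (auto simp: One_nat_def)
qed

lemma mor_pair:
  "mor C [f, g] [f', g'] a b \<longleftrightarrow>
     a \<in> Ar C \<and> Dom C a = Dom C f \<and> Cod C a = Dom C f' \<and> b \<in> Ar C \<and> Dom C b = Cod C g \<and> Cod C b = Cod C g' \<and>
     (\<exists>m\<in>Ar C. Dom C m = Dom C g \<and> Cod C m = Dom C g' \<and>
        m \<cdot>\<^bsub>C\<^esub> f = f' \<cdot>\<^bsub>C\<^esub> a \<and> b \<cdot>\<^bsub>C\<^esub> g = g' \<cdot>\<^bsub>C\<^esub> m)"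
  by (auto simp: mor_def seq_morphism_pair Hom_iff)

lemma n_exact_1:
  "n_exact C 1 X Y E \<longleftrightarrow> ses C X Y E"
  by (auto simp: n_exact_def ses_def short_exact_def length_Suc_conv One_nat_def)

section \<open>Morphisms of extensions and the universal properties of pull-back and
  push-out\<close>

context abelian_category
begin

lemma sesE:
  assumes "ses C X Y E"
  obtains f g where "E = [f, g]" "short_exact C f g" "Dom C f = Y" "Cod C g = X"
    "X \<in> Ob C" "Y \<in> Ob C"
  using assms short_exactD by (auto simp: ses_def)

lemma ses_opp [simp]: "ses (opp C) Y X (rev E) \<longleftrightarrow> ses C X Y E"
proof -
  have "ses (opp C) Y X (rev E) \<longleftrightarrow> (\<exists>f g. rev E = [g, f] \<and> short_exact C f g \<and> Dom C f = Y \<and> Cod C g = X)"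
    by (auto simp: ses_def)
  also have "\<dots> \<longleftrightarrow> ses C X Y E" by (auto simp: ses_def rev_swap)
  finally show ?thesis .
qed

lemma mor_opp:
  assumes "ses C X Y E" "ses C X' Y' E'"
  shows "mor (opp C) (rev E') (rev E) b a \<longleftrightarrow> mor C E E' a b"
proof -
  obtain f g where 1: "E = [f, g]" "short_exact C f g" using assms(1) by (rule sesE)
  obtain f' g' where 2: "E' = [f', g']" "short_exact C f' g'" using assms(2) by (rule sesE)
  show ?thesis
    using short_exactD[OF 1(2)] short_exactD[OF 2(2)] unfolding 1(1) 2(1)
    by (auto simp: mor_pair eq_commute)
qed

lemma mor_Ide:
  assumes "ses C X Y E" shows "mor C E E (Ide C Y) (Ide C X)"
proof -
  obtain f g where 1: "E = [f, g]" "short_exact C f g" "Dom C f = Y" "Cod C g = X" "X \<in> Ob C" "Y \<in> Ob C" using assms by (rule sesE)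
  show ?thesis
    using short_exactD[OF 1(2)] 1 by (auto simp: mor_pair intro!: bexI[of _ "Ide C (Dom C g)"])
qed

lemma mor_comp:
  assumes "ses C X Y E" "ses C X' Y' E'" "ses C X'' Y'' E''" "mor C E E' a b" "mor C E' E'' a' b'"
  shows "mor C E E'' (a' \<cdot> a) (b' \<cdot> b)"
proof -
  obtain f g where 1: "E = [f, g]" "short_exact C f g" using assms(1) by (rule sesE)
  obtain f' g' where 2: "E' = [f', g']" "short_exact C f' g'" using assms(2) by (rule sesE)
  obtain f'' g'' where 3: "E'' = [f'', g'']" "short_exact C f'' g''" using assms(3) by (rule sesE)
  note d = short_exactD[OF 1(2)] short_exactD[OF 2(2)] short_exactD[OF 3(2)]
  obtain m where m: "m \<in> Ar C" "Dom C m = Dom C g" "Cod C m = Dom C g'" "m \<cdot> f = f' \<cdot> a" "b \<cdot> g = g' \<cdot> m"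
    using assms(4) unfolding 1 2 by (auto simp: mor_pair)
  have ab: "a \<in> Ar C" "Dom C a = Dom C f" "Cod C a = Dom C f'" "b \<in> Ar C" "Dom C b = Cod C g" "Cod C b = Cod C g'"
    using assms(4) unfolding 1 2 by (auto simp: mor_pair)
  obtain m' where m': "m' \<in> Ar C" "Dom C m' = Dom C g'" "Cod C m' = Dom C g''" "m' \<cdot> f' = f'' \<cdot> a'" "b' \<cdot> g' = g'' \<cdot> m'"
    using assms(5) unfolding 2 3 by (auto simp: mor_pair)
  have ab': "a' \<in> Ar C" "Dom C a' = Dom C f'" "Cod C a' = Dom C f''" "b' \<in> Ar C" "Dom C b' = Cod C g'" "Cod C b' = Cod C g''"
    using assms(5) unfolding 2 3 by (auto simp: mor_pair)
  have "(m' \<cdot> m) \<cdot> f = f'' \<cdot> a' \<cdot> a" using reassoc[OF m'(4), of a] m m' d ab ab' by simp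
  moreover have "(b' \<cdot> b) \<cdot> g = g'' \<cdot> m' \<cdot> m" using reassoc[OF m'(5), of m] m m' d ab ab' by simp
  ultimately show ?thesis unfolding 1(1) 3(1) mor_pair
    by (intro conjI bexI[of _ "m' \<cdot> m"]) (use m(1-3) m'(1-3) d(1-3,7-9,13-15) ab ab' in simp_all)
qed

text \<open>By the five lemma the middle arrow is invertible. This is the point at which degree one
  is simpler than higher degrees, where such morphisms need not be invertible.\<close>

lemma mor_sym:
  assumes "ses C X Y E" "ses C X Y E'" "mor C E E' (Ide C Y) (Ide C X)"
  shows "mor C E' E (Ide C Y) (Ide C X)"
proof -
  obtain f g where 1: "E = [f, g]" "short_exact C f g" "Dom C f = Y" "Cod C g = X" "X \<in> Ob C" "Y \<in> Ob C" using assms(1) by (rule sesE)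
  obtain f' g' where 2: "E' = [f', g']" "short_exact C f' g'" "Dom C f' = Y" "Cod C g' = X" using assms(2) by (rule sesE)
  note d = short_exactD[OF 1(2)] short_exactD[OF 2(2)]
  obtain m where m: "m \<in> Ar C" "Dom C m = Dom C g" "Cod C m = Dom C g'" "m \<cdot> f = f'" "g' \<cdot> m = g"
    using assms(3) d 1(3,4) 2(3,4) unfolding 1(1) 2(1) by (auto simp: mor_pair)
  obtain n where "n \<in> Ar C" "Dom C n = Dom C g'" "Cod C n = Dom C g" "n \<cdot> f' = f" "g \<cdot> n = g'"
    using five_lemma[OF 1(2) 2(2) m] by metis
  then show ?thesis unfolding 1(1) 2(1) mor_pair
    by (intro conjI bexI[of _ n]) (use d(1-3,7-9) 1(3-) 2(3,4) in simp_all)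
qed

lemma pull_ex:
  assumes "ses C X Y E" "b \<in> Ar C" "Cod C b = X"
  obtains E' where "ses C (Dom C b) Y E'" "mor C E' E (Ide C Y) b"
proof -
  obtain f g where 1: "E = [f, g]" "short_exact C f g" "Dom C f = Y" "Cod C g = X" "X \<in> Ob C" "Y \<in> Ob C" using assms(1) by (rule sesE)
  obtain f' g' m where 2: "short_exact C f' g'" "Dom C f' = Dom C f" "Cod C g' = Dom C b"
    "m \<in> Ar C" "Dom C m = Dom C g'" "Cod C m = Dom C g" "m \<cdot> f' = f" "g \<cdot> m = b \<cdot> g'"
    using pullback[OF 1(2), of b] assms 1 by metis
  show thesis
  proof (rule that[of "[f', g']"])
    show "ses C (Dom C b) Y [f', g']" using 1(3) 2 by (auto simp: ses_def)
    show "mor C [f', g'] E (Ide C Y) b"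
      using 1 2 short_exactD[OF 1(2)] short_exactD[OF 2(1)] assms
      unfolding 1(1) mor_pair by (intro conjI bexI[of _ m]) simp_all
  qed
qed

text \<open>\<open>G\<close> is the pull-back of \<open>H\<close> along \<open>b\<close>. The middle
  arrow is obtained from \<open>pullback_univ\<close>, and \<open>pullback_unique\<close> shows that
  it has the prescribed left end. With its dual \<open>push_univ\<close> this replaces every
  explicit computation with extensions below.\<close>

lemma pull_univ:
  assumes "ses C X Y H" "ses C X' Y G" "mor C G H (Ide C Y) b" "ses C X'' Y'' F" "mor C F H a (b \<cdot> c)"
    "c \<in> Ar C" "Dom C c = X''" "Cod C c = X'"
  shows "mor C F G a c"
proof -
  obtain f g where 1: "H = [f, g]" "short_exact C f g" "Dom C f = Y" "Cod C g = X" "X \<in> Ob C" "Y \<in> Ob C" using assms(1) by (rule sesE)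
  obtain f' g' where 2: "G = [f', g']" "short_exact C f' g'" "Dom C f' = Y" "Cod C g' = X'" using assms(2) by (rule sesE)
  obtain f'' g'' where 3: "F = [f'', g'']" "short_exact C f'' g''" "Dom C f'' = Y''" "Cod C g'' = X''" using assms(4) by (rule sesE)
  note d = short_exactD[OF 1(2)] short_exactD[OF 2(2)] short_exactD[OF 3(2)]
  obtain m where m: "m \<in> Ar C" "Dom C m = Dom C g'" "Cod C m = Dom C g" "m \<cdot> f' = f"
    and b: "b \<in> Ar C" "Dom C b = Cod C g'" "Cod C b = Cod C g" "g \<cdot> m = b \<cdot> g'"
    using assms(3) 1(3,4) 2(3,4) d unfolding 1(1) 2(1) by (auto simp: mor_pair)
  obtain n where n: "n \<in> Ar C" "Dom C n = Dom C g''" "Cod C n = Dom C g" "n \<cdot> f'' = f \<cdot> a" "(b \<cdot> c) \<cdot> g'' = g \<cdot> n"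
    and a: "a \<in> Ar C" "Dom C a = Dom C f''" "Cod C a = Dom C f"
    using assms(5) unfolding 1(1) 3(1) by (auto simp: mor_pair)
  have cg: "c \<cdot> g'' \<in> Ar C" "Dom C n = Dom C (c \<cdot> g'')" "Cod C (c \<cdot> g'') = Dom C b" "g \<cdot> n = b \<cdot> c \<cdot> g''"
    using n d assms(6-) 2 3 b by auto
  obtain t where t: "t \<in> Ar C" "Dom C t = Dom C (c \<cdot> g'')" "Cod C t = Dom C g'" "m \<cdot> t = n" "g' \<cdot> t = c \<cdot> g''"
    using pullback_univ[OF 1(2) 2(2) m b n(1) cg(1,2) n(3) cg(3,4)] by metis
  have "t \<cdot> f'' = f' \<cdot> a"
  proof (rule pullback_unique[OF 1(2) 2(2) m])
    show "m \<cdot> t \<cdot> f'' = m \<cdot> f' \<cdot> a"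
      using reassoc[OF t(4), of f''] reassoc[OF m(4), of a] n a t m d 1 2 3 assms(6-) by simp
    show "g' \<cdot> t \<cdot> f'' = g' \<cdot> f' \<cdot> a"
      using reassoc[OF t(5), of f''] reassoc[OF d(10), of a] a t d 1(3) 2(3,4) 3(3,4) assms(6-) Ob_simps(1)[of f''] Ob_simps(2)[of g']
      by simp
  qed (use t n a m d 1 2 3 assms(6-) in auto)
  then show ?thesis unfolding 3(1) 2(1) mor_pair
    by (intro conjI bexI[of _ t]) (use t a d(1-3,7-9,13-15) 1(3) 2(3,4) 3(3,4) assms(6-) in simp_all)
qed

lemma push_ex:
  assumes "ses C X Y E" "a \<in> Ar C" "Dom C a = Y"
  obtains E' where "ses C X (Cod C a) E'" "mor C E E' a (Ide C X)"
proof -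
  obtain E' where E': "ses (opp C) (Cod C a) X E'" "mor (opp C) E' (rev E) (Ide C X) a"
    using abelian_category.pull_ex[OF abelian_category_opp, of Y X "rev E" a] assms by auto
  then have s: "ses C X (Cod C a) (rev E')"
    using ses_opp[of "Cod C a" X "rev E'"] by simp
  then show thesis using that[of "rev E'"] mor_opp[OF assms(1) s, of "Ide C X" a] E' by simp
qed

lemma push_univ:
  assumes "ses C X Y F" "ses C X Y' G" "mor C F G a (Ide C X)" "ses C X' Y'' H" "mor C F H (c \<cdot> a) b"
    "c \<in> Ar C" "Dom C c = Y'" "Cod C c = Y''"
  shows "mor C G H c b"
  using abelian_category.pull_univ[OF abelian_category_opp, of Y X "rev F" Y' "rev G" a Y'' X' "rev H" b c]
    assms by (simp add: mor_opp[OF assms(1,2)] mor_opp[OF assms(1,4)] mor_opp[OF assms(2,4)])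

section \<open>Yoneda classes of degree one, their push-forward and pull-back\<close>

lemma Ext_step_iff:
  "(E, E') \<in> Ext_step C 1 X Y \<longleftrightarrow> ses C X Y E \<and> ses C X Y E' \<and> mor C E E' (Ide C Y) (Ide C X)"
proof -
  have "seq_morphism C E E' h \<and> hd h = Ide C Y \<and> last h = Ide C X \<longleftrightarrow>
      (\<exists>m. h = [Ide C Y, m, Ide C X] \<and> seq_morphism C E E' [Ide C Y, m, Ide C X])"
    if "ses C X Y E" for h
  proof
    assume a: "seq_morphism C E E' h \<and> hd h = Ide C Y \<and> last h = Ide C X"
    then have "length h = Suc (Suc (Suc 0))" using that by (auto simp: seq_morphism_def ses_def)
    then show "\<exists>m. h = [Ide C Y, m, Ide C X] \<and> seq_morphism C E E' [Ide C Y, m, Ide C X]"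
      using a by (auto simp: length_Suc_conv)
  qed auto
  then show ?thesis by (auto simp: Ext_step_def mor_def n_exact_1)
qed

text \<open>Each step of a zigzag can be turned around by \<open>mor_sym\<close>, and the resulting
  chain composes to one morphism.\<close>

lemma Ext_equiv_iff:
  assumes "ses C X Y E"
  shows "(E, E') \<in> Ext_equiv C 1 X Y \<longleftrightarrow> ses C X Y E' \<and> mor C E E' (Ide C Y) (Ide C X)"
proof
  assume "(E, E') \<in> Ext_equiv C 1 X Y"
  then show "ses C X Y E' \<and> mor C E E' (Ide C Y) (Ide C X)" unfolding Ext_equiv_def
  proof (induction rule: rtrancl_induct)
    case base then show ?case using assms mor_Ide by auto
  next
    case (step F G)
    then have FG: "ses C X Y F" "ses C X Y G" "mor C F G (Ide C Y) (Ide C X)"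
      using mor_sym by (auto simp: Ext_step_iff)
    have "X \<in> Ob C" "Y \<in> Ob C" using assms by (auto elim: sesE)
    then show ?case using mor_comp[OF assms FG(1,2) _ FG(3)] step FG by fastforce
  qed
qed (use assms in \<open>auto simp: Ext_equiv_def Ext_step_iff\<close>)

lemma Ext_equiv_class: "ses C X Y E \<Longrightarrow> Ext_equiv C 1 X Y `` {E} = ext_class C X Y E"
  by (auto simp: ext_class_def Ext_equiv_iff)

lemma ext_class_self: "ses C X Y E \<Longrightarrow> E \<in> ext_class C X Y E"
  by (simp add: ext_class_def mor_Ide)

lemma mor_trans:
  assumes "ses C X Y E" "ses C X Y F" "ses C X Y G" "mor C E F (Ide C Y) (Ide C X)" "mor C F G (Ide C Y) (Ide C X)"
  shows "mor C E G (Ide C Y) (Ide C X)"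
proof -
  have "X \<in> Ob C" "Y \<in> Ob C" using assms(1) by (auto elim: sesE)
  then show ?thesis using mor_comp[OF assms] by simp
qed

lemma ext_class_eq_iff:
  assumes "ses C X Y E" "ses C X Y E'"
  shows "ext_class C X Y E = ext_class C X Y E' \<longleftrightarrow> mor C E E' (Ide C Y) (Ide C X)"
proof
  assume "ext_class C X Y E = ext_class C X Y E'"
  then show "mor C E E' (Ide C Y) (Ide C X)" using ext_class_self[OF assms(2)] by (auto simp: ext_class_def)
next
  assume m: "mor C E E' (Ide C Y) (Ide C X)"
  then have "mor C E' E (Ide C Y) (Ide C X)" by (rule mor_sym[OF assms])
  then show "ext_class C X Y E = ext_class C X Y E'"
    using m mor_trans assms unfolding ext_class_def by blast
qed

text \<open>Push-forward, pull-back and Baer sum are defined as saturations of sets of sequences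
  that are in general not whole classes. Such a saturation is the class of any one member once the
  set stays inside a single class.\<close>

lemma Ext_equiv_Image:
  assumes "ses C X Y E" "E \<in> S" "S \<subseteq> ext_class C X Y E"
  shows "Ext_equiv C 1 X Y `` S = ext_class C X Y E"
proof -
  have "Ext_equiv C 1 X Y `` {F} = ext_class C X Y E" if "F \<in> S" for F
    using that assms Ext_equiv_class[of X Y F] ext_class_eq_iff[of X Y E F] by (auto simp: ext_class_def)
  then show ?thesis using assms(2) by blast
qed

lemma carrier_Ext: "carrier (Ext C 1 X Y) = {ext_class C X Y E |E. ses C X Y E}"
  by (auto simp: Ext_def quotient_def n_exact_1 Ext_equiv_class)

text \<open>Any push-out \<open>G\<close> of any sequence equivalent to \<open>E\<close> also
  receives a morphism from \<open>E\<close> itself; by the universal property of \<open>E'\<close>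
  it is then equivalent to \<open>E'\<close>.\<close>

lemma Ext_push_class:
  assumes "ses C X Y E" "ses C X Y' E'" "mor C E E' a (Ide C X)"
  shows "Ext_push C 1 X a (ext_class C X Y E) = ext_class C X Y' E'"
proof -
  have X: "X \<in> Ob C" "Y \<in> Ob C" "Y' \<in> Ob C" using assms(1,2) by (auto elim: sesE)
  have a: "a \<in> Ar C" "Dom C a = Y" "Cod C a = Y'" using assms by (auto elim!: sesE simp: mor_pair)
  have hdlast: "(\<exists>h. seq_morphism C F G h \<and> hd h = a \<and> last h = Ide C X) \<longleftrightarrow> mor C F G a (Ide C X)"
    if "ses C X Y F" for F G
  proof
    assume "\<exists>h. seq_morphism C F G h \<and> hd h = a \<and> last h = Ide C X"
    then obtain h where h: "seq_morphism C F G h" "hd h = a" "last h = Ide C X" by blast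
    then have "length h = Suc (Suc (Suc 0))" using that by (auto simp: seq_morphism_def ses_def)
    then show "mor C F G a (Ide C X)" using h by (auto simp: length_Suc_conv mor_def)
  qed (auto simp: mor_def)
  have 1: "mor C E' G (Ide C Y') (Ide C X)" if "F \<in> ext_class C X Y E" "ses C X Y' G" "mor C F G a (Ide C X)" for F G
  proof -
    have "mor C E G (a \<cdot> Ide C Y) (Ide C X \<cdot> Ide C X)"
      by (rule mor_comp[OF assms(1) _ that(2) _ that(3)]) (use that(1) in \<open>auto simp: ext_class_def\<close>)
    then show ?thesis by (intro push_univ[OF assms that(2)]) (use a X in auto)
  qed
  show ?thesis unfolding Ext_push_def a n_exact_1
  proof (rule Ext_equiv_Image[OF assms(2)])
    show "E' \<in> {E'. ses C X Y' E' \<and> (\<exists>E\<in>ext_class C X Y E. \<exists>h. seq_morphism C E E' h \<and> hd h = a \<and> last h = Ide C X)}"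
      using assms hdlast ext_class_self by blast
    show "{E'. ses C X Y' E' \<and> (\<exists>E\<in>ext_class C X Y E. \<exists>h. seq_morphism C E E' h \<and> hd h = a \<and> last h = Ide C X)} \<subseteq> ext_class C X Y' E'"
      using 1 hdlast unfolding ext_class_def by blast
  qed
qed

lemma Ext_pull_class:
  assumes "ses C X Y E" "ses C X' Y E'" "mor C E' E (Ide C Y) b"
  shows "Ext_pull C 1 Y b (ext_class C X Y E) = ext_class C X' Y E'"
proof -
  have X: "X \<in> Ob C" "Y \<in> Ob C" "X' \<in> Ob C" using assms(1,2) by (auto elim: sesE)
  have b: "b \<in> Ar C" "Dom C b = X'" "Cod C b = X" using assms by (auto elim!: sesE simp: mor_pair)
  have hdlast: "(\<exists>h. seq_morphism C G F h \<and> hd h = Ide C Y \<and> last h = b) \<longleftrightarrow> mor C G F (Ide C Y) b"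
    if "ses C X Y F" for F G
  proof
    assume "\<exists>h. seq_morphism C G F h \<and> hd h = Ide C Y \<and> last h = b"
    then obtain h where h: "seq_morphism C G F h" "hd h = Ide C Y" "last h = b" by blast
    then have "length h = Suc (Suc (Suc 0))" using that by (auto simp: seq_morphism_def ses_def)
    then show "mor C G F (Ide C Y) b" using h by (auto simp: length_Suc_conv mor_def)
  qed (auto simp: mor_def)
  have 1: "mor C E' G (Ide C Y) (Ide C X')" if "F \<in> ext_class C X Y E" "ses C X' Y G" "mor C G F (Ide C Y) b" for F G
  proof -
    have F: "ses C X Y F" "mor C F E (Ide C Y) (Ide C X)"
      using that(1) mor_sym[OF assms(1)] by (auto simp: ext_class_def)
    have "mor C G E (Ide C Y \<cdot> Ide C Y) (Ide C X \<cdot> b)"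
      by (rule mor_comp[OF that(2) F(1) assms(1) that(3) F(2)])
    then have "mor C G E' (Ide C Y) (Ide C X')" by (intro pull_univ[OF assms that(2)]) (use b X in auto)
    then show ?thesis by (rule mor_sym[OF that(2) assms(2)])
  qed
  show ?thesis unfolding Ext_pull_def b n_exact_1
  proof (rule Ext_equiv_Image[OF assms(2)])
    show "E' \<in> {E'. ses C X' Y E' \<and> (\<exists>E\<in>ext_class C X Y E. \<exists>h. seq_morphism C E' E h \<and> hd h = Ide C Y \<and> last h = b)}"
      using assms hdlast ext_class_self by blast
    show "{E'. ses C X' Y E' \<and> (\<exists>E\<in>ext_class C X Y E. \<exists>h. seq_morphism C E' E h \<and> hd h = Ide C Y \<and> last h = b)} \<subseteq> ext_class C X' Y E'"
      using 1 hdlast unfolding ext_class_def by blast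
  qed
qed

end

section \<open>The Baer sum\<close>

context preadditive_category
begin

lemma biproductD:
  assumes "is_biproduct C A B S i1 i2 p1 p2"
  shows "i1 \<in> Ar C" "Dom C i1 = A" "Cod C i1 = S" "i2 \<in> Ar C" "Dom C i2 = B" "Cod C i2 = S"
    "p1 \<in> Ar C" "Dom C p1 = S" "Cod C p1 = A" "p2 \<in> Ar C" "Dom C p2 = S" "Cod C p2 = B"
    "A \<in> Ob C" "B \<in> Ob C" "S \<in> Ob C"
    "p1 \<cdot> i1 = Ide C A" "p2 \<cdot> i2 = Ide C B" "p2 \<cdot> i1 = Nul C A B" "p1 \<cdot> i2 = Nul C B A"
    "(i1 \<cdot> p1) \<oplus> (i2 \<cdot> p2) = Ide C S"
  using assms Ob_simps by (auto simp: is_biproduct_def Hom_iff)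

lemma biproduct_joint:
  assumes "is_biproduct C A B S i1 i2 p1 p2" "x \<in> Ar C" "y \<in> Ar C" "Cod C x = S" "Cod C y = S"
    "Dom C y = Dom C x" "p1 \<cdot> x = p1 \<cdot> y" "p2 \<cdot> x = p2 \<cdot> y"
  shows "x = y"
proof -
  note b = biproductD[OF assms(1)]
  have "((i1 \<cdot> p1) \<oplus> (i2 \<cdot> p2)) \<cdot> x = ((i1 \<cdot> p1) \<oplus> (i2 \<cdot> p2)) \<cdot> y"
    using b(1-12) assms(2-) by simp
  then show ?thesis using b(20) assms by simp
qed

text \<open>Stated for arbitrary biproducts instead of \<open>bi_map\<close>, because it is also
  applied in \<open>opp C\<close>: there the biproducts chosen in \<open>C\<close>, with injections
  and projections exchanged, are still biproducts, but not necessarily the chosen ones.\<close>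

lemma biproduct_kernel:
  assumes S: "is_biproduct C A A' S i1 i2 p1 p2" and T: "is_biproduct C B B' T j1 j2 q1 q2"
    and U: "is_biproduct C D D' U k1 k2 r1 r2"
    and F: "F \<in> Ar C" "Dom C F = S" "Cod C F = T" "q1 \<cdot> F = f \<cdot> p1" "q2 \<cdot> F = f' \<cdot> p2"
    and G: "G \<in> Ar C" "Dom C G = T" "Cod C G = U" "r1 \<cdot> G = g \<cdot> q1" "r2 \<cdot> G = g' \<cdot> q2"
    and ker: "is_kernel C f g" "is_kernel C f' g'"
    and ty: "Dom C f = A" "Cod C f = B" "Cod C g = D" "Dom C f' = A'" "Cod C f' = B'" "Cod C g' = D'"
  shows "is_kernel C F G"
proof -
  note s = biproductD[OF S] and t = biproductD[OF T] and u = biproductD[OF U]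
  have f: "f \<in> Ar C" "g \<in> Ar C" "Dom C g = B" "g \<cdot> f = Nul C A D"
    using ker(1) ty by (auto simp: is_kernel_def)
  have f': "f' \<in> Ar C" "g' \<in> Ar C" "Dom C g' = B'" "g' \<cdot> f' = Nul C A' D'"
    using ker(2) ty by (auto simp: is_kernel_def)
  show ?thesis
  proof (rule kernelI)
    show "is_mono C F"
    proof (rule monoI)
      fix x assume x: "x \<in> Ar C" "Cod C x = Dom C F" "F \<cdot> x = Nul C (Dom C x) (Cod C F)"
      have 1: "p1 \<cdot> x = Nul C (Dom C (p1 \<cdot> x)) (Dom C f)"
        by (rule mono_NulD[OF kernel_mono[OF ker(1)]])
          (use reassoc[OF F(4), of x] x F s t ty f in simp_all)
      have 2: "p2 \<cdot> x = Nul C (Dom C (p2 \<cdot> x)) (Dom C f')"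
        by (rule mono_NulD[OF kernel_mono[OF ker(2)]])
          (use reassoc[OF F(5), of x] x F s t ty f' in simp_all)
      have "Dom C (p1 \<cdot> x) = Dom C x" "Dom C (p2 \<cdot> x) = Dom C x" using x(1,2) F s by simp_all
      note n = 1[unfolded this] 2[unfolded this]
      show "x = Nul C (Dom C x) (Dom C F)"
        by (rule biproduct_joint[OF S]) (use n x F s ty in simp_all)
    qed (fact F(1))
    show "G \<cdot> F = Nul C (Dom C F) (Cod C G)"
    proof (rule biproduct_joint[OF U])
      show "r1 \<cdot> G \<cdot> F = r1 \<cdot> Nul C (Dom C F) (Cod C G)"
        using reassoc[OF G(4), of F] reassoc[OF f(4), of p1] F G s t u ty f by simp
      show "r2 \<cdot> G \<cdot> F = r2 \<cdot> Nul C (Dom C F) (Cod C G)"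
        using reassoc[OF G(5), of F] reassoc[OF f'(4), of p2] F G s t u ty f' by simp
    qed (use F G s u in simp_all)
    fix h assume h: "h \<in> Ar C" "Cod C h = Dom C G" "G \<cdot> h = Nul C (Dom C h) (Cod C G)"
    have "g \<cdot> q1 \<cdot> h = Nul C (Dom C h) D" using reassoc[OF G(4), of h] h G t u ty f by simp
    then obtain x where x: "x \<in> Ar C" "Dom C x = Dom C h" "Cod C x = A" "f \<cdot> x = q1 \<cdot> h"
      using kernel_factor[OF ker(1), of "q1 \<cdot> h"] h t f G ty by auto
    have "g' \<cdot> q2 \<cdot> h = Nul C (Dom C h) D'" using reassoc[OF G(5), of h] h G t u ty f' by simp
    then obtain y where y: "y \<in> Ar C" "Dom C y = Dom C h" "Cod C y = A'" "f' \<cdot> y = q2 \<cdot> h"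
      using kernel_factor[OF ker(2), of "q2 \<cdot> h"] h t f' G ty by auto
    define z where "z = i1 \<cdot> x \<oplus> i2 \<cdot> y"
    have z: "z \<in> Ar C" "Dom C z = Dom C h" "Cod C z = S" using x y s by (auto simp: z_def)
    have pz: "p1 \<cdot> z = x" "p2 \<cdot> z = y"
      using x y s by (simp_all add: z_def reassoc[OF s(16)] reassoc[OF s(17)] reassoc[OF s(18)] reassoc[OF s(19)])
    have "F \<cdot> z = h"
    proof (rule biproduct_joint[OF T])
      show "q1 \<cdot> F \<cdot> z = q1 \<cdot> h" using reassoc[OF F(4), of z] pz x z F s t ty f by simp
      show "q2 \<cdot> F \<cdot> z = q2 \<cdot> h" using reassoc[OF F(5), of z] pz y z F s t ty f' by simp
    qed (use z F G h in simp_all)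
    then show "\<exists>x\<in>Ar C. Dom C x = Dom C h \<and> Cod C x = Dom C F \<and> F \<cdot> x = h" using z F by auto
  qed (use F G in simp_all)
qed

end

context abelian_category
begin

lemma biprod_simps [simp]:
  assumes "A \<in> Ob C" "B \<in> Ob C"
  shows "bi_in1 C A B \<in> Ar C" "Dom C (bi_in1 C A B) = A" "Cod C (bi_in1 C A B) = bi_ob C A B"
    "bi_in2 C A B \<in> Ar C" "Dom C (bi_in2 C A B) = B" "Cod C (bi_in2 C A B) = bi_ob C A B"
    "bi_pr1 C A B \<in> Ar C" "Dom C (bi_pr1 C A B) = bi_ob C A B" "Cod C (bi_pr1 C A B) = A"
    "bi_pr2 C A B \<in> Ar C" "Dom C (bi_pr2 C A B) = bi_ob C A B" "Cod C (bi_pr2 C A B) = B"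
    "bi_ob C A B \<in> Ob C"
    "bi_pr1 C A B \<cdot> bi_in1 C A B = Ide C A" "bi_pr2 C A B \<cdot> bi_in2 C A B = Ide C B"
    "bi_pr2 C A B \<cdot> bi_in1 C A B = Nul C A B" "bi_pr1 C A B \<cdot> bi_in2 C A B = Nul C B A"
  using biproductD[OF biprod_is_biproduct[OF assms]] by auto

lemma biprod_reassoc [simp]:
  assumes "A \<in> Ob C" "B \<in> Ob C" "x \<in> Ar C"
  shows "Cod C x = A \<Longrightarrow> bi_pr1 C A B \<cdot> bi_in1 C A B \<cdot> x = x"
    "Cod C x = B \<Longrightarrow> bi_pr2 C A B \<cdot> bi_in2 C A B \<cdot> x = x"
    "Cod C x = A \<Longrightarrow> bi_pr2 C A B \<cdot> bi_in1 C A B \<cdot> x = Nul C (Dom C x) B"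
    "Cod C x = B \<Longrightarrow> bi_pr1 C A B \<cdot> bi_in2 C A B \<cdot> x = Nul C (Dom C x) A"
  using assms reassoc[OF biprod_simps(14)[OF assms(1,2)], of x] reassoc[OF biprod_simps(15)[OF assms(1,2)], of x]
    reassoc[OF biprod_simps(16)[OF assms(1,2)], of x] reassoc[OF biprod_simps(17)[OF assms(1,2)], of x]
  by auto

lemma biprod_eqI:
  assumes "A \<in> Ob C" "B \<in> Ob C" "x \<in> Ar C" "y \<in> Ar C" "Cod C x = bi_ob C A B" "Cod C y = bi_ob C A B"
    "Dom C y = Dom C x" "bi_pr1 C A B \<cdot> x = bi_pr1 C A B \<cdot> y" "bi_pr2 C A B \<cdot> x = bi_pr2 C A B \<cdot> y"
  shows "x = y"
  by (rule biproduct_joint[OF biprod_is_biproduct]) (use assms in auto)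

lemma bi_map_simps [simp]:
  assumes "f \<in> Ar C" "g \<in> Ar C"
  shows "bi_map C f g \<in> Ar C" "Dom C (bi_map C f g) = bi_ob C (Dom C f) (Dom C g)"
    "Cod C (bi_map C f g) = bi_ob C (Cod C f) (Cod C g)"
  using assms by (auto simp: bi_map_def)

lemma bi_map_Cmp [simp]:
  assumes "f \<in> Ar C" "g \<in> Ar C" "x \<in> Ar C"
  shows "Cod C x = A \<Longrightarrow> Dom C f = A \<Longrightarrow> Dom C g = B \<Longrightarrow> bi_map C f g \<cdot> bi_in1 C A B \<cdot> x = bi_in1 C (Cod C f) (Cod C g) \<cdot> f \<cdot> x"
    "Cod C x = B \<Longrightarrow> Dom C f = A \<Longrightarrow> Dom C g = B \<Longrightarrow> bi_map C f g \<cdot> bi_in2 C A B \<cdot> x = bi_in2 C (Cod C f) (Cod C g) \<cdot> g \<cdot> x"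
    "Cod C x = bi_ob C (Dom C f) (Dom C g) \<Longrightarrow> Cod C f = A' \<Longrightarrow> Cod C g = B' \<Longrightarrow>
      bi_pr1 C A' B' \<cdot> bi_map C f g \<cdot> x = f \<cdot> bi_pr1 C (Dom C f) (Dom C g) \<cdot> x"
    "Cod C x = bi_ob C (Dom C f) (Dom C g) \<Longrightarrow> Cod C f = A' \<Longrightarrow> Cod C g = B' \<Longrightarrow>
      bi_pr2 C A' B' \<cdot> bi_map C f g \<cdot> x = g \<cdot> bi_pr2 C (Dom C f) (Dom C g) \<cdot> x"
  using assms by (auto simp: bi_map_def)

lemma bi_map_Cmp' [simp]:
  assumes "f \<in> Ar C" "g \<in> Ar C"
  shows "Dom C f = A \<Longrightarrow> Dom C g = B \<Longrightarrow> bi_map C f g \<cdot> bi_in1 C A B = bi_in1 C (Cod C f) (Cod C g) \<cdot> f"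
    "Dom C f = A \<Longrightarrow> Dom C g = B \<Longrightarrow> bi_map C f g \<cdot> bi_in2 C A B = bi_in2 C (Cod C f) (Cod C g) \<cdot> g"
    "Cod C f = A' \<Longrightarrow> Cod C g = B' \<Longrightarrow> bi_pr1 C A' B' \<cdot> bi_map C f g = f \<cdot> bi_pr1 C (Dom C f) (Dom C g)"
    "Cod C f = A' \<Longrightarrow> Cod C g = B' \<Longrightarrow> bi_pr2 C A' B' \<cdot> bi_map C f g = g \<cdot> bi_pr2 C (Dom C f) (Dom C g)"
  using assms by (auto simp: bi_map_def)

lemma bi_map_comp:
  assumes "f \<in> Ar C" "g \<in> Ar C" "f' \<in> Ar C" "g' \<in> Ar C" "Cod C f = Dom C f'" "Cod C g = Dom C g'"
  shows "bi_map C f' g' \<cdot> bi_map C f g = bi_map C (f' \<cdot> f) (g' \<cdot> g)"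
  by (rule biprod_eqI[of "Cod C f'" "Cod C g'"]) (use assms in simp_all)

lemma bi_map_Ide: "A \<in> Ob C \<Longrightarrow> B \<in> Ob C \<Longrightarrow> bi_map C (Ide C A) (Ide C B) = Ide C (bi_ob C A B)"
  by (rule biprod_eqI[of A B]) simp_all

lemma short_exact_bi_map:
  assumes "short_exact C f g" "short_exact C f' g'"
  shows "short_exact C (bi_map C f f') (bi_map C g g')"
proof -
  note d = short_exactD[OF assms(1)] short_exactD[OF assms(2)]
  have b: "is_biproduct C A B (bi_ob C A B) (bi_in1 C A B) (bi_in2 C A B) (bi_pr1 C A B) (bi_pr2 C A B)"
    if "A \<in> Ob C" "B \<in> Ob C" for A B using that by (rule biprod_is_biproduct)
  have "is_kernel C (bi_map C f f') (bi_map C g g')"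
    by (rule biproduct_kernel[OF b[of "Dom C f" "Dom C f'"] b[of "Dom C g" "Dom C g'"] b[of "Cod C g" "Cod C g'"],
          where f = f and f' = f' and g = g and g' = g'])
      (use assms d in \<open>simp_all add: short_exact_iff\<close>)
  moreover have bo: "is_biproduct (opp C) A B (bi_ob C A B) (bi_pr1 C A B) (bi_pr2 C A B) (bi_in1 C A B) (bi_in2 C A B)"
    if "A \<in> Ob C" "B \<in> Ob C" for A B using b[OF that] by simp
  have "is_kernel (opp C) (bi_map C g g') (bi_map C f f')"
    by (rule preadditive_category.biproduct_kernel[OF preadditive_category_opp
          bo[of "Cod C g" "Cod C g'"] bo[of "Dom C g" "Dom C g'"] bo[of "Dom C f" "Dom C f'"],
          where f = g and f' = g' and g = f and g' = f'])
      (use assms d in \<open>simp_all add: short_exact_iff\<close>)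
  ultimately show ?thesis by (simp add: short_exact_iff)
qed

lemma ses_sum:
  assumes "ses C X Y E" "ses C X' Y' E'"
  shows "ses C (bi_ob C X X') (bi_ob C Y Y') (map2 (bi_map C) E E')"
proof -
  obtain f g where 1: "E = [f, g]" "short_exact C f g" "Dom C f = Y" "Cod C g = X" using assms(1) by (rule sesE)
  obtain f' g' where 2: "E' = [f', g']" "short_exact C f' g'" "Dom C f' = Y'" "Cod C g' = X'" using assms(2) by (rule sesE)
  show ?thesis
    using 1 2 short_exact_bi_map[OF 1(2) 2(2)] short_exactD[OF 1(2)] short_exactD[OF 2(2)] by (auto simp: ses_def)
qed

lemma mor_sum:
  assumes "ses C X Y E" "ses C X' Y' E'" "ses C Z W F" "ses C Z' W' F'" "mor C E F a b" "mor C E' F' a' b'"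
  shows "mor C (map2 (bi_map C) E E') (map2 (bi_map C) F F') (bi_map C a a') (bi_map C b b')"
proof -
  obtain f g where 1: "E = [f, g]" "short_exact C f g" using assms(1) by (rule sesE)
  obtain f' g' where 2: "E' = [f', g']" "short_exact C f' g'" using assms(2) by (rule sesE)
  obtain k l where 3: "F = [k, l]" "short_exact C k l" using assms(3) by (rule sesE)
  obtain k' l' where 4: "F' = [k', l']" "short_exact C k' l'" using assms(4) by (rule sesE)
  note d = short_exactD(1-3)[OF 1(2)] short_exactD(1-3)[OF 2(2)] short_exactD(1-3)[OF 3(2)] short_exactD(1-3)[OF 4(2)]
  obtain m where m: "m \<in> Ar C" "Dom C m = Dom C g" "Cod C m = Dom C l" "m \<cdot> f = k \<cdot> a" "b \<cdot> g = l \<cdot> m"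
    using assms(5) unfolding 1 3 by (auto simp: mor_pair)
  have ab: "a \<in> Ar C" "Dom C a = Dom C f" "Cod C a = Dom C k" "b \<in> Ar C" "Dom C b = Cod C g" "Cod C b = Cod C l"
    using assms(5) unfolding 1 3 by (auto simp: mor_pair)
  obtain m' where m': "m' \<in> Ar C" "Dom C m' = Dom C g'" "Cod C m' = Dom C l'" "m' \<cdot> f' = k' \<cdot> a'" "b' \<cdot> g' = l' \<cdot> m'"
    using assms(6) unfolding 2 4 by (auto simp: mor_pair)
  have ab': "a' \<in> Ar C" "Dom C a' = Dom C f'" "Cod C a' = Dom C k'" "b' \<in> Ar C" "Dom C b' = Cod C g'" "Cod C b' = Cod C l'"
    using assms(6) unfolding 2 4 by (auto simp: mor_pair)
  have "bi_map C m m' \<cdot> bi_map C f f' = bi_map C k k' \<cdot> bi_map C a a'"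
    "bi_map C b b' \<cdot> bi_map C g g' = bi_map C l l' \<cdot> bi_map C m m'"
    using m m' ab ab' d by (simp_all add: bi_map_comp)
  then show ?thesis unfolding 1(1) 2(1) 3(1) 4(1) zip_Cons_Cons zip_Nil list.map prod.case mor_pair
    by (intro conjI bexI[of _ "bi_map C m m'"]) (use m(1-3) m'(1-3) ab ab' d in simp_all)
qed

section \<open>Baer sums of push-outs and pull-backs of a fixed extension\<close>

lemma diagonal_simps [simp]:
  assumes "A \<in> Ob C"
  shows "diagonal C A \<in> Ar C" "Dom C (diagonal C A) = A" "Cod C (diagonal C A) = bi_ob C A A"
    "codiagonal C A \<in> Ar C" "Dom C (codiagonal C A) = bi_ob C A A" "Cod C (codiagonal C A) = A"
  using assms by (auto simp: diagonal_def codiagonal_def)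

lemma Baer_sum_class:
  assumes "ses C X Y E" "ses C X Y E'"
  obtains F G where "ses C X (bi_ob C Y Y) F" "mor C F (map2 (bi_map C) E E') (Ide C (bi_ob C Y Y)) (diagonal C X)"
    "ses C X Y G" "mor C F G (codiagonal C Y) (Ide C X)"
    "Baer_sum C 1 X Y (ext_class C X Y E) (ext_class C X Y E') = ext_class C X Y G"
proof -
  have X: "X \<in> Ob C" "Y \<in> Ob C" using assms(1) by (auto elim: sesE)
  let ?S = "map2 (bi_map C) E E'"
  note S = ses_sum[OF assms]
  obtain F where F: "ses C X (bi_ob C Y Y) F" "mor C F ?S (Ide C (bi_ob C Y Y)) (diagonal C X)"
    using pull_ex[OF S, of "diagonal C X"] X by auto
  obtain G where G: "ses C X Y G" "mor C F G (codiagonal C Y) (Ide C X)"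
    using push_ex[OF F(1), of "codiagonal C Y"] X by auto
  have "Ext_equiv C 1 (bi_ob C X X) (bi_ob C Y Y) ``
      {map2 (bi_map C) E1 E1' |E1 E1'. E1 \<in> ext_class C X Y E \<and> E1' \<in> ext_class C X Y E'}
      = ext_class C (bi_ob C X X) (bi_ob C Y Y) ?S"
  proof (rule Ext_equiv_Image[OF S])
    show "?S \<in> {map2 (bi_map C) E1 E1' |E1 E1'. E1 \<in> ext_class C X Y E \<and> E1' \<in> ext_class C X Y E'}"
      using ext_class_self assms by blast
    have "map2 (bi_map C) E1 E1' \<in> ext_class C (bi_ob C X X) (bi_ob C Y Y) ?S"
      if "E1 \<in> ext_class C X Y E" "E1' \<in> ext_class C X Y E'" for E1 E1'
      using that ses_sum[of X Y E1 X Y E1'] mor_sum[OF assms, of X Y E1 X Y E1' "Ide C Y" "Ide C X" "Ide C Y" "Ide C X"] X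
      by (simp add: ext_class_def bi_map_Ide)
    then show "{map2 (bi_map C) E1 E1' |E1 E1'. E1 \<in> ext_class C X Y E \<and> E1' \<in> ext_class C X Y E'}
      \<subseteq> ext_class C (bi_ob C X X) (bi_ob C Y Y) ?S" by blast
  qed
  then have "Baer_sum C 1 X Y (ext_class C X Y E) (ext_class C X Y E') = ext_class C X Y G"
    unfolding Baer_sum_def by (simp add: Ext_pull_class[OF S F] Ext_push_class[OF F(1) G])
  then show thesis using that F G by blast
qed

text \<open>The pair of morphisms \<open>E\<close> to \<open>E1\<close> and \<open>E\<close> to
  \<open>E2\<close> is one morphism into their direct sum over the diagonal. It factors through the
  pull-back along the diagonal, and following it by the codiagonal turns the left end into
  \<open>h \<oplus> h'\<close>. Hence the Baer sum is a push-out of \<open>E\<close> along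
  \<open>h \<oplus> h'\<close>.\<close>

lemma Baer_sum_push:
  assumes "ses C S A E" "ses C S B E1" "ses C S B E2" "ses C S B G"
    "mor C E E1 h (Ide C S)" "mor C E E2 h' (Ide C S)" "mor C E G (h \<oplus> h') (Ide C S)"
  shows "Baer_sum C 1 S B (ext_class C S B E1) (ext_class C S B E2) = ext_class C S B G"
proof -
  have O: "S \<in> Ob C" "A \<in> Ob C" "B \<in> Ob C" using assms(1,2) by (auto elim: sesE)
  obtain F G0 where F: "ses C S (bi_ob C B B) F" "mor C F (map2 (bi_map C) E1 E2) (Ide C (bi_ob C B B)) (diagonal C S)"
    and G0: "ses C S B G0" "mor C F G0 (codiagonal C B) (Ide C S)"
      "Baer_sum C 1 S B (ext_class C S B E1) (ext_class C S B E2) = ext_class C S B G0"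
    using Baer_sum_class[OF assms(2,3)] by metis
  obtain u v where 1: "E = [u, v]" "short_exact C u v" "Dom C u = A" "Cod C v = S" using assms(1) by (rule sesE)
  obtain f1 g1 where 2: "E1 = [f1, g1]" "short_exact C f1 g1" "Dom C f1 = B" "Cod C g1 = S" using assms(2) by (rule sesE)
  obtain f2 g2 where 3: "E2 = [f2, g2]" "short_exact C f2 g2" "Dom C f2 = B" "Cod C g2 = S" using assms(3) by (rule sesE)
  note d = short_exactD(1-3)[OF 1(2)] short_exactD(1-3)[OF 2(2)] short_exactD(1-3)[OF 3(2)]
  have h: "h \<in> Ar C" "Dom C h = A" "Cod C h = B" "h' \<in> Ar C" "Dom C h' = A" "Cod C h' = B"
    using assms(5,6) 1 2 3 by (auto simp: mor_pair)
  obtain m1 where m1: "m1 \<in> Ar C" "Dom C m1 = Dom C v" "Cod C m1 = Dom C g1" "m1 \<cdot> u = f1 \<cdot> h" "g1 \<cdot> m1 = v"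
    using assms(5) 1(3,4) 2(3,4) d unfolding 1(1) 2(1) by (auto simp: mor_pair)
  obtain m2 where m2: "m2 \<in> Ar C" "Dom C m2 = Dom C v" "Cod C m2 = Dom C g2" "m2 \<cdot> u = f2 \<cdot> h'" "g2 \<cdot> m2 = v"
    using assms(6) 1(3,4) 3(3,4) d unfolding 1(1) 3(1) by (auto simp: mor_pair)
  define c where "c = bi_in1 C B B \<cdot> h \<oplus> bi_in2 C B B \<cdot> h'"
  define m where "m = bi_in1 C (Dom C g1) (Dom C g2) \<cdot> m1 \<oplus> bi_in2 C (Dom C g1) (Dom C g2) \<cdot> m2"
  have c: "c \<in> Ar C" "Dom C c = A" "Cod C c = bi_ob C B B" using h O by (auto simp: c_def)
  have m: "m \<in> Ar C" "Dom C m = Dom C v" "Cod C m = bi_ob C (Dom C g1) (Dom C g2)" using m1 m2 d by (auto simp: m_def)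
  have "m \<cdot> u = bi_map C f1 f2 \<cdot> c" "diagonal C S \<cdot> v = bi_map C g1 g2 \<cdot> m"
    using h O d m1 m2 1(3,4) 2(3,4) 3(3,4) by (simp_all add: m_def c_def diagonal_def)
  then have "mor C E (map2 (bi_map C) E1 E2) c (diagonal C S)"
    unfolding 1(1) 2(1) 3(1) zip_Cons_Cons zip_Nil list.map prod.case mor_pair
    by (intro conjI bexI[of _ m]) (use m c O d 1(3,4) 2(3,4) 3(3,4) in simp_all)
  then have "mor C E F c (Ide C S)"
    by (intro pull_univ[OF ses_sum[OF assms(2,3)] F assms(1)]) (use O in simp_all)
  then have "mor C E G0 (codiagonal C B \<cdot> c) (Ide C S \<cdot> Ide C S)"
    using G0 F(1) assms(1) mor_comp by blast
  moreover have "codiagonal C B \<cdot> c = h \<oplus> h'" using h O by (simp add: codiagonal_def c_def)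
  ultimately have "mor C E G0 (h \<oplus> h') (Ide C S)" using O by simp
  then have "mor C G G0 (Ide C B) (Ide C S)"
    by (intro push_univ[OF assms(1,4,7) G0(1)]) (use h O in simp_all)
  then show ?thesis using G0(1,3) ext_class_eq_iff[OF assms(4) G0(1)] by simp
qed

text \<open>Here the two morphisms into \<open>E\<close> are added on the direct sum of
  \<open>E1\<close> and \<open>E2\<close>, with left end the codiagonal. The dual of
  \<open>Baer_sum_push\<close> would concern the sum in \<open>opp C\<close>, formed in the other
  order and with other chosen biproducts, so the argument is carried out directly.\<close>

lemma Baer_sum_pull:
  assumes "ses C S A E" "ses C D A E1" "ses C D A E2" "ses C D A G"
    "mor C E1 E (Ide C A) h" "mor C E2 E (Ide C A) h'" "mor C G E (Ide C A) (h \<oplus> h')"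
  shows "Baer_sum C 1 D A (ext_class C D A E1) (ext_class C D A E2) = ext_class C D A G"
proof -
  have O: "S \<in> Ob C" "A \<in> Ob C" "D \<in> Ob C" using assms(1,2) by (auto elim: sesE)
  obtain F G0 where F: "ses C D (bi_ob C A A) F" "mor C F (map2 (bi_map C) E1 E2) (Ide C (bi_ob C A A)) (diagonal C D)"
    and G0: "ses C D A G0" "mor C F G0 (codiagonal C A) (Ide C D)"
      "Baer_sum C 1 D A (ext_class C D A E1) (ext_class C D A E2) = ext_class C D A G0"
    using Baer_sum_class[OF assms(2,3)] by metis
  obtain u v where 1: "E = [u, v]" "short_exact C u v" "Dom C u = A" "Cod C v = S" using assms(1) by (rule sesE)
  obtain f1 g1 where 2: "E1 = [f1, g1]" "short_exact C f1 g1" "Dom C f1 = A" "Cod C g1 = D" using assms(2) by (rule sesE)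
  obtain f2 g2 where 3: "E2 = [f2, g2]" "short_exact C f2 g2" "Dom C f2 = A" "Cod C g2 = D" using assms(3) by (rule sesE)
  note d = short_exactD(1-3)[OF 1(2)] short_exactD(1-3)[OF 2(2)] short_exactD(1-3)[OF 3(2)]
  have h: "h \<in> Ar C" "Dom C h = D" "Cod C h = S" "h' \<in> Ar C" "Dom C h' = D" "Cod C h' = S"
    using assms(5,6) 1 2 3 by (auto simp: mor_pair)
  obtain m1 where m1: "m1 \<in> Ar C" "Dom C m1 = Dom C g1" "Cod C m1 = Dom C v" "m1 \<cdot> f1 = u" "h \<cdot> g1 = v \<cdot> m1"
    using assms(5) 1(3,4) 2(3,4) d unfolding 1(1) 2(1) by (auto simp: mor_pair)
  obtain m2 where m2: "m2 \<in> Ar C" "Dom C m2 = Dom C g2" "Cod C m2 = Dom C v" "m2 \<cdot> f2 = u" "h' \<cdot> g2 = v \<cdot> m2"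
    using assms(6) 1(3,4) 3(3,4) d unfolding 1(1) 3(1) by (auto simp: mor_pair)
  define c where "c = h \<cdot> bi_pr1 C D D \<oplus> h' \<cdot> bi_pr2 C D D"
  define m where "m = m1 \<cdot> bi_pr1 C (Dom C g1) (Dom C g2) \<oplus> m2 \<cdot> bi_pr2 C (Dom C g1) (Dom C g2)"
  have c: "c \<in> Ar C" "Dom C c = bi_ob C D D" "Cod C c = S" using h O by (auto simp: c_def)
  have m: "m \<in> Ar C" "Dom C m = bi_ob C (Dom C g1) (Dom C g2)" "Cod C m = Dom C v" using m1 m2 d by (auto simp: m_def)
  have "m \<cdot> bi_map C f1 f2 = u \<cdot> codiagonal C A" "c \<cdot> bi_map C g1 g2 = v \<cdot> m"
    using h O d m1(1-3) m2(1-3) 1(3,4) 2(3,4) 3(3,4)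
    by (simp_all add: m_def c_def codiagonal_def
        reassoc[OF m1(4)] reassoc[OF m2(4)] reassoc[OF m1(5)] reassoc[OF m2(5)])
  then have "mor C (map2 (bi_map C) E1 E2) E (codiagonal C A) c"
    unfolding 1(1) 2(1) 3(1) zip_Cons_Cons zip_Nil list.map prod.case mor_pair
    by (intro conjI bexI[of _ m]) (use m c O d 1(3,4) 2(3,4) 3(3,4) in simp_all)
  then have "mor C F E (codiagonal C A \<cdot> Ide C (bi_ob C A A)) (c \<cdot> diagonal C D)"
    using F ses_sum[OF assms(2,3)] assms(1) mor_comp by blast
  moreover have "c \<cdot> diagonal C D = h \<oplus> h'" using h O by (simp add: diagonal_def c_def)
  ultimately have "mor C F E (codiagonal C A) (h \<oplus> h')" using O by simp
  then have "mor C G0 E (Ide C A) (h \<oplus> h')"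
    by (intro push_univ[OF F(1) G0(1,2) assms(1)]) (use O in simp_all)
  then have "mor C G0 G (Ide C A) (Ide C D)"
    by (intro pull_univ[OF assms(1,4,7) G0(1)]) (use h O in simp_all)
  then show ?thesis using G0(1,3) ext_class_eq_iff[OF G0(1) assms(4)] by simp
qed

text \<open>Exactness of Hom(\<open>Cod u\<close>, B) to Hom(A, B) to Ext^1(S, B) at the middle
  term. The arrow \<open>z\<close> is the difference of two middle arrows into the same sequence:
  they agree after projection to \<open>S\<close>, so the difference lands in B.\<close>

lemma push_eq_iff:
  assumes "ses C S A [u, v]" "ses C S B E1" "ses C S B E2"
    "mor C [u, v] E1 h (Ide C S)" "mor C [u, v] E2 h' (Ide C S)"
  shows "mor C E1 E2 (Ide C B) (Ide C S) \<longleftrightarrow>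
    (\<exists>z\<in>Ar C. Dom C z = Cod C u \<and> Cod C z = B \<and> Diff C h' h = z \<cdot> u)"
proof -
  have O: "S \<in> Ob C" "A \<in> Ob C" "B \<in> Ob C" using assms(1,2) by (auto elim: sesE)
  have 1: "short_exact C u v" "Dom C u = A" "Cod C v = S" using assms(1) by (auto simp: ses_def)
  obtain f1 g1 where 2: "E1 = [f1, g1]" "short_exact C f1 g1" "Dom C f1 = B" "Cod C g1 = S" using assms(2) by (rule sesE)
  obtain f2 g2 where 3: "E2 = [f2, g2]" "short_exact C f2 g2" "Dom C f2 = B" "Cod C g2 = S" using assms(3) by (rule sesE)
  note d = short_exactD[OF 1(1)] and d2 = short_exactD[OF 2(2)] and d3 = short_exactD[OF 3(2)]
  have h: "h \<in> Ar C" "Dom C h = A" "Cod C h = B" "h' \<in> Ar C" "Dom C h' = A" "Cod C h' = B"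
    using assms(4,5) 1 2 3 by (auto simp: mor_pair)
  obtain m' where m': "m' \<in> Ar C" "Dom C m' = Dom C v" "Cod C m' = Dom C g2" "m' \<cdot> u = f2 \<cdot> h'" "g2 \<cdot> m' = v"
    using assms(5) 1(2,3) 3(3,4) d d3 unfolding 3(1) by (auto simp: mor_pair)
  show ?thesis
  proof
    assume "mor C E1 E2 (Ide C B) (Ide C S)"
    then have "mor C [u, v] E2 (Ide C B \<cdot> h) (Ide C S \<cdot> Ide C S)" using mor_comp assms by blast
    then have "mor C [u, v] E2 h (Ide C S)" using h O by simp
    then obtain m where m: "m \<in> Ar C" "Dom C m = Dom C v" "Cod C m = Dom C g2" "m \<cdot> u = f2 \<cdot> h" "g2 \<cdot> m = v"
      using 1(2,3) 3(3,4) d d3 unfolding 3(1) by (auto simp: mor_pair)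
    have "g2 \<cdot> Diff C m' m = Nul C (Dom C (Diff C m' m)) (Cod C g2)" using m m' d3 d 3(4) 1(3) by simp
    then obtain z where z: "z \<in> Ar C" "Dom C z = Dom C v" "Cod C z = B" "f2 \<cdot> z = Diff C m' m"
      using short_exact_lift[OF 3(2), of "Diff C m' m"] m m' 3(3) by auto
    have "Diff C h' h = z \<cdot> u"
    proof (rule monoD[OF d3(5)])
      show "f2 \<cdot> Diff C h' h = f2 \<cdot> z \<cdot> u" using reassoc[OF z(4), of u] m m' z(1-3) h d d3 1(2) 3(3) by simp
    qed (use h z d d3 1 3 in simp_all)
    then show "\<exists>z\<in>Ar C. Dom C z = Cod C u \<and> Cod C z = B \<and> Diff C h' h = z \<cdot> u" using z d by auto
  next
    assume "\<exists>z\<in>Ar C. Dom C z = Cod C u \<and> Cod C z = B \<and> Diff C h' h = z \<cdot> u"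
    then obtain z where z: "z \<in> Ar C" "Dom C z = Dom C v" "Cod C z = B" "Diff C h' h = z \<cdot> u" using d by auto
    \<comment> \<open>Subtracting the part through \<open>z\<close> changes the left end of the
      middle arrow from \<open>h'\<close> to \<open>h\<close> and leaves its projection to
      \<open>S\<close> unchanged.\<close>
    define m where "m = Diff C m' (f2 \<cdot> z)"
    have m: "m \<in> Ar C" "Dom C m = Dom C v" "Cod C m = Dom C g2" using m' z 3(3) d3 by (auto simp: m_def)
    have "m \<cdot> u = Diff C (f2 \<cdot> h') (f2 \<cdot> z \<cdot> u)" using m' z(1-3) d d3 3(3) by (simp add: m_def)
    also have "\<dots> = f2 \<cdot> Diff C h' (z \<cdot> u)" using h d d3 z(1-3) 1(2) 3(3) by simp
    also have "\<dots> = f2 \<cdot> h" using h by (simp flip: z(4))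
    finally have mu: "m \<cdot> u = f2 \<cdot> h" .
    have "g2 \<cdot> m = v" unfolding m_def using m' z(1-3) d d3 3(3,4) 1(3) reassoc[OF d3(4), of z] O
      by (simp add: Diff_Neg)
    with mu have "mor C [u, v] E2 h (Ide C S)"
      unfolding 3(1) mor_pair by (intro conjI bexI[of _ m]) (use m h O 1(2,3) 3(3,4) d(1-3) d3(1-3) in simp_all)
    then show "mor C E1 E2 (Ide C B) (Ide C S)"
      by (intro push_univ[OF assms(1,2,4,3)]) (use h O in simp_all)
  qed
qed

lemma pull_eq_iff:
  assumes "ses C S A [u, v]" "ses C D A E1" "ses C D A E2"
    "mor C E1 [u, v] (Ide C A) h" "mor C E2 [u, v] (Ide C A) h'"
  shows "mor C E1 E2 (Ide C A) (Ide C D) \<longleftrightarrow>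
    (\<exists>z\<in>Ar C. Dom C z = D \<and> Cod C z = Dom C v \<and> Diff C h' h = v \<cdot> z)"
proof -
  have s: "ses (opp C) A S [v, u]" using ses_opp[of A S "[u, v]"] assms(1) by simp
  have "mor (opp C) (rev E1) (rev E2) (Ide (opp C) D) (Ide (opp C) A) \<longleftrightarrow>
    (\<exists>z\<in>Ar (opp C). Dom (opp C) z = Cod (opp C) v \<and> Cod (opp C) z = D \<and> Diff (opp C) h' h = z \<cdot>\<^bsub>opp C\<^esub> v)"
    by (rule abelian_category.push_eq_iff[OF abelian_category_opp s])
      (use assms mor_opp[OF assms(2,1), of h "Ide C A"] mor_opp[OF assms(3,1), of h' "Ide C A"] in simp_all)
  moreover have "mor (opp C) (rev E1) (rev E2) (Ide C D) (Ide C A) \<longleftrightarrow> mor C E1 E2 (Ide C A) (Ide C D)"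
    using mor_opp[OF assms(3,2)] mor_sym assms(2,3) by blast
  ultimately show ?thesis by auto
qed

end

section \<open>Abelian model structures\<close>

text \<open>Only a retraction is demanded; a section on the other side comes from
  \<open>retraction_section\<close>, which makes the notion self-dual.\<close>

definition splits :: "('o, 'm) cat \<Rightarrow> 'o \<Rightarrow> 'o \<Rightarrow> bool" where
  "splits C X Y \<longleftrightarrow> (\<forall>f g. short_exact C f g \<longrightarrow> Dom C f = Y \<longrightarrow> Cod C g = X \<longrightarrow>
     (\<exists>r\<in>Ar C. Dom C r = Cod C f \<and> Cod C r = Y \<and> r \<cdot>\<^bsub>C\<^esub> f = Ide C Y))"

section \<open>Splitting, vanishing of Ext^1, and the resulting extension properties\<close>

context abelian_category
begin

text \<open>The idempotent \<open>Ide - f \<cdot> r\<close> kills \<open>f\<close>, so it descends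
  along \<open>g\<close>; the descended arrow is the section.\<close>

lemma retraction_section:
  assumes "short_exact C f g" "r \<in> Ar C" "Dom C r = Cod C f" "Cod C r = Dom C f" "r \<cdot> f = Ide C (Dom C f)"
  obtains s where "s \<in> Ar C" "Dom C s = Cod C g" "Cod C s = Dom C g" "g \<cdot> s = Ide C (Cod C g)"
proof -
  note d = short_exactD[OF assms(1)]
  let ?e = "Diff C (Ide C (Dom C g)) (f \<cdot> r)"
  have e: "?e \<in> Ar C" "Dom C ?e = Dom C g" "Cod C ?e = Dom C g" using d assms by auto
  have "?e \<cdot> f = Nul C (Dom C f) (Cod C ?e)" using d assms by simp
  then obtain s where s: "s \<in> Ar C" "Dom C s = Cod C g" "Cod C s = Dom C g" "s \<cdot> g = ?e"
    using short_exact_descend[OF assms(1), of ?e] e by metis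
  have "g \<cdot> s \<cdot> g = g" using d assms s reassoc[OF d(4), of r] by (simp add: Diff_Neg)
  then have "(g \<cdot> s) \<cdot> g = Ide C (Cod C g) \<cdot> g" using d s(1-3) by simp
  then have "g \<cdot> s = Ide C (Cod C g)" by (rule epiD[OF d(6)]) (use d s(1-3) in simp_all)
  then show thesis using that s by blast
qed

lemma splits_sectionD:
  assumes "splits C X Y" "short_exact C f g" "Dom C f = Y" "Cod C g = X"
  obtains s where "s \<in> Ar C" "Dom C s = X" "Cod C s = Dom C g" "g \<cdot> s = Ide C X"
proof -
  obtain r where "r \<in> Ar C" "Dom C r = Cod C f" "Cod C r = Y" "r \<cdot> f = Ide C Y"
    using assms unfolding splits_def by blast
  then show thesis using retraction_section[OF assms(2)] assms(3,4) that by metis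
qed

lemma splits_oppD: "splits C X Y \<Longrightarrow> splits (opp C) Y X"
  unfolding splits_def[of "opp C"] opp_sel short_exact_opp by (metis splits_sectionD short_exactD(3))

lemma splits_opp [simp]: "splits (opp C) Y X \<longleftrightarrow> splits C X Y"
  using splits_oppD abelian_category.splits_oppD[OF abelian_category_opp, of Y X] by auto

lemma ses_zero_seq:
  assumes "X \<in> Ob C" "Y \<in> Ob C"
  shows "ses C X Y (zero_seq C 1 X Y)"
proof -
  have "is_mono C (bi_in1 C Y X)"
  proof (rule monoI)
    fix x assume x: "x \<in> Ar C" "Cod C x = Dom C (bi_in1 C Y X)" "bi_in1 C Y X \<cdot> x = Nul C (Dom C x) (Cod C (bi_in1 C Y X))"
    then have "bi_pr1 C Y X \<cdot> bi_in1 C Y X \<cdot> x = Nul C (Dom C x) Y" using assms by simp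
    then show "x = Nul C (Dom C x) (Dom C (bi_in1 C Y X))" using x(1,2) assms by simp
  qed (use assms in simp)
  moreover have "is_epi C (bi_pr2 C Y X)"
  proof (rule epiI)
    fix x assume x: "x \<in> Ar C" "Dom C x = Cod C (bi_pr2 C Y X)" "x \<cdot> bi_pr2 C Y X = Nul C (Dom C (bi_pr2 C Y X)) (Cod C x)"
    then have "x \<cdot> bi_pr2 C Y X \<cdot> bi_in2 C Y X = Nul C X (Cod C x)"
      using assms reassoc[OF x(3), of "bi_in2 C Y X"] by simp
    then show "x = Nul C (Cod C (bi_pr2 C Y X)) (Cod C x)" using x(1,2) assms by simp
  qed (use assms in simp)
  moreover have "is_kernel C (bi_in1 C Y X) (bi_pr2 C Y X)"
  proof (rule kernelI)
    fix h assume h: "h \<in> Ar C" "Cod C h = Dom C (bi_pr2 C Y X)" "bi_pr2 C Y X \<cdot> h = Nul C (Dom C h) (Cod C (bi_pr2 C Y X))"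
    have "bi_in1 C Y X \<cdot> bi_pr1 C Y X \<cdot> h = h"
      by (rule biprod_eqI[of Y X]) (use h assms in simp_all)
    then show "\<exists>x\<in>Ar C. Dom C x = Dom C h \<and> Cod C x = Dom C (bi_in1 C Y X) \<and> bi_in1 C Y X \<cdot> x = h"
      using h assms by (intro bexI[of _ "bi_pr1 C Y X \<cdot> h"]) auto
  qed (use assms calculation in simp_all)
  ultimately have "short_exact C (bi_in1 C Y X) (bi_pr2 C Y X)" using epi_short_exact by blast
  then show ?thesis using assms by (simp add: ses_def zero_seq_def)
qed

text \<open>A morphism with identity ends into the split sequence is the same as a retraction of
  \<open>f\<close>: its first component is one, and conversely a retraction paired with
  \<open>g\<close> gives the middle arrow.\<close>

lemma Ext_vanishes_iff_splits:
  assumes "X \<in> Ob C" "Y \<in> Ob C"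
  shows "Ext_vanishes C 1 X Y \<longleftrightarrow> splits C X Y"
proof -
  let ?Z = "zero_seq C 1 X Y"
  note Z = ses_zero_seq[OF assms]
  have Zeq: "?Z = [bi_in1 C Y X, bi_pr2 C Y X]" by (simp add: zero_seq_def)
  have one: "one (Ext C 1 X Y) = ext_class C X Y ?Z" using Ext_equiv_class[OF Z] by (simp add: Ext_def)
  have triv: "mor C [f, g] ?Z (Ide C Y) (Ide C X) \<longleftrightarrow> (\<exists>r\<in>Ar C. Dom C r = Cod C f \<and> Cod C r = Y \<and> r \<cdot> f = Ide C Y)"
    (is "?L \<longleftrightarrow> ?R") if "short_exact C f g" "Dom C f = Y" "Cod C g = X" for f g
  proof
    note d = short_exactD[OF that(1)]
    assume ?L
    then obtain m where m: "m \<in> Ar C" "Dom C m = Dom C g" "Cod C m = bi_ob C Y X" "m \<cdot> f = bi_in1 C Y X"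
      unfolding Zeq using assms by (auto simp: mor_pair)
    then show ?R using assms d that by (intro bexI[of _ "bi_pr1 C Y X \<cdot> m"]) simp_all
  next
    note d = short_exactD[OF that(1)]
    assume ?R
    then obtain r where r: "r \<in> Ar C" "Dom C r = Cod C f" "Cod C r = Y" "r \<cdot> f = Ide C Y" by blast
    let ?m = "bi_in1 C Y X \<cdot> r \<oplus> bi_in2 C Y X \<cdot> g"
    have "?m \<cdot> f = bi_in1 C Y X" "bi_pr2 C Y X \<cdot> ?m = g" using r d that assms by simp_all
    then show ?L unfolding Zeq mor_pair
      by (intro conjI bexI[of _ ?m]) (use r d(1-3) that assms in simp_all)
  qed
  show ?thesis
  proof
    assume v: "Ext_vanishes C 1 X Y"
    show "splits C X Y" unfolding splits_def
    proof (intro allI impI)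
      fix f g assume fg: "short_exact C f g" "Dom C f = Y" "Cod C g = X"
      then have s: "ses C X Y [f, g]" by (simp add: ses_def)
      then have "ext_class C X Y [f, g] \<in> carrier (Ext C 1 X Y)" by (auto simp: carrier_Ext)
      then have "ext_class C X Y [f, g] = ext_class C X Y ?Z" using v one by (simp add: Ext_vanishes_def)
      then show "\<exists>r\<in>Ar C. Dom C r = Cod C f \<and> Cod C r = Y \<and> r \<cdot> f = Ide C Y"
        using triv[OF fg] ext_class_eq_iff[OF s Z] by simp
    qed
  next
    assume sp: "splits C X Y"
    have "ext_class C X Y E = ext_class C X Y ?Z" if E: "ses C X Y E" for E
    proof -
      obtain f g where fg: "E = [f, g]" "short_exact C f g" "Dom C f = Y" "Cod C g = X" using E by (rule sesE)
      have "mor C E ?Z (Ide C Y) (Ide C X)" using triv[OF fg(2-4)] sp fg unfolding splits_def by blast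
      then show ?thesis using ext_class_eq_iff[OF E Z] by simp
    qed
    then show "Ext_vanishes C 1 X Y" using Z unfolding Ext_vanishes_def carrier_Ext one by blast
  qed
qed

text \<open>The sequence is pushed out along \<open>h\<close>. The result splits, and its retraction
  composed with the middle arrow extends \<open>h\<close>.\<close>

lemma extend:
  assumes "short_exact C f g" "splits C (Cod C g) (Cod C h)" "h \<in> Ar C" "Dom C h = Dom C f"
  obtains h' where "h' \<in> Ar C" "Dom C h' = Cod C f" "Cod C h' = Cod C h" "h' \<cdot> f = h"
proof -
  note d = short_exactD[OF assms(1)]
  have "ses C (Cod C g) (Dom C f) [f, g]" using assms by (simp add: ses_def)
  then obtain E where E: "ses C (Cod C g) (Cod C h) E" "mor C [f, g] E h (Ide C (Cod C g))"
    using push_ex assms by metis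
  obtain f' g' where 1: "E = [f', g']" "short_exact C f' g'" "Dom C f' = Cod C h" "Cod C g' = Cod C g" using E(1) by (rule sesE)
  note d' = short_exactD[OF 1(2)]
  obtain m where m: "m \<in> Ar C" "Dom C m = Dom C g" "Cod C m = Dom C g'" "m \<cdot> f = f' \<cdot> h"
    using E(2) unfolding 1(1) by (auto simp: mor_pair)
  obtain r where r: "r \<in> Ar C" "Dom C r = Cod C f'" "Cod C r = Cod C h" "r \<cdot> f' = Ide C (Cod C h)"
    using assms(2) 1 unfolding splits_def by blast
  have "(r \<cdot> m) \<cdot> f = h" using r m d d' 1 assms reassoc[OF r(4), of h] by simp
  then show thesis using that[of "r \<cdot> m"] r m d d' by simp
qed

lemma lift:
  assumes "short_exact C f g" "splits C (Dom C h) (Dom C f)" "h \<in> Ar C" "Cod C h = Cod C g"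
  obtains h' where "h' \<in> Ar C" "Dom C h' = Dom C h" "Cod C h' = Dom C g" "g \<cdot> h' = h"
  using abelian_category.extend[OF abelian_category_opp, of g f h] assms by auto

lemma epi_comp:
  assumes "is_epi C f" "is_epi C g" "Cod C f = Dom C g"
  shows "is_epi C (g \<cdot> f)"
proof (rule epiI)
  have fg: "f \<in> Ar C" "g \<in> Ar C" using assms by (auto simp: is_epi_def)
  then show "g \<cdot> f \<in> Ar C" using assms by simp
  fix x assume x: "x \<in> Ar C" "Dom C x = Cod C (g \<cdot> f)" "x \<cdot> g \<cdot> f = Nul C (Dom C (g \<cdot> f)) (Cod C x)"
  have "x \<cdot> g = Nul C (Cod C f) (Cod C (x \<cdot> g))"
    by (rule epi_NulD[OF assms(1)]) (use x fg assms in simp_all)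
  then have *: "x \<cdot> g = Nul C (Dom C g) (Cod C x)" using x(1,2) fg assms by simp
  have "x = Nul C (Cod C g) (Cod C x)"
    by (rule epi_NulD[OF assms(2) *]) (use x fg assms in simp_all)
  then show "x = Nul C (Cod C (g \<cdot> f)) (Cod C x)" using fg assms by simp
qed

text \<open>The inverse image under \<open>g\<close> of the subobject \<open>u\<close> is the kernel
  of \<open>v \<cdot> g\<close>.\<close>

lemma pullback_comp_exact:
  assumes "short_exact C f g" "short_exact C f' g'"
    and m: "m \<in> Ar C" "Dom C m = Dom C g'" "Cod C m = Dom C g" "m \<cdot> f' = f" "g \<cdot> m = u \<cdot> g'"
    and uv: "short_exact C u v" "Cod C u = Cod C g" "Dom C u = Cod C g'"
  shows "short_exact C m (v \<cdot> g)"
proof (rule epi_short_exact)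
  note d = short_exactD[OF assms(1)] and d' = short_exactD[OF assms(2)] and e = short_exactD[OF uv(1)]
  show "is_epi C (v \<cdot> g)" by (rule epi_comp) (use d e uv in simp_all)
  show "is_kernel C m (v \<cdot> g)"
  proof (rule kernelI)
    show "is_mono C m"
    proof (rule monoI)
      fix x assume x: "x \<in> Ar C" "Cod C x = Dom C m" "m \<cdot> x = Nul C (Dom C x) (Cod C m)"
      have "g' \<cdot> x = Nul C (Dom C (g' \<cdot> x)) (Dom C u)"
        by (rule mono_NulD[OF e(5)]) (use reassoc[OF m(5), of x] x m d d' e uv in simp_all)
      then have *: "g' \<cdot> x = Nul C (Dom C x) (Dom C u)" using x(1,2) d' m by simp
      show "x = Nul C (Dom C x) (Dom C m)"
        by (rule pullback_unique[OF assms(1,2) m(1-4)]) (use * x m d d' e uv in simp_all)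
    qed (fact m(1))
    have "v \<cdot> u \<cdot> g' = Nul C (Dom C m) (Cod C v)" using reassoc[OF e(4), of g'] d' e uv m by simp
    then show "(v \<cdot> g) \<cdot> m = Nul C (Dom C m) (Cod C (v \<cdot> g))" using m d e uv by simp
    fix h assume h: "h \<in> Ar C" "Cod C h = Dom C (v \<cdot> g)" "(v \<cdot> g) \<cdot> h = Nul C (Dom C h) (Cod C (v \<cdot> g))"
    obtain y where y: "y \<in> Ar C" "Dom C y = Dom C h" "Cod C y = Dom C u" "u \<cdot> y = g \<cdot> h"
      using short_exact_lift[OF uv(1), of "g \<cdot> h"] h d e uv by auto
    have hy: "Dom C h = Dom C y" "Cod C h = Dom C g" "g \<cdot> h = u \<cdot> y" using h y d e uv by auto
    obtain t where "t \<in> Ar C" "Dom C t = Dom C y" "Cod C t = Dom C g'" "m \<cdot> t = h"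
      using pullback_univ[OF assms(1,2) m(1-4) e(1) uv(3,2) m(5) h(1) y(1) hy(1,2) y(3) hy(3)] by metis
    then show "\<exists>x\<in>Ar C. Dom C x = Dom C h \<and> Cod C x = Dom C m \<and> m \<cdot> x = h"
      using hy m(2) by auto
  qed (use m d e uv in simp_all)
qed

text \<open>A sequence over the middle object is first pulled back to \<open>Dom u\<close>, where it
  has a retraction. The pulled-back total object sits in the original one as \<open>m\<close> with
  cokernel \<open>Cod v\<close>, so the retraction extends over \<open>m\<close>.\<close>

lemma splits_extension:
  assumes uv: "short_exact C u v" and "splits C (Dom C u) Y" "splits C (Cod C v) Y"
  shows "splits C (Cod C u) Y"
  unfolding splits_def
proof (intro allI impI)
  fix f g assume fg: "short_exact C f g" "Dom C f = Y" "Cod C g = Cod C u"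
  note e = short_exactD[OF uv] and d = short_exactD[OF fg(1)]
  obtain f' g' m where p: "short_exact C f' g'" "Dom C f' = Dom C f" "Cod C g' = Dom C u"
    and m: "m \<in> Ar C" "Dom C m = Dom C g'" "Cod C m = Dom C g" "m \<cdot> f' = f" "g \<cdot> m = u \<cdot> g'"
    using pullback[OF fg(1) e(1)] fg(3) by metis
  note d' = short_exactD[OF p(1)]
  have se: "short_exact C m (v \<cdot> g)" by (rule pullback_comp_exact[OF fg(1) p(1) m uv]) (use fg p in simp_all)
  obtain r where r: "r \<in> Ar C" "Dom C r = Cod C f'" "Cod C r = Y" "r \<cdot> f' = Ide C Y"
    using assms(2) p fg unfolding splits_def by metis
  obtain r' where r': "r' \<in> Ar C" "Dom C r' = Cod C m" "Cod C r' = Cod C r" "r' \<cdot> m = r"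
    using extend[OF se, of r] assms(3) r d e fg m d' by auto
  have "r' \<cdot> f = Ide C Y" using reassoc[OF r'(4), of f'] r r' m d' by simp
  then show "\<exists>r\<in>Ar C. Dom C r = Cod C f \<and> Cod C r = Y \<and> r \<cdot> f = Ide C Y"
    using r r' m d by (intro bexI[of _ r']) simp_all
qed

lemma splits_zero:
  assumes "is_zero_object C Z"
  shows "splits C Z Y"
  unfolding splits_def
proof (intro allI impI)
  fix f g assume fg: "short_exact C f g" "Dom C f = Y" "Cod C g = Z"
  note d = short_exactD[OF fg(1)]
  have Z: "Z \<in> Ob C" and u: "\<exists>!f. f \<in> Hom C (Dom C g) Z" using assms d by (auto simp: is_zero_object_def)
  have "g \<in> Hom C (Dom C g) Z" "Nul C (Dom C g) Z \<in> Hom C (Dom C g) Z" using d fg Z by (auto simp: Hom_iff)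
  then have "g = Nul C (Dom C g) Z" using u by blast
  then have "g \<cdot> Ide C (Dom C g) = Nul C (Dom C (Ide C (Dom C g))) (Cod C g)" using d fg by simp
  then obtain x where x: "x \<in> Ar C" "Dom C x = Dom C g" "Cod C x = Dom C f" "f \<cdot> x = Ide C (Dom C g)"
    using short_exact_lift[OF fg(1), of "Ide C (Dom C g)"] d by auto
  have "x \<cdot> f = Ide C Y"
    by (rule monoD[OF d(5)]) (use x d fg reassoc[OF x(4), of f] Ob_simps(1)[OF d(1)] in simp_all)
  then show "\<exists>r\<in>Ar C. Dom C r = Cod C f \<and> Cod C r = Y \<and> r \<cdot> f = Ide C Y"
    using x d fg by (intro bexI[of _ x]) simp_all
qed

end

text \<open>The model structure in the form in which it is used, with vanishing of Ext^1 expressed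
  by \<open>splits\<close>. The assumptions are carried to each other by passing to
  \<open>opp C\<close> and exchanging \<open>\<Q>\<close> and \<open>\<R>\<close>.\<close>

locale abelian_model = abelian_category +
  fixes \<Q> \<W> \<R> :: "'a set"
  assumes thick: "thick C \<W>"
    and RW_eq: "\<W> \<inter> \<R> = {Y \<in> Ob C. \<forall>X\<in>\<Q>. splits C X Y}"
    and Q_eq: "\<Q> = {X \<in> Ob C. \<forall>Y\<in>\<W> \<inter> \<R>. splits C X Y}"
    and QW_eq: "\<Q> \<inter> \<W> = {X \<in> Ob C. \<forall>Y\<in>\<R>. splits C X Y}"
    and R_eq: "\<R> = {Y \<in> Ob C. \<forall>X\<in>\<Q> \<inter> \<W>. splits C X Y}"
    and complete: "complete_pair C \<Q> (\<W> \<inter> \<R>)" "complete_pair C (\<Q> \<inter> \<W>) \<R>"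

section \<open>Completeness and thickness in the opposite category\<close>

context abelian_category
begin

lemma complete_pair_oppD:
  assumes "complete_pair C \<X> \<Y>" shows "complete_pair (opp C) \<Y> \<X>"
  unfolding complete_pair_def
proof (intro ballI conjI)
  fix A assume "A \<in> Ob (opp C)"
  then obtain f g f' g' where
      1: "short_exact C f g" "Dom C f \<in> \<Y>" "Dom C g \<in> \<X>" "Cod C g = A"
    and 2: "short_exact C f' g'" "Dom C f' = A" "Cod C f' \<in> \<Y>" "Cod C g' \<in> \<X>"
    using assms unfolding complete_pair_def by (metis opp_sel(1))
  show "\<exists>f g. short_exact (opp C) f g \<and> Dom (opp C) f = A \<and> Cod (opp C) f \<in> \<X> \<and> Cod (opp C) g \<in> \<Y>"
    using 1 by (intro exI[of _ g] exI[of _ f]) simp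
  show "\<exists>f g. short_exact (opp C) f g \<and> Dom (opp C) f \<in> \<X> \<and> Dom (opp C) g \<in> \<Y> \<and> Cod (opp C) g = A"
    using 2 short_exactD(3)[OF 2(1)] by (intro exI[of _ g'] exI[of _ f']) simp
qed

lemma thick_oppD:
  assumes "thick C \<W>" shows "thick (opp C) \<W>"
proof -
  have "(Cod C g \<in> \<W> \<and> Dom C g \<in> \<W> \<longrightarrow> Dom C f \<in> \<W>) \<and> (Cod C g \<in> \<W> \<and> Dom C f \<in> \<W> \<longrightarrow> Dom C g \<in> \<W>) \<and>
      (Dom C g \<in> \<W> \<and> Dom C f \<in> \<W> \<longrightarrow> Cod C g \<in> \<W>)" if "short_exact C f g" for f g
    using assms[unfolded thick_def, THEN conjunct2, THEN spec[of _ f], THEN spec[of _ g], THEN mp, OF that]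
    unfolding short_exactD(3)[OF that] by (elim conjE, intro conjI impI; elim conjE; elim impE; blast)
  moreover have "\<W> \<subseteq> Ob C" using assms by (simp add: thick_def)
  ultimately show ?thesis unfolding thick_def opp_sel short_exact_opp by blast
qed

end

context abelian_model
begin

lemma abelian_model_opp: "abelian_model (opp C) \<R> \<W> \<Q>"
proof (intro abelian_model.intro abelian_category_opp abelian_model_axioms.intro;
    (unfold opp_sel splits_opp Int_commute[of \<W> \<Q>] Int_commute[of \<R> \<W>])?)
qed (fact thick_oppD[OF thick] QW_eq R_eq RW_eq Q_eq complete[THEN complete_pair_oppD])+

section \<open>Closure under extensions and the ideal of arrows through the core\<close>

lemma splits_Q_RW: "X \<in> \<Q> \<Longrightarrow> Y \<in> \<W> \<Longrightarrow> Y \<in> \<R> \<Longrightarrow> splits C X Y"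
  using RW_eq by blast

lemma splits_QW_R: "X \<in> \<Q> \<Longrightarrow> X \<in> \<W> \<Longrightarrow> Y \<in> \<R> \<Longrightarrow> splits C X Y"
  using QW_eq by blast

lemma Q_extension:
  assumes "short_exact C f g" "Dom C f \<in> \<Q>" "Cod C g \<in> \<Q>"
  shows "Cod C f \<in> \<Q>"
proof -
  have "Cod C f \<in> Ob C" using short_exactD[OF assms(1)] by simp
  moreover have "splits C (Cod C f) Y" if "Y \<in> \<W> \<inter> \<R>" for Y
    using splits_extension[OF assms(1)] assms(2,3) splits_Q_RW that by blast
  ultimately show ?thesis using Q_eq by blast
qed

lemma R_extension:
  assumes "short_exact C f g" "Dom C f \<in> \<R>" "Cod C g \<in> \<R>"
  shows "Cod C f \<in> \<R>"
  using abelian_model.Q_extension[OF abelian_model_opp, of g f] assms short_exactD(3)[OF assms(1)] by simp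

lemma W_extension:
  assumes "short_exact C f g" "Dom C f \<in> \<W>" "Cod C g \<in> \<W>"
  shows "Cod C f \<in> \<W>"
  using thick assms unfolding thick_def by blast

lemma W_kernel:
  assumes "short_exact C f g" "Cod C f \<in> \<W>" "Cod C g \<in> \<W>"
  shows "Dom C f \<in> \<W>"
  using thick assms unfolding thick_def by blast

text \<open>These arrows form an ideal, closed under sums and under composition on either side;
  \<open>homotopy_iff\<close> identifies its cosets with the homotopy classes. The end objects are
  read off the arrow, so no Hom sets need to be carried along.\<close>

definition null :: "'b \<Rightarrow> bool" where
  "null f \<longleftrightarrow> (\<exists>a\<in>Ar C. \<exists>b\<in>Ar C. Cod C a = Dom C b \<and> Dom C b \<in> \<Q> \<inter> \<W> \<inter> \<R> \<and> f = b \<cdot> a)"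

lemma nullI:
  assumes "a \<in> Ar C" "b \<in> Ar C" "Cod C a = Dom C b" "Dom C b \<in> \<Q>" "Dom C b \<in> \<W>" "Dom C b \<in> \<R>"
  shows "null (b \<cdot> a)"
  using assms unfolding null_def by blast

lemma nullE:
  assumes "null f"
  obtains a b where "a \<in> Ar C" "b \<in> Ar C" "Cod C a = Dom C b" "Dom C b \<in> \<Q>" "Dom C b \<in> \<W>" "Dom C b \<in> \<R>" "f = b \<cdot> a"
  using assms unfolding null_def by blast

lemma null_Ar: "null f \<Longrightarrow> f \<in> Ar C"
  by (auto elim: nullE)

lemma null_opp: "abelian_model.null (opp C) \<R> \<W> \<Q> f \<longleftrightarrow> null f"
  unfolding abelian_model.null_def[OF abelian_model_opp] null_def by auto metis+

lemma null_left:
  assumes "null f" "g \<in> Ar C" "Dom C g = Cod C f"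
  shows "null (g \<cdot> f)"
proof -
  obtain a b where ab: "a \<in> Ar C" "b \<in> Ar C" "Cod C a = Dom C b" "Dom C b \<in> \<Q>" "Dom C b \<in> \<W>" "Dom C b \<in> \<R>" "f = b \<cdot> a"
    using assms(1) by (rule nullE)
  then show ?thesis using nullI[of a "g \<cdot> b"] assms by simp
qed

lemma null_right:
  assumes "null f" "g \<in> Ar C" "Cod C g = Dom C f"
  shows "null (f \<cdot> g)"
proof -
  obtain a b where ab: "a \<in> Ar C" "b \<in> Ar C" "Cod C a = Dom C b" "Dom C b \<in> \<Q>" "Dom C b \<in> \<W>" "Dom C b \<in> \<R>" "f = b \<cdot> a"
    using assms(1) by (rule nullE)
  then show ?thesis using nullI[of "a \<cdot> g" b] assms by simp
qed

lemma null_Neg: "null f \<Longrightarrow> null (Neg C f)"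
  using null_left[of f "Neg C (Ide C (Cod C f))"] null_Ar[of f] by simp

lemma zero_Q: "is_zero_object C Z \<Longrightarrow> Z \<in> \<Q>"
  using splits_zero by (subst Q_eq) (auto simp: is_zero_object_def)

lemma null_Nul:
  assumes "A \<in> Ob C" "B \<in> Ob C"
  shows "null (Nul C A B)"
proof -
  obtain Z where Z: "is_zero_object C Z" using ex_zero_object by blast
  have "Z \<in> \<R>" using abelian_model.zero_Q[OF abelian_model_opp, of Z] Z by simp
  moreover have "Z \<in> Ob C" using Z by (simp add: is_zero_object_def)
  moreover have "Z \<in> \<W>" using QW_eq splits_zero[OF Z] \<open>Z \<in> Ob C\<close> by blast
  ultimately show ?thesis using nullI[of "Nul C A Z" "Nul C Z B"] assms zero_Q[OF Z] by simp
qed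

text \<open>The sum factors through the direct sum of the two core objects. This is an extension of
  one by the other, so it stays in each of \<open>\<Q>\<close>, \<open>\<W>\<close> and
  \<open>\<R>\<close>.\<close>

lemma null_Add:
  assumes "null f" "null g" "Dom C g = Dom C f" "Cod C g = Cod C f"
  shows "null (f \<oplus> g)"
proof -
  obtain a b where f: "a \<in> Ar C" "b \<in> Ar C" "Cod C a = Dom C b" "Dom C b \<in> \<Q>" "Dom C b \<in> \<W>" "Dom C b \<in> \<R>" "f = b \<cdot> a"
    using assms(1) by (rule nullE)
  obtain a' b' where g: "a' \<in> Ar C" "b' \<in> Ar C" "Cod C a' = Dom C b'" "Dom C b' \<in> \<Q>" "Dom C b' \<in> \<W>" "Dom C b' \<in> \<R>" "g = b' \<cdot> a'"
    using assms(2) by (rule nullE)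
  let ?J = "Dom C b" and ?J' = "Dom C b'"
  have se: "short_exact C (bi_in1 C ?J ?J') (bi_pr2 C ?J ?J')"
    using ses_zero_seq[of ?J' ?J] f g by (auto simp: ses_def zero_seq_def)
  have J: "bi_ob C ?J ?J' \<in> \<Q>" "bi_ob C ?J ?J' \<in> \<W>" "bi_ob C ?J ?J' \<in> \<R>"
    using Q_extension[OF se] W_extension[OF se] R_extension[OF se] f g by simp_all
  have ty: "Dom C a' = Dom C a" "Cod C b' = Cod C b" using assms(3,4) f g by auto
  let ?a = "bi_in1 C ?J ?J' \<cdot> a \<oplus> bi_in2 C ?J ?J' \<cdot> a'" and ?b = "b \<cdot> bi_pr1 C ?J ?J' \<oplus> b' \<cdot> bi_pr2 C ?J ?J'"
  have "null (?b \<cdot> ?a)" by (rule nullI) (use f g ty J in simp_all)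
  moreover have "?b \<cdot> ?a = f \<oplus> g" using f g ty by simp
  ultimately show ?thesis by simp
qed

text \<open>The domain embeds into an object of \<open>\<R>\<close> with cokernel in
  \<open>\<Q> \<inter> \<W>\<close>. By closure under extensions that object lies in the core, and
  \<open>h\<close> extends to it because Ext^1 from \<open>\<Q> \<inter> \<W>\<close> to
  \<open>\<R>\<close> vanishes.\<close>

lemma null_QW_R:
  assumes "h \<in> Ar C" "Dom C h \<in> \<Q>" "Dom C h \<in> \<W>" "Cod C h \<in> \<R>"
  shows "null h"
proof -
  obtain f g where fg: "short_exact C f g" "Dom C f = Dom C h" "Cod C f \<in> \<R>" "Cod C g \<in> \<Q> \<inter> \<W>"
    using complete(2) assms(1) unfolding complete_pair_def by (meson Ob_simps(1))
  have "Cod C f \<in> \<Q>" "Cod C f \<in> \<W>" using Q_extension[OF fg(1)] W_extension[OF fg(1)] fg assms by auto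
  moreover obtain h' where "h' \<in> Ar C" "Dom C h' = Cod C f" "Cod C h' = Cod C h" "h' \<cdot> f = h"
    using extend[OF fg(1), of h] splits_QW_R fg assms by auto
  ultimately show ?thesis using nullI[of f h'] fg short_exactD[OF fg(1)] by simp
qed

lemma null_Q_RW:
  assumes "h \<in> Ar C" "Dom C h \<in> \<Q>" "Cod C h \<in> \<W>" "Cod C h \<in> \<R>"
  shows "null h"
  using abelian_model.null_QW_R[OF abelian_model_opp, of h] assms by (simp add: null_opp)

text \<open>If \<open>h \<cdot> j = b \<cdot> a\<close> through the core, then \<open>a\<close>
  extends along \<open>j\<close> to \<open>a'\<close>. The difference of \<open>h\<close> and
  \<open>b \<cdot> a'\<close> kills \<open>j\<close>, so it factors through \<open>Cod c\<close>; an
  arrow from there into \<open>\<R>\<close> is null by \<open>null_QW_R\<close>.\<close>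

lemma null_cancel:
  assumes jc: "short_exact C j c" "Cod C c \<in> \<Q>" "Cod C c \<in> \<W>"
    and h: "h \<in> Ar C" "Dom C h = Cod C j" "Cod C h \<in> \<R>" "null (h \<cdot> j)"
  shows "null h"
proof -
  note d = short_exactD[OF jc(1)]
  obtain a b where ab: "a \<in> Ar C" "b \<in> Ar C" "Cod C a = Dom C b" "Dom C b \<in> \<Q>" "Dom C b \<in> \<W>" "Dom C b \<in> \<R>" "h \<cdot> j = b \<cdot> a"
    using h(4) by (rule nullE)
  have hj: "Dom C (h \<cdot> j) = Dom C j" "Cod C (h \<cdot> j) = Cod C h" using h d by auto
  have ty: "Dom C a = Dom C j" "Cod C b = Cod C h" using hj ab(1-3) unfolding ab(7) by auto
  obtain a' where a': "a' \<in> Ar C" "Dom C a' = Cod C j" "Cod C a' = Cod C a" "a' \<cdot> j = a"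
    using extend[OF jc(1), of a] splits_QW_R ab jc ty by auto
  let ?e = "Diff C h (b \<cdot> a')"
  have e: "?e \<in> Ar C" "Dom C ?e = Dom C c" "Cod C ?e = Cod C h" using h a' ab(1-6) ty d by auto
  have "?e \<cdot> j = Nul C (Dom C j) (Cod C ?e)" using h(1-3) a' ab ty d by simp
  then obtain x where x: "x \<in> Ar C" "Dom C x = Cod C c" "Cod C x = Cod C h" "x \<cdot> c = ?e"
    using short_exact_descend[OF jc(1), of ?e] e by metis
  have "null x" using null_QW_R[of x] x jc h by simp
  then have "null ?e" using null_right[of x c] x d by simp
  moreover have "null (b \<cdot> a')" using nullI[of a' b] a' ab by simp
  ultimately have "null (b \<cdot> a' \<oplus> ?e)" by (intro null_Add) (use h a' ab(1-6) ty d in simp_all)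
  then show ?thesis using h a' ab(1-6) ty d by simp
qed

text \<open>Identifies the kernel of the connecting map with the null arrows. Forwards,
  \<open>Cod v \<in> \<Q>\<close> allows arrows into the core to be extended along \<open>u\<close>;
  backwards, \<open>z\<close> runs from \<open>\<Q> \<inter> \<W>\<close> to
  \<open>\<R>\<close>.\<close>

lemma null_iff_factors:
  assumes uv: "short_exact C u v" "Cod C u \<in> \<Q>" "Cod C u \<in> \<W>" "Cod C v \<in> \<Q>"
    and h: "h \<in> Ar C" "Dom C h = Dom C u" "Cod C h \<in> \<R>"
  shows "null h \<longleftrightarrow> (\<exists>z\<in>Ar C. Dom C z = Cod C u \<and> Cod C z = Cod C h \<and> h = z \<cdot> u)"
proof
  note d = short_exactD[OF uv(1)]
  assume "null h"
  then obtain a b where ab: "a \<in> Ar C" "b \<in> Ar C" "Cod C a = Dom C b" "Dom C b \<in> \<Q>" "Dom C b \<in> \<W>" "Dom C b \<in> \<R>" "h = b \<cdot> a"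
    by (rule nullE)
  obtain a' where a': "a' \<in> Ar C" "Dom C a' = Cod C u" "Cod C a' = Cod C a" "a' \<cdot> u = a"
    using extend[OF uv(1), of a] splits_Q_RW ab uv h by auto
  then show "\<exists>z\<in>Ar C. Dom C z = Cod C u \<and> Cod C z = Cod C h \<and> h = z \<cdot> u"
    using ab d by (intro bexI[of _ "b \<cdot> a'"]) simp_all
next
  note d = short_exactD[OF uv(1)]
  assume "\<exists>z\<in>Ar C. Dom C z = Cod C u \<and> Cod C z = Cod C h \<and> h = z \<cdot> u"
  then obtain z where z: "z \<in> Ar C" "Dom C z = Cod C u" "Cod C z = Cod C h" "h = z \<cdot> u" by blast
  have "null z" using null_QW_R[of z] z(1-3) uv h(3) by simp
  then show "null h" using null_right[of z u] z d by simp
qed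

lemma null_iff_factors':
  assumes "short_exact C k l" "Dom C l \<in> \<R>" "Dom C l \<in> \<W>" "Dom C k \<in> \<R>"
    and "h \<in> Ar C" "Cod C h = Cod C l" "Dom C h \<in> \<Q>"
  shows "null h \<longleftrightarrow> (\<exists>z\<in>Ar C. Dom C z = Dom C h \<and> Cod C z = Dom C l \<and> h = l \<cdot> z)"
  using abelian_model.null_iff_factors[OF abelian_model_opp, of l k h] assms by (auto simp: null_opp)

end

section \<open>Weak equivalences of fibrant objects\<close>

context abelian_model
begin

text \<open>
  The kernel \<open>K = Dom \<kappa>\<close> is the fibre product of \<open>\<pi>\<close> and \<open>w\<close>.  That it lies in \<open>\<W>\<close> follows from thickness
  via the short exact sequences \<open>N' \<rightarrow> Dom w \<rightarrow> Cod c'\<close>, \<open>Dom i \<rightarrow> N'' \<rightarrow> N'\<close> and \<open>N'' \<rightarrow> K \<rightarrow> Cod c\<close>, where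
  \<open>N'\<close> is the fibre product of \<open>j'\<close> and \<open>w\<close>, and \<open>N''\<close> that of \<open>p\<close> and \<open>N' \<rightarrow> Cod p\<close>.
\<close>

lemma weak_equivalence_resolution:
  assumes ip: "short_exact C i p" "Dom C i \<in> \<W>"
    and jc: "short_exact C j c" "Dom C j = Dom C p" "Cod C j \<in> \<R>" "Cod C c \<in> \<W>"
    and jc': "short_exact C j' c'" "Dom C j' = Cod C p" "Cod C c' \<in> \<W>"
    and \<pi>: "\<pi> \<in> Ar C" "Dom C \<pi> = Cod C j" "Cod C \<pi> = Cod C j'" "\<pi> \<cdot> j = j' \<cdot> p"
  obtains w \<kappa> where "w \<in> Ar C" "Dom C w \<in> \<Q>" "Dom C w \<in> \<W>" "Cod C w = Cod C \<pi>"
    "short_exact C \<kappa> (\<pi> \<cdot> bi_pr1 C (Dom C \<pi>) (Dom C w) \<oplus> w \<cdot> bi_pr2 C (Dom C \<pi>) (Dom C w))"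
    "Dom C \<kappa> \<in> \<W>" "Dom C \<kappa> \<in> \<R>"
proof -
  note dip = short_exactD[OF ip(1)] and djc = short_exactD[OF jc(1)] and djc' = short_exactD[OF jc'(1)]
  \<comment> \<open>A \<open>\<Q> \<inter> \<W>\<close> approximation of the codomain: it makes the
    sum with \<open>\<pi>\<close> epic, its domain does not change arrows modulo the core, and its
    kernel in \<open>\<R>\<close> keeps the fibre product \<open>Dom k1\<close> in
    \<open>\<R>\<close>.\<close>
  obtain r w where rw: "short_exact C r w" "Dom C r \<in> \<R>" "Dom C w \<in> \<Q>" "Dom C w \<in> \<W>" "Cod C w = Cod C \<pi>"
    using complete(2) \<pi>(1) unfolding complete_pair_def by (metis IntD1 IntD2 Ob_simps(2))
  note drw = short_exactD[OF rw(1)]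
  obtain r' k1 k2 where rk: "short_exact C r' k1" "Dom C r' = Dom C r" "Cod C k1 = Dom C \<pi>"
    and k2: "k2 \<in> Ar C" "Dom C k2 = Dom C k1" "Cod C k2 = Dom C w" "k2 \<cdot> r' = r" "w \<cdot> k2 = \<pi> \<cdot> k1"
    using pullback[OF rw(1) \<pi>(1)] rw(5) by metis
  note drk = short_exactD[OF rk(1)]
  have KR: "Dom C k1 \<in> \<R>" using R_extension[OF rk(1)] rk jc \<pi> rw(2) drk by simp
  obtain r2 b \<nu> where rb: "short_exact C r2 b" "Dom C r2 = Dom C r" "Cod C b = Dom C j'"
    and \<nu>: "\<nu> \<in> Ar C" "Dom C \<nu> = Dom C b" "Cod C \<nu> = Dom C w" "\<nu> \<cdot> r2 = r" "w \<cdot> \<nu> = j' \<cdot> b"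
    using pullback[OF rw(1) djc'(1)] rw(5) \<pi>(3) by metis
  note drb = short_exactD[OF rb(1)]
  have se\<nu>: "short_exact C \<nu> (c' \<cdot> w)"
    by (rule pullback_comp_exact[OF rw(1) rb(1) \<nu> jc'(1)]) (use \<pi> rw rb in simp_all)
  note d\<nu> = short_exactD[OF se\<nu>]
  have N': "Dom C b \<in> \<W>"
    using W_kernel[OF se\<nu>] rw(4) jc'(3) \<nu>(2,3) drw djc' \<pi>(3) rw(5) by simp
  obtain i' n q where in': "short_exact C i' n" "Dom C i' = Dom C i" "Cod C n = Dom C b"
    and q: "q \<in> Ar C" "Dom C q = Dom C n" "Cod C q = Dom C p" "q \<cdot> i' = i" "p \<cdot> q = b \<cdot> n"
    using pullback[OF ip(1) drb(2)] rb(3) jc'(2) by metis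
  note din = short_exactD[OF in'(1)]
  have N'': "Dom C n \<in> \<W>" using W_extension[OF in'(1)] in' ip N' din by simp
  have "w \<cdot> \<nu> \<cdot> n = \<pi> \<cdot> j \<cdot> q"
    using reassoc[OF \<nu>(5), of n] reassoc[OF \<pi>(4), of q] q \<nu> \<pi> din drw drb djc' djc dip in' rb rw(5) jc jc' by simp
  \<comment> \<open>The components \<open>j \<cdot> q\<close> and \<open>\<nu> \<cdot> n\<close>
    agree over \<open>Cod \<pi>\<close> and so define the arrow \<open>t\<close> from
    \<open>Dom n\<close> into the fibre product of \<open>\<pi>\<close> and
    \<open>w\<close>.\<close>
  moreover have jq: "j \<cdot> q \<in> Ar C" "\<nu> \<cdot> n \<in> Ar C" "Dom C (\<nu> \<cdot> n) = Dom C (j \<cdot> q)" "Cod C (\<nu> \<cdot> n) = Dom C w" "Cod C (j \<cdot> q) = Dom C \<pi>"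
    using q \<nu> \<pi> din in' djc jc by simp_all
  moreover have ty: "Dom C \<pi> = Cod C k1" "Cod C \<pi> = Cod C w" using rk rw by simp_all
  ultimately obtain t where t: "t \<in> Ar C" "Dom C t = Dom C (j \<cdot> q)" "Cod C t = Dom C k1" "k2 \<cdot> t = \<nu> \<cdot> n" "k1 \<cdot> t = j \<cdot> q"
    using pullback_univ[OF rw(1) rk(1) k2(1-4) \<pi>(1) ty k2(5) jq(2,1,3-5)] by metis
  have t2: "Dom C t = Dom C n" using t(2) q djc jc by simp
  have "short_exact C t (c \<cdot> k1)"
  proof (rule epi_short_exact)
    show "is_epi C (c \<cdot> k1)" by (rule epi_comp) (use drk djc rk \<pi> in simp_all)
    show "is_kernel C t (c \<cdot> k1)"
    proof (rule kernelI)
      show "is_mono C t"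
      proof (rule monoI)
        fix x assume x: "x \<in> Ar C" "Cod C x = Dom C t" "t \<cdot> x = Nul C (Dom C x) (Cod C t)"
        have "j \<cdot> q \<cdot> x = Nul C (Dom C x) (Cod C j)"
          using reassoc[OF t(5), of x] x t(1,3) t2 q djc jc(2) drk rk(3) \<pi>(2) by simp
        then have "q \<cdot> x = Nul C (Dom C (q \<cdot> x)) (Dom C j)"
          by (intro mono_NulD[OF djc(5)]) (use x t2 q djc jc in simp_all)
        then have qx: "q \<cdot> x = Nul C (Dom C x) (Dom C p)" using x(1,2) t2 q jc(2) by simp
        have "\<nu> \<cdot> n \<cdot> x = Nul C (Dom C x) (Cod C \<nu>)"
          using reassoc[OF t(4), of x] x t(1,3) t2 \<nu> k2(1-3) din in'(3) by simp
        then have "n \<cdot> x = Nul C (Dom C (n \<cdot> x)) (Dom C \<nu>)"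
          by (intro mono_NulD[OF d\<nu>(5)]) (use x t2 \<nu> din in'(3) in simp_all)
        then have nx: "n \<cdot> x = Nul C (Dom C x) (Dom C \<nu>)" using x(1,2) t2 din by simp
        show "x = Nul C (Dom C x) (Dom C t)"
          by (rule pullback_unique[OF ip(1) in'(1) q(1-4)]) (use qx nx x t2 q din dip in'(3) \<nu>(2) drb in simp_all)
      qed (fact t(1))
      have "c \<cdot> j \<cdot> q = Nul C (Dom C n) (Cod C c)" using reassoc[OF djc(4), of q] q djc jc by simp
      then show "(c \<cdot> k1) \<cdot> t = Nul C (Dom C t) (Cod C (c \<cdot> k1))"
        using t t2 drk djc rk(3) \<pi>(2) by simp
      fix x assume x: "x \<in> Ar C" "Cod C x = Dom C (c \<cdot> k1)" "(c \<cdot> k1) \<cdot> x = Nul C (Dom C x) (Cod C (c \<cdot> k1))"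
      \<comment> \<open>An arrow \<open>x\<close> killed by \<open>c \<cdot> k1\<close> has first
        component \<open>j \<cdot> y\<close>. Then
        \<open>w \<cdot> k2 \<cdot> x = j' \<cdot> p \<cdot> y\<close> is killed by
        \<open>c'\<close>, so the second component is \<open>\<nu> \<cdot> z\<close>; the pair
        \<open>y\<close>, \<open>z\<close> is compatible over \<open>Cod p\<close> and gives the
        required factor through \<open>Dom n\<close>.\<close>
      obtain y where y: "y \<in> Ar C" "Dom C y = Dom C x" "Cod C y = Dom C j" "j \<cdot> y = k1 \<cdot> x"
        using short_exact_lift[OF jc(1), of "k1 \<cdot> x"] x drk djc rk(3) \<pi>(2) by auto
      have wx: "w \<cdot> k2 \<cdot> x = j' \<cdot> p \<cdot> y"
        using reassoc[OF k2(5), of x] reassoc[OF \<pi>(4), of y] x(1,2) y drk djc djc' dip rk(3) \<pi>(1-3) k2(1-3) jc(2) jc'(2) drw by simp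
      have "c' \<cdot> j' \<cdot> p \<cdot> y = Nul C (Dom C x) (Cod C c')"
        using reassoc[OF djc'(4), of "p \<cdot> y"] y djc' dip jc(2) jc'(2) by simp
      then have "(c' \<cdot> w) \<cdot> k2 \<cdot> x = Nul C (Dom C (k2 \<cdot> x)) (Cod C (c' \<cdot> w))"
        using wx x(1,2) k2(1-3) drw drk djc djc' rw(5) \<pi>(2,3) rk(3) by simp
      then obtain z where z: "z \<in> Ar C" "Dom C z = Dom C x" "Cod C z = Dom C \<nu>" "\<nu> \<cdot> z = k2 \<cdot> x"
        using short_exact_lift[OF se\<nu>, of "k2 \<cdot> x"] x k2(1-3) drw drk djc djc' rw(5) \<pi>(2,3) rk(3) by auto
      have "p \<cdot> y = b \<cdot> z"
      proof (rule monoD[OF djc'(5)])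
        show "j' \<cdot> p \<cdot> y = j' \<cdot> b \<cdot> z"
          using wx reassoc[OF \<nu>(5), of z] z \<nu>(1-3) drw drb djc' rb(3) by simp
      qed (use y z \<nu>(2) drb dip djc' jc jc' rb in simp_all)
      then obtain s where s: "s \<in> Ar C" "Dom C s = Dom C z" "Cod C s = Dom C n" "q \<cdot> s = y" "n \<cdot> s = z"
        using pullback_univ[OF ip(1) in'(1) q(1-4) drb(2) in'(3)[symmetric] _ q(5) y(1) z(1)] y z \<nu>(2) jc(2) rb(3) jc'(2) by metis
      have "t \<cdot> s = x"
      proof (rule pullback_unique[OF rw(1) rk(1) k2(1-4)])
        show "k2 \<cdot> t \<cdot> s = k2 \<cdot> x"
          using reassoc[OF t(4), of s] s z(4) t(1,3) t2 k2(1-3) \<nu>(1,2) din in'(3) by simp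
        show "k1 \<cdot> t \<cdot> s = k1 \<cdot> x"
          using reassoc[OF t(5), of s] s y(4) t(1,3) t2 drk q(1-3) djc jc(2) by simp
      qed (use s x z(2) t(1,3) t2 k2(2) drk djc rk(3) \<pi>(2) in simp_all)
      then show "\<exists>y\<in>Ar C. Dom C y = Dom C x \<and> Cod C y = Dom C t \<and> t \<cdot> y = x"
        using s z(2) t2 by (intro bexI[of _ s]) simp_all
    qed (use t t2 drk djc rk(3) \<pi>(2) in simp_all)
  qed
  from W_extension[OF this] have KW: "Dom C k1 \<in> \<W>"
    using t t2 N'' jc(4) drk djc rk(3) \<pi>(2) by simp
  let ?G = "Dom C \<pi>" and ?V = "Dom C w"
  have GV: "?G \<in> Ob C" "?V \<in> Ob C" using \<pi>(1) drw by simp_all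
  define s where "s = \<pi> \<cdot> bi_pr1 C ?G ?V \<oplus> w \<cdot> bi_pr2 C ?G ?V"
  \<comment> \<open>The minus sign is forced because \<open>s\<close> adds the two components, while
    \<open>\<pi> \<cdot> k1\<close> and \<open>w \<cdot> k2\<close> are equal on the fibre
    product.\<close>
  define \<kappa> where "\<kappa> = Diff C (bi_in1 C ?G ?V \<cdot> k1) (bi_in2 C ?G ?V \<cdot> k2)"
  have s: "s \<in> Ar C" "Dom C s = bi_ob C ?G ?V" "Cod C s = Cod C \<pi>" using GV \<pi>(1) drw rw(5) by (auto simp: s_def)
  have \<kappa>: "\<kappa> \<in> Ar C" "Dom C \<kappa> = Dom C k1" "Cod C \<kappa> = bi_ob C ?G ?V" using GV k2 drk rk(3) by (auto simp: \<kappa>_def)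
  have pr: "bi_pr1 C ?G ?V \<cdot> \<kappa> = k1" "bi_pr2 C ?G ?V \<cdot> \<kappa> = Neg C k2"
    using GV k2(1-3) drk rk(3) by (simp_all add: \<kappa>_def Diff_Neg)
  have "s \<cdot> bi_in2 C ?G ?V = w" using GV \<pi>(1) drw rw(5) by (simp add: s_def)
  then have "is_epi C s" using epi_compD[of s "bi_in2 C ?G ?V"] s GV drw by simp
  moreover have "is_kernel C \<kappa> s"
  proof (rule kernelI)
    show "is_mono C \<kappa>"
    proof (rule monoI)
      fix x assume x: "x \<in> Ar C" "Cod C x = Dom C \<kappa>" "\<kappa> \<cdot> x = Nul C (Dom C x) (Cod C \<kappa>)"
      have 1: "k1 \<cdot> x = Nul C (Dom C x) ?G" using reassoc[OF pr(1), of x] x \<kappa> GV drk rk(3) by simp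
      have "Neg C (k2 \<cdot> x) = Nul C (Dom C x) ?V" using reassoc[OF pr(2), of x] x \<kappa> GV k2(1-3) by simp
      then have "Neg C (Neg C (k2 \<cdot> x)) = Nul C (Dom C x) ?V" using x(1) GV by simp
      then have 2: "k2 \<cdot> x = Nul C (Dom C x) ?V" using x(1,2) k2(1-3) \<kappa> by simp
      show "x = Nul C (Dom C x) (Dom C \<kappa>)"
        by (rule pullback_unique[OF rw(1) rk(1) k2(1-4)]) (use 1 2 x \<kappa> k2(1-3) drk rk(3) in simp_all)
    qed (fact \<kappa>(1))
    have "s \<cdot> \<kappa> = Diff C (\<pi> \<cdot> k1) (w \<cdot> k2)"
      using GV \<pi>(1) drw(1-3) rw(5) \<kappa> k2(1-3) drk rk(3) by (simp add: s_def pr Diff_Neg)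
    then show "s \<cdot> \<kappa> = Nul C (Dom C \<kappa>) (Cod C s)" using k2(5) \<pi>(1) drk rk(3) \<kappa> s by simp
    fix x assume x: "x \<in> Ar C" "Cod C x = Dom C s" "s \<cdot> x = Nul C (Dom C x) (Cod C s)"
    let ?x1 = "bi_pr1 C ?G ?V \<cdot> x" and ?x2 = "Neg C (bi_pr2 C ?G ?V \<cdot> x)"
    have xx: "?x2 \<in> Ar C" "?x1 \<in> Ar C" "Dom C ?x2 = Dom C ?x1" "Cod C ?x2 = ?V" "Cod C ?x1 = ?G"
      using x(1,2) s GV by simp_all
    have "s \<cdot> x = \<pi> \<cdot> ?x1 \<oplus> w \<cdot> bi_pr2 C ?G ?V \<cdot> x" using x(1,2) GV \<pi>(1) drw rw(5) s by (simp add: s_def)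
    then have "w \<cdot> bi_pr2 C ?G ?V \<cdot> x \<oplus> \<pi> \<cdot> ?x1 = Nul C (Dom C x) (Cod C \<pi>)"
      using x s GV \<pi>(1) drw rw(5) Add_comm[of "\<pi> \<cdot> ?x1" "w \<cdot> bi_pr2 C ?G ?V \<cdot> x"] by simp
    then have "Neg C (w \<cdot> bi_pr2 C ?G ?V \<cdot> x) = \<pi> \<cdot> ?x1"
      by (intro Neg_unique) (use x(1,2) s GV \<pi>(1) drw rw(5) in simp_all)
    then have "w \<cdot> ?x2 = \<pi> \<cdot> ?x1" using x(1,2) s GV drw by simp
    then obtain t where t: "t \<in> Ar C" "Dom C t = Dom C ?x1" "Cod C t = Dom C k1" "k2 \<cdot> t = ?x2" "k1 \<cdot> t = ?x1"
      using pullback_univ[OF rw(1) rk(1) k2(1-4) \<pi>(1) ty k2(5) xx] by metis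
    have "\<kappa> \<cdot> t = x"
    proof (rule biprod_eqI[OF GV])
      show "bi_pr1 C ?G ?V \<cdot> \<kappa> \<cdot> t = bi_pr1 C ?G ?V \<cdot> x"
        using reassoc[OF pr(1), of t] t(1,3,5) \<kappa> GV by simp
      show "bi_pr2 C ?G ?V \<cdot> \<kappa> \<cdot> t = bi_pr2 C ?G ?V \<cdot> x"
        using reassoc[OF pr(2), of t] t(1,3,4) \<kappa> GV k2(1-3) x(1,2) s by simp
    qed (use t(1-3) x(1,2) \<kappa> s GV in simp_all)
    then show "\<exists>y\<in>Ar C. Dom C y = Dom C x \<and> Cod C y = Dom C \<kappa> \<and> \<kappa> \<cdot> y = x"
      using t(1-3) x(1,2) \<kappa> s GV by (intro bexI[of _ t]) simp_all
  qed (use s \<kappa> in simp_all)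
  ultimately have "short_exact C \<kappa> s" by (rule epi_short_exact)
  then show thesis using that[of w \<kappa>] drw rw KW KR \<kappa> by (simp add: s_def)
qed

text \<open>For surjectivity, an arrow out of \<open>\<Q>\<close> lifts strictly through the
  epimorphism of the resolution, whose kernel lies in \<open>\<W> \<inter> \<R>\<close>. The
  component of the lift through \<open>w\<close> is null since \<open>w\<close> runs from
  \<open>\<Q> \<inter> \<W>\<close> to \<open>\<R>\<close>, so the other component is the
  preimage.\<close>

lemma weak_equivalence_bijective:
  assumes ip: "short_exact C i p" "Dom C i \<in> \<W>"
    and jc: "short_exact C j c" "Dom C j = Dom C p" "Cod C j \<in> \<R>" "Cod C c \<in> \<W>"
    and jc': "short_exact C j' c'" "Dom C j' = Cod C p" "Cod C j' \<in> \<R>" "Cod C c' \<in> \<W>"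
    and \<pi>: "\<pi> \<in> Ar C" "Dom C \<pi> = Cod C j" "Cod C \<pi> = Cod C j'" "\<pi> \<cdot> j = j' \<cdot> p"
  shows weak_equivalence_surj: "\<And>h. h \<in> Ar C \<Longrightarrow> Dom C h \<in> \<Q> \<Longrightarrow> Cod C h = Cod C \<pi> \<Longrightarrow>
      \<exists>y\<in>Ar C. Dom C y = Dom C h \<and> Cod C y = Dom C \<pi> \<and> null (Diff C h (\<pi> \<cdot> y))"
    and weak_equivalence_inj: "\<And>y. y \<in> Ar C \<Longrightarrow> Dom C y \<in> \<Q> \<Longrightarrow> Cod C y = Dom C \<pi> \<Longrightarrow> null (\<pi> \<cdot> y) \<Longrightarrow> null y"
proof -
  obtain w \<kappa> where w: "w \<in> Ar C" "Dom C w \<in> \<Q>" "Dom C w \<in> \<W>" "Cod C w = Cod C \<pi>"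
    and se: "short_exact C \<kappa> (\<pi> \<cdot> bi_pr1 C (Dom C \<pi>) (Dom C w) \<oplus> w \<cdot> bi_pr2 C (Dom C \<pi>) (Dom C w))"
    and K: "Dom C \<kappa> \<in> \<W>" "Dom C \<kappa> \<in> \<R>"
    using weak_equivalence_resolution[OF ip jc jc'(1,2,4) \<pi>] by blast
  let ?G = "Dom C \<pi>" and ?V = "Dom C w"
  define s where "s = \<pi> \<cdot> bi_pr1 C ?G ?V \<oplus> w \<cdot> bi_pr2 C ?G ?V"
  have se: "short_exact C \<kappa> s" using se by (simp add: s_def)
  note d = short_exactD[OF se]
  have GV: "?G \<in> Ob C" "?V \<in> Ob C" using \<pi>(1) w by simp_all
  have s: "Dom C s = bi_ob C ?G ?V" "Cod C s = Cod C \<pi>" using GV \<pi>(1) w by (auto simp: s_def)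
  have s_eq: "s \<cdot> x = \<pi> \<cdot> bi_pr1 C ?G ?V \<cdot> x \<oplus> w \<cdot> bi_pr2 C ?G ?V \<cdot> x" if "x \<in> Ar C" "Cod C x = bi_ob C ?G ?V" for x
    using that GV \<pi>(1) w by (simp add: s_def)
  have null_w: "null (w \<cdot> x)" if "x \<in> Ar C" "Cod C x = ?V" for x
    using null_right[of w x] null_QW_R[of w] w jc'(3) \<pi>(3) that by simp
  show "\<exists>y\<in>Ar C. Dom C y = Dom C h \<and> Cod C y = ?G \<and> null (Diff C h (\<pi> \<cdot> y))"
    if h: "h \<in> Ar C" "Dom C h \<in> \<Q>" "Cod C h = Cod C \<pi>" for h
  proof -
    obtain x where x: "x \<in> Ar C" "Dom C x = Dom C h" "Cod C x = bi_ob C ?G ?V" "s \<cdot> x = h"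
      using lift[OF se, of h] splits_Q_RW K h s by auto
    have "h = \<pi> \<cdot> bi_pr1 C ?G ?V \<cdot> x \<oplus> w \<cdot> bi_pr2 C ?G ?V \<cdot> x" using s_eq[of x] x by simp
    then have "Diff C h (\<pi> \<cdot> bi_pr1 C ?G ?V \<cdot> x) = w \<cdot> bi_pr2 C ?G ?V \<cdot> x"
      by (rule Diff_unique) (use x(1-3) GV \<pi>(1) w in simp_all)
    then show ?thesis using x(1-3) GV null_w[of "bi_pr2 C ?G ?V \<cdot> x"]
      by (intro bexI[of _ "bi_pr1 C ?G ?V \<cdot> x"]) simp_all
  qed
  show "null y" if y: "y \<in> Ar C" "Dom C y \<in> \<Q>" "Cod C y = ?G" "null (\<pi> \<cdot> y)" for y
  proof -
    obtain a b where ab: "a \<in> Ar C" "b \<in> Ar C" "Cod C a = Dom C b" "Dom C b \<in> \<Q>" "Dom C b \<in> \<W>" "Dom C b \<in> \<R>" "\<pi> \<cdot> y = b \<cdot> a"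
      using y(4) by (rule nullE)
    have "Dom C (\<pi> \<cdot> y) = Dom C y" "Cod C (\<pi> \<cdot> y) = Cod C \<pi>" using y \<pi> by simp_all
    then have ty: "Dom C a = Dom C y" "Cod C b = Cod C \<pi>" using ab(1-3) unfolding ab(7) by simp_all
    obtain b' where b': "b' \<in> Ar C" "Dom C b' = Dom C b" "Cod C b' = bi_ob C ?G ?V" "s \<cdot> b' = b"
      using lift[OF se, of b] splits_Q_RW K ab ty s by auto
    \<comment> \<open>The core object lifts to the direct sum as well, so the factorisation of
      \<open>\<pi> \<cdot> y\<close> can be subtracted there. The remainder is killed by
      \<open>s\<close>, hence comes from an arrow of \<open>\<Q>\<close> into the kernel in
      \<open>\<W> \<inter> \<R>\<close>, which is null; the first projection recovers
      \<open>y\<close> up to a null arrow.\<close>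
    let ?x = "Diff C (bi_in1 C ?G ?V \<cdot> y) (b' \<cdot> a)"
    have x: "?x \<in> Ar C" "Dom C ?x = Dom C y" "Cod C ?x = bi_ob C ?G ?V"
      using y(1-3) GV ab(1-6) b' ty by simp_all
    have "s \<cdot> bi_in1 C ?G ?V \<cdot> y = \<pi> \<cdot> y" using s_eq[of "bi_in1 C ?G ?V \<cdot> y"] y(1-3) GV \<pi>(1) w by simp
    then have "s \<cdot> ?x = Diff C (\<pi> \<cdot> y) (b \<cdot> a)"
      using y(1-3) GV ab(1-6) b' ty s d reassoc[OF b'(4), of a] by simp
    then have "s \<cdot> ?x = Nul C (Dom C ?x) (Cod C s)" using ab(1-6) ty x s by (simp add: ab(7))
    then obtain k where k: "k \<in> Ar C" "Dom C k = Dom C y" "Cod C k = Dom C \<kappa>" "\<kappa> \<cdot> k = ?x"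
      using short_exact_lift[OF se, of ?x] x s by auto
    have "null k" using null_Q_RW[of k] k y K by simp
    then have "null (bi_pr1 C ?G ?V \<cdot> ?x)"
      using null_left[of k "bi_pr1 C ?G ?V \<cdot> \<kappa>"] k(1-3) d GV s by (simp add: k(4))
    moreover have "null ((bi_pr1 C ?G ?V \<cdot> b') \<cdot> a)" by (rule nullI) (use ab b' GV in simp_all)
    ultimately have "null ((bi_pr1 C ?G ?V \<cdot> b') \<cdot> a \<oplus> bi_pr1 C ?G ?V \<cdot> ?x)"
      by (intro null_Add) (use y(1-3) GV ab(1-6) b' ty in simp_all)
    moreover have "(bi_pr1 C ?G ?V \<cdot> b') \<cdot> a \<oplus> bi_pr1 C ?G ?V \<cdot> ?x = y"
      using y(1-3) GV ab(1-6) b' ty by simp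
    ultimately show "null y" by simp
  qed
qed

end

section \<open>Connecting maps\<close>

text \<open>The value at \<open>h\<close> of the connecting homomorphism Hom(\<open>Dom u\<close>,
  B) to Ext^1(\<open>Cod v\<close>, B), given as the set of all push-outs so that no representative
  has to be chosen.\<close>

definition push_class :: "('o, 'm) cat \<Rightarrow> 'm \<Rightarrow> 'm \<Rightarrow> 'm \<Rightarrow> 'm list set" where
  "push_class C u v h = {E. ses C (Cod C v) (Cod C h) E \<and> mor C [u, v] E h (Ide C (Cod C v))}"

definition pull_class :: "('o, 'm) cat \<Rightarrow> 'm \<Rightarrow> 'm \<Rightarrow> 'm \<Rightarrow> 'm list set" where
  "pull_class C k l x = {E. ses C (Dom C x) (Dom C k) E \<and> mor C E [k, l] (Ide C (Dom C k)) x}"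

section \<open>Additivity, kernel, surjectivity and naturality of the connecting maps\<close>

context abelian_category
begin

text \<open>Composition shows that everything equivalent to one push-out is again a push-out along
  \<open>h\<close>; the universal property gives the converse, so the set is exactly one
  class.\<close>

lemma push_classE:
  assumes "short_exact C u v" "h \<in> Ar C" "Dom C h = Dom C u"
  obtains E where "ses C (Cod C v) (Cod C h) E" "mor C [u, v] E h (Ide C (Cod C v))"
    "push_class C u v h = ext_class C (Cod C v) (Cod C h) E"
proof -
  have s: "ses C (Cod C v) (Dom C u) [u, v]" using assms by (simp add: ses_def)
  have O: "Cod C v \<in> Ob C" "Cod C h \<in> Ob C" using short_exactD[OF assms(1)] assms(2) by simp_all
  obtain E where E: "ses C (Cod C v) (Cod C h) E" "mor C [u, v] E h (Ide C (Cod C v))"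
    using push_ex[OF s assms(2,3)] by metis
  have "mor C E F (Ide C (Cod C h)) (Ide C (Cod C v)) \<longleftrightarrow> mor C [u, v] F h (Ide C (Cod C v))"
    if F: "ses C (Cod C v) (Cod C h) F" for F
  proof
    assume "mor C E F (Ide C (Cod C h)) (Ide C (Cod C v))"
    from mor_comp[OF s E(1) F E(2) this] show "mor C [u, v] F h (Ide C (Cod C v))" using O assms(2) by simp
  next
    assume "mor C [u, v] F h (Ide C (Cod C v))"
    then show "mor C E F (Ide C (Cod C h)) (Ide C (Cod C v))"
      by (intro push_univ[OF s E F]) (use O assms(2) in simp_all)
  qed
  then have "push_class C u v h = ext_class C (Cod C v) (Cod C h) E"
    unfolding push_class_def ext_class_def by blast
  then show thesis using that E by blast
qed

lemma pull_classE:
  assumes "short_exact C k l" "x \<in> Ar C" "Cod C x = Cod C l"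
  obtains E where "ses C (Dom C x) (Dom C k) E" "mor C E [k, l] (Ide C (Dom C k)) x"
    "pull_class C k l x = ext_class C (Dom C x) (Dom C k) E"
proof -
  have s: "ses C (Cod C l) (Dom C k) [k, l]" using assms by (simp add: ses_def)
  have O: "Dom C k \<in> Ob C" "Dom C x \<in> Ob C" using short_exactD[OF assms(1)] assms(2) by simp_all
  obtain E where E: "ses C (Dom C x) (Dom C k) E" "mor C E [k, l] (Ide C (Dom C k)) x"
    using pull_ex[OF s assms(2,3)] by metis
  have "mor C E F (Ide C (Dom C k)) (Ide C (Dom C x)) \<longleftrightarrow> mor C F [k, l] (Ide C (Dom C k)) x"
    if F: "ses C (Dom C x) (Dom C k) F" for F
  proof
    assume "mor C E F (Ide C (Dom C k)) (Ide C (Dom C x))"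
    from mor_comp[OF F E(1) s mor_sym[OF E(1) F this] E(2)]
    show "mor C F [k, l] (Ide C (Dom C k)) x" using O assms(2) by simp
  next
    assume "mor C F [k, l] (Ide C (Dom C k)) x"
    then have "mor C F E (Ide C (Dom C k)) (Ide C (Dom C x))"
      by (intro pull_univ[OF s E F]) (use O assms(2) in simp_all)
    then show "mor C E F (Ide C (Dom C k)) (Ide C (Dom C x))" by (rule mor_sym[OF F E(1)])
  qed
  then have "pull_class C k l x = ext_class C (Dom C x) (Dom C k) E"
    unfolding pull_class_def ext_class_def by blast
  then show thesis using that E by blast
qed

lemma push_class_carrier:
  assumes "short_exact C u v" "h \<in> Ar C" "Dom C h = Dom C u"
  shows "push_class C u v h \<in> carrier (Ext C 1 (Cod C v) (Cod C h))"
  using push_classE[OF assms] unfolding carrier_Ext by blast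

lemma pull_class_carrier:
  assumes "short_exact C k l" "x \<in> Ar C" "Cod C x = Cod C l"
  shows "pull_class C k l x \<in> carrier (Ext C 1 (Dom C x) (Dom C k))"
  using pull_classE[OF assms] unfolding carrier_Ext by blast

lemma push_class_eq_iff:
  assumes "short_exact C u v" "h \<in> Ar C" "Dom C h = Dom C u" "h' \<in> Ar C" "Dom C h' = Dom C u" "Cod C h' = Cod C h"
  shows "push_class C u v h = push_class C u v h' \<longleftrightarrow>
    (\<exists>z\<in>Ar C. Dom C z = Cod C u \<and> Cod C z = Cod C h \<and> Diff C h' h = z \<cdot> u)"
proof -
  have s: "ses C (Cod C v) (Dom C u) [u, v]" using assms by (simp add: ses_def)
  obtain E where E: "ses C (Cod C v) (Cod C h) E" "mor C [u, v] E h (Ide C (Cod C v))"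
    "push_class C u v h = ext_class C (Cod C v) (Cod C h) E" using push_classE[OF assms(1-3)] by blast
  obtain E' where E': "ses C (Cod C v) (Cod C h) E'" "mor C [u, v] E' h' (Ide C (Cod C v))"
    "push_class C u v h' = ext_class C (Cod C v) (Cod C h) E'" using push_classE[OF assms(1,4,5)] assms(6) by metis
  show ?thesis unfolding E(3) E'(3) ext_class_eq_iff[OF E(1) E'(1)] by (rule push_eq_iff[OF s E(1) E'(1) E(2) E'(2)])
qed

lemma pull_class_eq_iff:
  assumes "short_exact C k l" "h \<in> Ar C" "Cod C h = Cod C l" "h' \<in> Ar C" "Cod C h' = Cod C l" "Dom C h' = Dom C h"
  shows "pull_class C k l h = pull_class C k l h' \<longleftrightarrow>
    (\<exists>z\<in>Ar C. Dom C z = Dom C h \<and> Cod C z = Dom C l \<and> Diff C h' h = l \<cdot> z)"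
proof -
  have s: "ses C (Cod C l) (Dom C k) [k, l]" using assms by (simp add: ses_def)
  obtain E where E: "ses C (Dom C h) (Dom C k) E" "mor C E [k, l] (Ide C (Dom C k)) h"
    "pull_class C k l h = ext_class C (Dom C h) (Dom C k) E" using pull_classE[OF assms(1-3)] by blast
  obtain E' where E': "ses C (Dom C h) (Dom C k) E'" "mor C E' [k, l] (Ide C (Dom C k)) h'"
    "pull_class C k l h' = ext_class C (Dom C h) (Dom C k) E'" using pull_classE[OF assms(1,4,5)] assms(6) by metis
  show ?thesis unfolding E(3) E'(3) ext_class_eq_iff[OF E(1) E'(1)] by (rule pull_eq_iff[OF s E(1) E'(1) E(2) E'(2)])
qed

lemma push_class_Add:
  assumes "short_exact C u v" "h \<in> Ar C" "Dom C h = Dom C u" "h' \<in> Ar C" "Dom C h' = Dom C u" "Cod C h' = Cod C h"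
  shows "Baer_sum C 1 (Cod C v) (Cod C h) (push_class C u v h) (push_class C u v h') = push_class C u v (h \<oplus> h')"
proof -
  have s: "ses C (Cod C v) (Dom C u) [u, v]" using assms by (simp add: ses_def)
  obtain E where E: "ses C (Cod C v) (Cod C h) E" "mor C [u, v] E h (Ide C (Cod C v))"
    "push_class C u v h = ext_class C (Cod C v) (Cod C h) E" using push_classE[OF assms(1-3)] by blast
  obtain E' where E': "ses C (Cod C v) (Cod C h) E'" "mor C [u, v] E' h' (Ide C (Cod C v))"
    "push_class C u v h' = ext_class C (Cod C v) (Cod C h) E'" using push_classE[OF assms(1,4,5)] assms(6) by metis
  obtain G where G: "ses C (Cod C v) (Cod C h) G" "mor C [u, v] G (h \<oplus> h') (Ide C (Cod C v))"
    "push_class C u v (h \<oplus> h') = ext_class C (Cod C v) (Cod C h) G"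
    using push_classE[OF assms(1), of "h \<oplus> h'"] assms by auto
  show ?thesis unfolding E(3) E'(3) G(3) by (rule Baer_sum_push[OF s E(1) E'(1) G(1) E(2) E'(2) G(2)])
qed

lemma pull_class_Add:
  assumes "short_exact C k l" "h \<in> Ar C" "Cod C h = Cod C l" "h' \<in> Ar C" "Cod C h' = Cod C l" "Dom C h' = Dom C h"
  shows "Baer_sum C 1 (Dom C h) (Dom C k) (pull_class C k l h) (pull_class C k l h') = pull_class C k l (h \<oplus> h')"
proof -
  have s: "ses C (Cod C l) (Dom C k) [k, l]" using assms by (simp add: ses_def)
  obtain E where E: "ses C (Dom C h) (Dom C k) E" "mor C E [k, l] (Ide C (Dom C k)) h"
    "pull_class C k l h = ext_class C (Dom C h) (Dom C k) E" using pull_classE[OF assms(1-3)] by blast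
  obtain E' where E': "ses C (Dom C h) (Dom C k) E'" "mor C E' [k, l] (Ide C (Dom C k)) h'"
    "pull_class C k l h' = ext_class C (Dom C h) (Dom C k) E'" using pull_classE[OF assms(1,4,5)] assms(6) by metis
  obtain G where G: "ses C (Dom C h) (Dom C k) G" "mor C G [k, l] (Ide C (Dom C k)) (h \<oplus> h')"
    "pull_class C k l (h \<oplus> h') = ext_class C (Dom C h) (Dom C k) G"
    using pull_classE[OF assms(1), of "h \<oplus> h'"] assms by auto
  show ?thesis unfolding E(3) E'(3) G(3) by (rule Baer_sum_pull[OF s E(1) E'(1) G(1) E(2) E'(2) G(2)])
qed

text \<open>Vanishing of Ext^1(\<open>Cod u\<close>, B) lifts \<open>v\<close> to an arrow
  \<open>m\<close> into the middle of the given extension. The composite \<open>m \<cdot> u\<close>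
  is killed by the projection, and its factor through B is the arrow \<open>h\<close> looked
  for.\<close>

lemma push_class_surj:
  assumes uv: "short_exact C u v" and sp: "splits C (Cod C u) B" and e: "e \<in> carrier (Ext C 1 (Cod C v) B)"
  obtains h where "h \<in> Ar C" "Dom C h = Dom C u" "Cod C h = B" "e = push_class C u v h"
proof -
  note d = short_exactD[OF uv]
  obtain E where E: "ses C (Cod C v) B E" "e = ext_class C (Cod C v) B E" using e unfolding carrier_Ext by blast
  obtain f g where 1: "E = [f, g]" "short_exact C f g" "Dom C f = B" "Cod C g = Cod C v" using E(1) by (rule sesE)
  note d1 = short_exactD[OF 1(2)]
  obtain m where m: "m \<in> Ar C" "Dom C m = Dom C v" "Cod C m = Dom C g" "g \<cdot> m = v"
    using lift[OF 1(2), of v] sp 1 d by auto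
  have "g \<cdot> m \<cdot> u = Nul C (Dom C (m \<cdot> u)) (Cod C g)" using reassoc[OF m(4), of u] m(1-3) d d1 1(4) by simp
  then obtain h where h: "h \<in> Ar C" "Dom C h = Dom C u" "Cod C h = B" "f \<cdot> h = m \<cdot> u"
    using short_exact_lift[OF 1(2), of "m \<cdot> u"] m(1-3) d 1(3) by auto
  have hu: "mor C [u, v] E h (Ide C (Cod C v))"
    unfolding 1(1) mor_pair by (intro conjI bexI[of _ m]) (use h m d d1 1 in simp_all)
  obtain E' where E': "ses C (Cod C v) B E'" "mor C [u, v] E' h (Ide C (Cod C v))"
    "push_class C u v h = ext_class C (Cod C v) B E'" using push_classE[OF uv h(1,2)] h(3) by metis
  have "E \<in> push_class C u v h" using hu E(1) h(3) by (simp add: push_class_def)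
  then have "mor C E' E (Ide C B) (Ide C (Cod C v))" unfolding E'(3) by (simp add: ext_class_def)
  then have "push_class C u v h = e" using ext_class_eq_iff[OF E'(1) E(1)] E E' by simp
  then show thesis using that h by blast
qed

lemma pull_class_surj:
  assumes kl: "short_exact C k l" and sp: "splits C X (Dom C l)" and e: "e \<in> carrier (Ext C 1 X (Dom C k))"
  obtains x where "x \<in> Ar C" "Dom C x = X" "Cod C x = Cod C l" "e = pull_class C k l x"
proof -
  note d = short_exactD[OF kl]
  obtain E where E: "ses C X (Dom C k) E" "e = ext_class C X (Dom C k) E" using e unfolding carrier_Ext by blast
  obtain f g where 1: "E = [f, g]" "short_exact C f g" "Dom C f = Dom C k" "Cod C g = X" using E(1) by (rule sesE)
  note d1 = short_exactD[OF 1(2)]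
  obtain m where m: "m \<in> Ar C" "Dom C m = Dom C g" "Cod C m = Dom C l" "m \<cdot> f = k"
    using extend[OF 1(2), of k] sp 1 d d1 by auto
  have "(l \<cdot> m) \<cdot> f = Nul C (Dom C f) (Cod C (l \<cdot> m))" using m d d1 1(3) by simp
  then obtain x where x: "x \<in> Ar C" "Dom C x = X" "Cod C x = Cod C l" "x \<cdot> g = l \<cdot> m"
    using short_exact_descend[OF 1(2), of "l \<cdot> m"] m(1-3) d d1 1(4) by auto
  have hu: "mor C E [k, l] (Ide C (Dom C k)) x"
    unfolding 1(1) mor_pair by (intro conjI bexI[of _ m]) (use x m d d1 1 in simp_all)
  obtain E' where E': "ses C X (Dom C k) E'" "mor C E' [k, l] (Ide C (Dom C k)) x"
    "pull_class C k l x = ext_class C X (Dom C k) E'" using pull_classE[OF kl x(1,3)] x(2) by metis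
  have "E \<in> pull_class C k l x" using hu E(1) x(2) by (simp add: pull_class_def)
  then have "mor C E' E (Ide C (Dom C k)) (Ide C X)" unfolding E'(3) by (simp add: ext_class_def)
  then have "pull_class C k l x = e" using ext_class_eq_iff[OF E'(1) E(1)] E E' by simp
  then show thesis using that x by blast
qed

text \<open>The morphism from \<open>[u', v']\<close> to \<open>[u, v]\<close> followed by the one
  to \<open>E\<close> has right end \<open>s\<close>, so it factors through the pull-back of
  \<open>E\<close> along \<open>s\<close>. Composing with the push-out along \<open>r\<close> gives
  left end \<open>r \<cdot> h \<cdot> q\<close>.\<close>

lemma push_class_natural:
  assumes uv: "short_exact C u v" "short_exact C u' v'" "mor C [u', v'] [u, v] q s"
    and h: "h \<in> Ar C" "Dom C h = Dom C u" and r: "r \<in> Ar C" "Dom C r = Cod C h"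
  shows "Ext_push C 1 (Cod C v') r (Ext_pull C 1 (Cod C h) s (push_class C u v h)) = push_class C u' v' (r \<cdot> h \<cdot> q)"
proof -
  have ss: "ses C (Cod C v) (Dom C u) [u, v]" "ses C (Cod C v') (Dom C u') [u', v']" using uv by (simp_all add: ses_def)
  have qs: "q \<in> Ar C" "Dom C q = Dom C u'" "Cod C q = Dom C u" "s \<in> Ar C" "Dom C s = Cod C v'" "Cod C s = Cod C v"
    using uv(3) by (auto simp: mor_pair)
  have O: "Cod C v \<in> Ob C" "Cod C v' \<in> Ob C" using qs(4-6) Ob_simps by metis+
  obtain E where E: "ses C (Cod C v) (Cod C h) E" "mor C [u, v] E h (Ide C (Cod C v))"
    "push_class C u v h = ext_class C (Cod C v) (Cod C h) E" using push_classE[OF uv(1) h] by blast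
  obtain E1 where E1: "ses C (Cod C v') (Cod C h) E1" "mor C E1 E (Ide C (Cod C h)) s"
    using pull_ex[OF E(1) qs(4,6)] qs(5) by metis
  obtain E2 where E2: "ses C (Cod C v') (Cod C r) E2" "mor C E1 E2 r (Ide C (Cod C v'))"
    using push_ex[OF E1(1) r] by metis
  have hq: "r \<cdot> h \<cdot> q \<in> Ar C" "Dom C (r \<cdot> h \<cdot> q) = Dom C u'" "Cod C (r \<cdot> h \<cdot> q) = Cod C r" using qs h r by simp_all
  have "mor C [u', v'] E (h \<cdot> q) (s \<cdot> Ide C (Cod C v'))"
    using mor_comp[OF ss(2,1) E(1) uv(3) E(2)] qs O by simp
  then have "mor C [u', v'] E1 (h \<cdot> q) (Ide C (Cod C v'))"
    by (rule pull_univ[OF E(1) E1 ss(2)]) (use O in simp_all)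
  from mor_comp[OF ss(2) E1(1) E2(1) this E2(2)]
  have "mor C [u', v'] E2 (r \<cdot> h \<cdot> q) (Ide C (Cod C v'))" using O by simp
  then have "E2 \<in> push_class C u' v' (r \<cdot> h \<cdot> q)" using E2(1) hq by (simp add: push_class_def)
  moreover obtain E3 where E3: "ses C (Cod C v') (Cod C r) E3" "push_class C u' v' (r \<cdot> h \<cdot> q) = ext_class C (Cod C v') (Cod C r) E3"
    using push_classE[OF uv(2) hq(1,2)] hq(3) by metis
  ultimately have "push_class C u' v' (r \<cdot> h \<cdot> q) = ext_class C (Cod C v') (Cod C r) E2"
    using ext_class_eq_iff[OF E3(1) E2(1)] by (simp add: ext_class_def)
  then show ?thesis unfolding E(3) by (simp add: Ext_pull_class[OF E(1) E1] Ext_push_class[OF E1(1) E2])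
qed

lemma pull_class_natural:
  assumes kl: "short_exact C k l" "short_exact C k' l'" "mor C [k, l] [k', l'] t r"
    and x: "x \<in> Ar C" "Cod C x = Cod C l" and q: "q \<in> Ar C" "Cod C q = Dom C x"
  shows "Ext_push C 1 (Dom C q) t (Ext_pull C 1 (Dom C k) q (pull_class C k l x)) = pull_class C k' l' (r \<cdot> x \<cdot> q)"
proof -
  have ss: "ses C (Cod C l) (Dom C k) [k, l]" "ses C (Cod C l') (Dom C k') [k', l']" using kl by (simp_all add: ses_def)
  have tr: "t \<in> Ar C" "Dom C t = Dom C k" "Cod C t = Dom C k'" "r \<in> Ar C" "Dom C r = Cod C l" "Cod C r = Cod C l'"
    using kl(3) by (auto simp: mor_pair)
  have O: "Dom C k \<in> Ob C" "Dom C k' \<in> Ob C" using tr(1-3) Ob_simps by metis+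
  obtain E where E: "ses C (Dom C x) (Dom C k) E" "mor C E [k, l] (Ide C (Dom C k)) x"
    "pull_class C k l x = ext_class C (Dom C x) (Dom C k) E" using pull_classE[OF kl(1) x] by blast
  obtain E1 where E1: "ses C (Dom C q) (Dom C k) E1" "mor C E1 E (Ide C (Dom C k)) q"
    using pull_ex[OF E(1) q] by metis
  obtain E2 where E2: "ses C (Dom C q) (Dom C k') E2" "mor C E1 E2 t (Ide C (Dom C q))"
    using push_ex[OF E1(1) tr(1,2)] tr(3) by metis
  have xq: "r \<cdot> x \<cdot> q \<in> Ar C" "Dom C (r \<cdot> x \<cdot> q) = Dom C q" "Cod C (r \<cdot> x \<cdot> q) = Cod C l'" using tr x q by simp_all
  have "mor C E1 [k, l] (Ide C (Dom C k)) (x \<cdot> q)"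
    using mor_comp[OF E1(1) E(1) ss(1) E1(2) E(2)] O by simp
  from mor_comp[OF E1(1) ss this kl(3)] have "mor C E1 [k', l'] (Ide C (Dom C k') \<cdot> t) (r \<cdot> x \<cdot> q)" using tr O by simp
  then have "mor C E2 [k', l'] (Ide C (Dom C k')) (r \<cdot> x \<cdot> q)"
    by (rule push_univ[OF E1(1) E2 ss(2)]) (use O in simp_all)
  then have "E2 \<in> pull_class C k' l' (r \<cdot> x \<cdot> q)" using E2(1) xq by (simp add: pull_class_def)
  moreover obtain E3 where E3: "ses C (Dom C q) (Dom C k') E3" "pull_class C k' l' (r \<cdot> x \<cdot> q) = ext_class C (Dom C q) (Dom C k') E3"
    using pull_classE[OF kl(2) xq(1,3)] xq(2) by metis
  ultimately have "pull_class C k' l' (r \<cdot> x \<cdot> q) = ext_class C (Dom C q) (Dom C k') E2"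
    using ext_class_eq_iff[OF E3(1) E2(1)] by (simp add: ext_class_def)
  then show ?thesis unfolding E(3) by (simp add: Ext_pull_class[OF E(1) E1] Ext_push_class[OF E1(1) E2])
qed

end

section \<open>The homotopy category\<close>

text \<open>Both carriers are images of one set \<open>H\<close> under maps with the same fibres, so
  \<open>F\<close> is the induced bijection; \<open>m\<close> lifts both multiplications to
  \<open>H\<close>. It is used with \<open>H\<close> the arrows from RQA to RQB and \<open>m\<close>
  their sum.\<close>

lemma iso_via_parametrization:
  assumes G: "carrier G = a ` H" and K: "carrier K = b ` H"
    and eq: "\<And>x y. x \<in> H \<Longrightarrow> y \<in> H \<Longrightarrow> a x = a y \<longleftrightarrow> b x = b y"
    and m: "\<And>x y. x \<in> H \<Longrightarrow> y \<in> H \<Longrightarrow> m x y \<in> H"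
    and mG: "\<And>x y. x \<in> H \<Longrightarrow> y \<in> H \<Longrightarrow> a x \<otimes>\<^bsub>G\<^esub> a y = a (m x y)"
    and mK: "\<And>x y. x \<in> H \<Longrightarrow> y \<in> H \<Longrightarrow> b x \<otimes>\<^bsub>K\<^esub> b y = b (m x y)"
    and F: "\<And>x. x \<in> H \<Longrightarrow> F (a x) = b x"
  shows "F \<in> iso G K"
proof -
  have "F \<in> hom G K" unfolding hom_def using G K mG mK m F by auto
  moreover have "inj_on F (carrier G)" unfolding inj_on_def G using F eq by auto
  moreover have "F ` carrier G = carrier K" unfolding G K using F by (auto simp: image_image)
  ultimately show ?thesis by (simp add: iso_def bij_betw_def)
qed

section \<open>Homotopy classes as cosets of the ideal of null arrows\<close>

context abelian_model
begin

abbreviation core :: "'a set" where "core \<equiv> \<Q> \<inter> \<W> \<inter> \<R>"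

abbreviation htp :: "'a \<Rightarrow> 'a \<Rightarrow> 'b \<Rightarrow> 'b set" where "htp A B f \<equiv> homotopy C core A B `` {f}"

lemma homotopy_iff:
  "(f, g) \<in> homotopy C core A B \<longleftrightarrow> f \<in> Hom C A B \<and> g \<in> Hom C A B \<and> null (Diff C g f)"
proof -
  have "null d \<longleftrightarrow> (\<exists>J\<in>core. \<exists>a\<in>Hom C A J. \<exists>b\<in>Hom C J B. d = b \<cdot> a)"
    if "d \<in> Ar C" "Dom C d = A" "Cod C d = B" for d
  proof
    assume "null d"
    then obtain a b where ab: "a \<in> Ar C" "b \<in> Ar C" "Cod C a = Dom C b" "Dom C b \<in> \<Q>" "Dom C b \<in> \<W>" "Dom C b \<in> \<R>" "d = b \<cdot> a"
      by (rule nullE)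
    have "a \<in> Hom C A (Dom C b)" "b \<in> Hom C (Dom C b) B" using that ab(1-3) unfolding ab(7) by (simp_all add: Hom_iff)
    then show "\<exists>J\<in>core. \<exists>a\<in>Hom C A J. \<exists>b\<in>Hom C J B. d = b \<cdot> a" using ab by blast
  next
    assume "\<exists>J\<in>core. \<exists>a\<in>Hom C A J. \<exists>b\<in>Hom C J B. d = b \<cdot> a"
    then show "null d" by (auto simp: Hom_iff intro: nullI)
  qed
  note * = this
  show ?thesis
  proof (cases "f \<in> Hom C A B \<and> g \<in> Hom C A B")
    case True
    then have "Diff C g f \<in> Ar C" "Dom C (Diff C g f) = A" "Cod C (Diff C g f) = B" by (auto simp: Hom_iff)
    from *[OF this] show ?thesis using True by (simp add: homotopy_def)
  qed (auto simp: homotopy_def)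
qed

lemma null_Diff_sym:
  assumes "null (Diff C f g)" "f \<in> Ar C" "g \<in> Ar C" "Dom C g = Dom C f" "Cod C g = Cod C f"
  shows "null (Diff C g f)"
proof -
  have "Neg C (Diff C f g) = Diff C g f"
    using assms by (simp add: Diff_Neg Neg_Add Add_comm[of "Neg C f" g])
  then show ?thesis using null_Neg[OF assms(1)] by simp
qed

lemma null_Diff_trans:
  assumes "null (Diff C f g)" "null (Diff C g h)" "f \<in> Ar C" "g \<in> Ar C" "h \<in> Ar C"
    "Dom C g = Dom C f" "Cod C g = Cod C f" "Dom C h = Dom C f" "Cod C h = Cod C f"
  shows "null (Diff C f h)"
proof -
  have "Diff C f h = Diff C g h \<oplus> Diff C f g"
  proof (rule Diff_unique)
    show "f = h \<oplus> (Diff C g h \<oplus> Diff C f g)" using assms(3-) by (simp flip: Add_assoc)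
  qed (use assms(3-) in simp_all)
  then show ?thesis using null_Add[OF assms(2,1)] assms(3-) by simp
qed

lemma equiv_homotopy: "equiv (Hom C A B) (homotopy C core A B)"
proof (rule equivI)
  show "homotopy C core A B \<subseteq> Hom C A B \<times> Hom C A B" by (auto simp: homotopy_def)
  show "refl_on (Hom C A B) (homotopy C core A B)"
    by (rule refl_onI) (auto simp: homotopy_iff Hom_iff intro: null_Nul)
  show "sym (homotopy C core A B)"
    by (rule symI) (auto simp: homotopy_iff Hom_iff intro: null_Diff_sym)
  show "trans (homotopy C core A B)"
    by (rule transI) (auto simp: homotopy_iff Hom_iff intro: null_Diff_trans)
qed

lemma htp_eq_iff:
  assumes "f \<in> Hom C A B" "g \<in> Hom C A B"
  shows "htp A B f = htp A B g \<longleftrightarrow> null (Diff C g f)"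
  using eq_equiv_class_iff[OF equiv_homotopy assms] assms by (simp add: homotopy_iff)

text \<open>The counterpart of \<open>Ext_equiv_Image\<close>: sums, composites and functor values
  in the homotopy category are saturations of sets of representatives.\<close>

lemma htp_Image:
  assumes "f \<in> S" "S \<subseteq> htp A B f"
  shows "homotopy C core A B `` S = htp A B f"
proof -
  have "htp A B g = htp A B f" if "g \<in> S" for g
    using that assms(2) equiv_class_eq[OF equiv_homotopy] by blast
  then show ?thesis using assms(1) by blast
qed

lemma mem_htp: "g \<in> htp A B f \<longleftrightarrow> f \<in> Hom C A B \<and> g \<in> Hom C A B \<and> null (Diff C g f)"
  by (simp add: homotopy_iff)

lemma htp_self: "f \<in> Hom C A B \<Longrightarrow> f \<in> htp A B f"
  using equiv_class_self[OF equiv_homotopy] by blast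

lemma carrier_stable_Hom: "carrier (stable_Hom C core A B) = htp A B ` Hom C A B"
  by (auto simp: stable_Hom_def quotient_def)

lemma mult_stable_Hom:
  assumes "f \<in> Hom C A B" "g \<in> Hom C A B"
  shows "htp A B f \<otimes>\<^bsub>stable_Hom C core A B\<^esub> htp A B g = htp A B (f \<oplus> g)"
proof -
  have "homotopy C core A B `` {f' \<oplus> g' |f' g'. f' \<in> htp A B f \<and> g' \<in> htp A B g} = htp A B (f \<oplus> g)"
  proof (rule htp_Image)
    show "f \<oplus> g \<in> {f' \<oplus> g' |f' g'. f' \<in> htp A B f \<and> g' \<in> htp A B g}"
      using assms htp_self by blast
    have "f' \<oplus> g' \<in> htp A B (f \<oplus> g)" if "f' \<in> htp A B f" "g' \<in> htp A B g" for f' g'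
    proof -
      have t: "f \<in> Ar C" "Dom C f = A" "Cod C f = B" "g \<in> Ar C" "Dom C g = A" "Cod C g = B"
        "f' \<in> Ar C" "Dom C f' = A" "Cod C f' = B" "g' \<in> Ar C" "Dom C g' = A" "Cod C g' = B"
        and n: "null (Diff C f' f)" "null (Diff C g' g)"
        using that by (auto simp: homotopy_iff Hom_iff)
      have "Diff C (f' \<oplus> g') (f \<oplus> g) = Diff C f' f \<oplus> Diff C g' g"
        using t by (simp add: Diff_Neg Neg_Add Add_assoc Add_left_comm[of g' "Neg C f"])
      then show ?thesis using null_Add[OF n] t by (simp add: homotopy_iff Hom_iff)
    qed
    then show "{f' \<oplus> g' |f' g'. f' \<in> htp A B f \<and> g' \<in> htp A B g} \<subseteq> htp A B (f \<oplus> g)" by blast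
  qed
  then show ?thesis by (simp add: stable_Hom_def)
qed

text \<open>Both factors can be changed one at a time: \<open>g' \<cdot> f' - g' \<cdot> f\<close>
  and \<open>g' \<cdot> f - g \<cdot> f\<close> are null because null arrows form an ideal.\<close>

lemma htp_comp:
  assumes "f \<in> Hom C A B" "g \<in> Hom C B D"
  shows "homotopy C core A D `` {g' \<cdot> f' |f' g'. f' \<in> htp A B f \<and> g' \<in> htp B D g} = htp A D (g \<cdot> f)"
proof (rule htp_Image)
  show "g \<cdot> f \<in> {g' \<cdot> f' |f' g'. f' \<in> htp A B f \<and> g' \<in> htp B D g}"
    using htp_self[OF assms(1)] htp_self[OF assms(2)] by blast
  have "g' \<cdot> f' \<in> htp A D (g \<cdot> f)" if "f' \<in> htp A B f" "g' \<in> htp B D g" for f' g'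
  proof -
    have t: "f \<in> Ar C" "Dom C f = A" "Cod C f = B" "g \<in> Ar C" "Dom C g = B" "Cod C g = D"
      "f' \<in> Ar C" "Dom C f' = A" "Cod C f' = B" "g' \<in> Ar C" "Dom C g' = B" "Cod C g' = D"
      and n: "null (Diff C f' f)" "null (Diff C g' g)"
      using that by (auto simp: homotopy_iff Hom_iff)
    have "null (g' \<cdot> Diff C f' f)" "null (Diff C g' g \<cdot> f)"
      using null_left[OF n(1), of g'] null_right[OF n(2), of f] t by simp_all
    then have "null (Diff C (g' \<cdot> f') (g' \<cdot> f))" "null (Diff C (g' \<cdot> f) (g \<cdot> f))" using t by simp_all
    then have "null (Diff C (g' \<cdot> f') (g \<cdot> f))" by (rule null_Diff_trans) (use t in simp_all)
    then show ?thesis using t by (simp add: homotopy_iff Hom_iff)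
  qed
  then show "{g' \<cdot> f' |f' g'. f' \<in> htp A B f \<and> g' \<in> htp B D g} \<subseteq> htp A D (g \<cdot> f)" by blast
qed

end

locale replaced_model = abelian_model +
  fixes p j :: "'a \<Rightarrow> 'b"
  assumes cofibrant: "A \<in> Ob C \<Longrightarrow> cofibrant_replacement C \<Q> \<W> \<R> A (p A)"
    and fibrant: "A \<in> Ob C \<Longrightarrow> fibrant_replacement C \<Q> \<W> \<R> A (j A)"
begin

abbreviation q :: "'a \<Rightarrow> 'a" where "q A \<equiv> Dom C (p A)"
abbreviation r :: "'a \<Rightarrow> 'a" where "r A \<equiv> Cod C (j A)"

section \<open>Lifting and cancelling along the chosen replacements\<close>

lemma pE:
  assumes "A \<in> Ob C"
  obtains i where "short_exact C i (p A)" "Cod C (p A) = A" "q A \<in> \<Q>" "Dom C i \<in> \<W>" "Dom C i \<in> \<R>"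
  using cofibrant[OF assms] unfolding cofibrant_replacement_def by blast

lemma jE:
  assumes "A \<in> Ob C"
  obtains c where "short_exact C (j A) c" "Dom C (j A) = A" "r A \<in> \<R>" "Cod C c \<in> \<Q>" "Cod C c \<in> \<W>"
  using fibrant[OF assms] unfolding fibrant_replacement_def by blast

lemma p_simps [simp]:
  assumes "A \<in> Ob C"
  shows "p A \<in> Ar C" "Cod C (p A) = A" "q A \<in> \<Q>" "q A \<in> Ob C"
proof -
  obtain i where "short_exact C i (p A)" "Cod C (p A) = A" "q A \<in> \<Q>" using pE[OF assms] by metis
  then show "p A \<in> Ar C" "Cod C (p A) = A" "q A \<in> \<Q>" "q A \<in> Ob C" using short_exactD by auto
qed

lemma j_simps [simp]:
  assumes "A \<in> Ob C"
  shows "j A \<in> Ar C" "Dom C (j A) = A" "r A \<in> \<R>" "r A \<in> Ob C"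
proof -
  obtain c where "short_exact C (j A) c" "Dom C (j A) = A" "r A \<in> \<R>" using jE[OF assms] by metis
  then show "j A \<in> Ar C" "Dom C (j A) = A" "r A \<in> \<R>" "r A \<in> Ob C" using short_exactD by auto
qed

text \<open>RQA is an extension of an object of \<open>\<Q> \<inter> \<W>\<close> by the cofibrant
  QA. Arrows out of RQA thereby become accessible to \<open>rp_surj\<close> and
  \<open>rp_inj\<close>.\<close>

lemma rq_Q: "A \<in> Ob C \<Longrightarrow> r (q A) \<in> \<Q>"
  using jE[of "q A"] Q_extension[of "j (q A)"] by (metis p_simps(3,4))

lemma extend_j:
  assumes "A \<in> Ob C" "h \<in> Ar C" "Dom C h = A" "Cod C h \<in> \<R>"
  obtains h' where "h' \<in> Ar C" "Dom C h' = r A" "Cod C h' = Cod C h" "h' \<cdot> j A = h"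
proof -
  obtain c where c: "short_exact C (j A) c" "Dom C (j A) = A" "Cod C c \<in> \<Q>" "Cod C c \<in> \<W>" using jE[OF assms(1)] by metis
  then show thesis using extend[OF c(1), of h] splits_QW_R assms that by metis
qed

lemma lift_p:
  assumes "A \<in> Ob C" "h \<in> Ar C" "Cod C h = A" "Dom C h \<in> \<Q>"
  obtains h' where "h' \<in> Ar C" "Dom C h' = Dom C h" "Cod C h' = q A" "p A \<cdot> h' = h"
proof -
  obtain i where i: "short_exact C i (p A)" "Cod C (p A) = A" "Dom C i \<in> \<W>" "Dom C i \<in> \<R>" using pE[OF assms(1)] by metis
  then show thesis using lift[OF i(1), of h] splits_Q_RW assms that by metis
qed

lemma null_cancel_j:
  assumes "null (h \<cdot> j A)" "A \<in> Ob C" "h \<in> Ar C" "Dom C h = r A" "Cod C h \<in> \<R>"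
  shows "null h"
proof -
  obtain c where c: "short_exact C (j A) c" "Cod C c \<in> \<Q>" "Cod C c \<in> \<W>" using jE[OF assms(2)] by metis
  then show ?thesis using null_cancel[OF c, of h] assms by simp
qed

lemma null_cancel_p:
  assumes "null (p A \<cdot> h)" "A \<in> Ob C" "h \<in> Ar C" "Cod C h = q A" "Dom C h \<in> \<Q>"
  shows "null h"
proof -
  obtain i where i: "short_exact C i (p A)" "Dom C i \<in> \<W>" "Dom C i \<in> \<R>" using pE[OF assms(2)] by metis
  then show ?thesis
    using abelian_model.null_cancel[OF abelian_model_opp, of "p A" i h] assms short_exactD(3)[OF i(1)]
    by (simp add: null_opp)
qed

text \<open>The arrow called \<open>\<pi>\<close> in the overview. Any two candidates agree after
  composition with \<open>j (q B)\<close>, so by \<open>null_cancel_j\<close> they differ by a null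
  arrow and the choice does not affect homotopy classes.\<close>

definition rp :: "'a \<Rightarrow> 'b" where
  "rp B = (SOME h. h \<in> Ar C \<and> Dom C h = r (q B) \<and> Cod C h = r B \<and> h \<cdot> j (q B) = j B \<cdot> p B)"

lemma rp_simps [simp]:
  assumes "B \<in> Ob C"
  shows "rp B \<in> Ar C" "Dom C (rp B) = r (q B)" "Cod C (rp B) = r B" "rp B \<cdot> j (q B) = j B \<cdot> p B"
proof -
  obtain h where "h \<in> Ar C" "Dom C h = r (q B)" "Cod C h = r B" "h \<cdot> j (q B) = j B \<cdot> p B"
    using extend_j[of "q B" "j B \<cdot> p B"] assms by auto
  then have "\<exists>h. h \<in> Ar C \<and> Dom C h = r (q B) \<and> Cod C h = r B \<and> h \<cdot> j (q B) = j B \<cdot> p B" by blast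
  from someI_ex[OF this]
  show "rp B \<in> Ar C" "Dom C (rp B) = r (q B)" "Cod C (rp B) = r B" "rp B \<cdot> j (q B) = j B \<cdot> p B"
    unfolding rp_def by blast+
qed

lemma rp_bijective:
  assumes B: "B \<in> Ob C"
  shows rp_surj: "\<And>h. h \<in> Ar C \<Longrightarrow> Dom C h \<in> \<Q> \<Longrightarrow> Cod C h = r B \<Longrightarrow>
      \<exists>y\<in>Ar C. Dom C y = Dom C h \<and> Cod C y = r (q B) \<and> null (Diff C h (rp B \<cdot> y))"
    and rp_inj: "\<And>y. null (rp B \<cdot> y) \<Longrightarrow> y \<in> Ar C \<Longrightarrow> Dom C y \<in> \<Q> \<Longrightarrow> Cod C y = r (q B) \<Longrightarrow> null y"
proof -
  obtain i where i: "short_exact C i (p B)" "Dom C i \<in> \<W>" using pE[OF B] by metis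
  obtain c where c: "short_exact C (j (q B)) c" "Dom C (j (q B)) = q B" "r (q B) \<in> \<R>" "Cod C c \<in> \<W>"
    using jE[of "q B"] B by auto
  obtain c' where c': "short_exact C (j B) c'" "Dom C (j B) = Cod C (p B)" "r B \<in> \<R>" "Cod C c' \<in> \<W>"
    using jE[of B] B by auto
  note w = weak_equivalence_surj[OF i c c' rp_simps[OF B]] weak_equivalence_inj[OF i c c' rp_simps[OF B]]
  show "\<exists>y\<in>Ar C. Dom C y = Dom C h \<and> Cod C y = r (q B) \<and> null (Diff C h (rp B \<cdot> y))"
    if "h \<in> Ar C" "Dom C h \<in> \<Q>" "Cod C h = r B" for h using w(1)[of h] that B by simp
  show "null y" if "null (rp B \<cdot> y)" "y \<in> Ar C" "Dom C y \<in> \<Q>" "Cod C y = r (q B)" for y using w(2)[of y] that B by simp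
qed

definition adj :: "'a \<Rightarrow> 'a \<Rightarrow> 'b \<Rightarrow> 'b" where
  "adj A B y = rp B \<cdot> y \<cdot> j (q A)"

section \<open>The comparison map modulo the core, and its compatibility with the homotopy
  functor\<close>

lemma adj_simps [simp]:
  assumes "A \<in> Ob C" "B \<in> Ob C" "y \<in> Hom C (r (q A)) (r (q B))"
  shows "adj A B y \<in> Ar C" "Dom C (adj A B y) = q A" "Cod C (adj A B y) = r B"
  using assms by (simp_all add: adj_def Hom_iff)

lemma adj_Add:
  assumes "A \<in> Ob C" "B \<in> Ob C" "y \<in> Hom C (r (q A)) (r (q B))" "y' \<in> Hom C (r (q A)) (r (q B))"
  shows "adj A B (y \<oplus> y') = adj A B y \<oplus> adj A B y'"
  using assms by (simp add: adj_def Hom_iff)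

text \<open>The two outer factors of \<open>adj\<close> are stripped off in turn: first
  \<open>j (q A)\<close>, as the target is fibrant, then \<open>rp B\<close>, as the source RQA is
  cofibrant.\<close>

lemma null_adj_Diff:
  assumes "A \<in> Ob C" "B \<in> Ob C" "y \<in> Hom C (r (q A)) (r (q B))" "y' \<in> Hom C (r (q A)) (r (q B))"
  shows "null (Diff C (adj A B y) (adj A B y')) \<longleftrightarrow> null (Diff C y y')"
proof -
  let ?d = "Diff C y y'"
  have d: "?d \<in> Ar C" "Dom C ?d = r (q A)" "Cod C ?d = r (q B)" using assms by (auto simp: Hom_iff)
  have eq: "Diff C (adj A B y) (adj A B y') = (rp B \<cdot> ?d) \<cdot> j (q A)" using assms by (simp add: adj_def Hom_iff)
  show ?thesis
  proof
    assume "null (Diff C (adj A B y) (adj A B y'))"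
    then have "null ((rp B \<cdot> ?d) \<cdot> j (q A))" unfolding eq .
    then have "null (rp B \<cdot> ?d)" by (rule null_cancel_j[where A = "q A"]) (use d assms(1,2) in \<open>simp_all del: Cmp_Diff Diff_Cmp\<close>)
    then show "null ?d" by (rule rp_inj[OF assms(2)]) (use d assms(1,2) rq_Q in simp_all)
  next
    assume "null ?d"
    then have "null (rp B \<cdot> ?d)" by (rule null_left) (use d assms(1,2) in simp_all)
    then show "null (Diff C (adj A B y) (adj A B y'))" unfolding eq
      by (rule null_right) (use d assms(1,2) in \<open>simp_all del: Cmp_Diff Diff_Cmp\<close>)
  qed
qed

text \<open>The arrow extends strictly along \<open>j (q A)\<close>; only the passage from RB back
  to RQB costs a null arrow.\<close>

lemma adj_surj:
  assumes "A \<in> Ob C" "B \<in> Ob C" "h \<in> Ar C" "Dom C h = q A" "Cod C h = r B"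
  obtains y where "y \<in> Hom C (r (q A)) (r (q B))" "null (Diff C h (adj A B y))"
proof -
  obtain h' where h': "h' \<in> Ar C" "Dom C h' = r (q A)" "Cod C h' = r B" "h' \<cdot> j (q A) = h"
    using extend_j[of "q A" h] assms by auto
  obtain y where y: "y \<in> Ar C" "Dom C y = r (q A)" "Cod C y = r (q B)" "null (Diff C h' (rp B \<cdot> y))"
    using rp_surj[OF assms(2), of h'] h' rq_Q assms by auto
  have "null (Diff C h' (rp B \<cdot> y) \<cdot> j (q A))" by (rule null_right[OF y(4)]) (use y h' assms in simp_all)
  then have "null (Diff C h (adj A B y))" using y(1-3) h' assms by (simp add: adj_def)
  then show thesis using that y by (simp add: Hom_iff)
qed

text \<open>\<open>Ho_map\<close> collects the extensions of all lifts. Two lifts become equal after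
  composition with \<open>p B\<close>, hence differ by a null arrow; their extensions then differ by
  a null arrow after composition with \<open>j (q A)\<close>, and so before it.\<close>

lemma Ho_map_eq:
  assumes f: "f \<in> Hom C A B" and qf: "Q_lift C p f k" and h: "R_ext C j k h"
  shows "Ho_map C core p j f = htp (r (q A)) (r (q B)) h"
    "h \<in> Hom C (r (q A)) (r (q B))" "h \<cdot> j (q A) = j (q B) \<cdot> k"
proof -
  have AB: "A \<in> Ob C" "B \<in> Ob C" "f \<in> Ar C" "Dom C f = A" "Cod C f = B" using f by (auto simp: Hom_iff)
  have ty: "l \<in> Ar C \<and> Dom C l = q A \<and> Cod C l = q B \<and> p B \<cdot> l = f \<cdot> p A \<and>
      g \<in> Ar C \<and> Dom C g = r (q A) \<and> Cod C g = r (q B) \<and> g \<cdot> j (q A) = j (q B) \<cdot> l"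
    if "Q_lift C p f l" "R_ext C j l g" for l g
    using that AB by (auto simp: Q_lift_def R_ext_def Hom_iff Qo_def Ro_def)
  note 1 = ty[OF qf h]
  then show hH: "h \<in> Hom C (r (q A)) (r (q B))" and "h \<cdot> j (q A) = j (q B) \<cdot> k" by (auto simp: Hom_iff)
  have "g \<in> htp (r (q A)) (r (q B)) h" if "Q_lift C p f l" "R_ext C j l g" for l g
  proof -
    note 2 = ty[OF that]
    have "null (Diff C l k)"
      by (rule null_cancel_p[where A = B]) (use 1 2 AB null_Nul[of "q A" B] in simp_all)
    then have "null (j (q B) \<cdot> Diff C l k)" by (rule null_left) (use 1 2 AB in simp_all)
    then have "null (Diff C g h \<cdot> j (q A))" using 1 2 AB by simp
    then have "null (Diff C g h)" by (rule null_cancel_j[where A = "q A"]) (use 1 2 AB in simp_all)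
    then show ?thesis using 2 hH by (simp add: homotopy_iff Hom_iff)
  qed
  then have "homotopy C core (r (q A)) (r (q B)) `` {h. \<exists>k. Q_lift C p f k \<and> R_ext C j k h} = htp (r (q A)) (r (q B)) h"
    by (intro htp_Image) (use qf h in blast)+
  then show "Ho_map C core p j f = htp (r (q A)) (r (q B)) h"
    using AB by (simp add: Ho_map_def RQ_def Qo_def Ro_def)
qed

lemma Q_lift_ex:
  assumes "f \<in> Hom C A B"
  obtains k where "Q_lift C p f k"
proof -
  have AB: "A \<in> Ob C" "B \<in> Ob C" "f \<in> Ar C" "Dom C f = A" "Cod C f = B" using assms by (auto simp: Hom_iff)
  obtain k where "k \<in> Ar C" "Dom C k = q A" "Cod C k = q B" "p B \<cdot> k = f \<cdot> p A"
    using lift_p[of B "f \<cdot> p A"] AB by auto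
  then show thesis using that[of k] AB by (simp add: Q_lift_def Hom_iff Qo_def)
qed

lemma R_ext_Q_lift_ex:
  assumes "f \<in> Hom C A B" "Q_lift C p f k"
  obtains h where "R_ext C j k h"
proof -
  have AB: "A \<in> Ob C" "B \<in> Ob C" "f \<in> Ar C" "Dom C f = A" "Cod C f = B" using assms by (auto simp: Hom_iff)
  have k: "k \<in> Ar C" "Dom C k = q A" "Cod C k = q B" using assms(2) AB by (auto simp: Q_lift_def Hom_iff Qo_def)
  obtain h where "h \<in> Ar C" "Dom C h = r (q A)" "Cod C h = r (q B)" "h \<cdot> j (q A) = j (q B) \<cdot> k"
    using extend_j[of "q A" "j (q B) \<cdot> k"] AB k by auto
  then show thesis using that[of h] AB k by (simp add: R_ext_def Hom_iff Ro_def)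
qed

text \<open>On the source side the square of \<open>hf\<close>, \<open>k\<close> and the arrows
  \<open>j\<close> commutes strictly. On the target side \<open>rp\<close> is compatible with
  \<open>g\<close> only up to a null arrow, which is why the conclusion is nullity of a difference
  and not an equation.\<close>

lemma adj_natural:
  assumes f: "f \<in> Hom C A' A" "Q_lift C p f k" and g: "g \<in> Hom C B B'" "R_ext C j g s"
    and y: "y \<in> Hom C (r (q A)) (r (q B))"
  obtains z where "z \<in> Hom C (r (q A')) (r (q B'))"
    "Ho_comp C core p j A' B' (Ho_map C core p j g) (Ho_comp C core p j A' B (htp (r (q A)) (r (q B)) y) (Ho_map C core p j f))
      = htp (r (q A')) (r (q B')) z"
    "null (Diff C (adj A' B' z) (s \<cdot> adj A B y \<cdot> k))"
proof -
  have O: "A' \<in> Ob C" "A \<in> Ob C" "B \<in> Ob C" "B' \<in> Ob C" "g \<in> Ar C" "Dom C g = B" "Cod C g = B'" "Dom C f = A'" "Cod C f = A"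
    using f(1) g(1) by (auto simp: Hom_iff)
  obtain hf where hf: "R_ext C j k hf" using R_ext_Q_lift_ex[OF f] .
  note F = Ho_map_eq[OF f hf]
  obtain l where l: "Q_lift C p g l" using Q_lift_ex[OF g(1)] .
  obtain hg where hg: "R_ext C j l hg" using R_ext_Q_lift_ex[OF g(1) l] .
  note G = Ho_map_eq[OF g(1) l hg]
  have tk: "k \<in> Ar C" "Dom C k = q A'" "Cod C k = q A" using f(2) O by (auto simp: Q_lift_def Hom_iff Qo_def)
  have tl: "l \<in> Ar C" "Dom C l = q B" "Cod C l = q B'" "p B' \<cdot> l = g \<cdot> p B" using l O by (auto simp: Q_lift_def Hom_iff Qo_def)
  have ts: "s \<in> Ar C" "Dom C s = r B" "Cod C s = r B'" "s \<cdot> j B = j B' \<cdot> g" using g(2) O by (auto simp: R_ext_def Hom_iff Ro_def)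
  have ty: "y \<in> Ar C" "Dom C y = r (q A)" "Cod C y = r (q B)" using y by (auto simp: Hom_iff)
  have tf: "hf \<in> Ar C" "Dom C hf = r (q A')" "Cod C hf = r (q A)" using F(2) by (auto simp: Hom_iff)
  have tg: "hg \<in> Ar C" "Dom C hg = r (q B)" "Cod C hg = r (q B')" using G(2) by (auto simp: Hom_iff)
  \<comment> \<open>The defect of naturality of \<open>rp\<close>. Restricted along
    \<open>j (q B)\<close> both terms become \<open>j B' \<cdot> g \<cdot> p B\<close>, so the
    defect vanishes there and is itself null.\<close>
  let ?d = "Diff C (rp B' \<cdot> hg) (s \<cdot> rp B)"
  have "(rp B' \<cdot> hg) \<cdot> j (q B) = (s \<cdot> rp B) \<cdot> j (q B)"
    using tg ts tl O G(3) reassoc[OF rp_simps(4), of B' l] reassoc[OF ts(4), of "p B"] by simp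
  then have "?d \<cdot> j (q B) = Nul C (q B) (r B')" using tg ts O by simp
  then have "null (?d \<cdot> j (q B))" using null_Nul[of "q B" "r B'"] O by simp
  then have "null ?d" by (rule null_cancel_j[where A = "q B"]) (use tg ts O in simp_all)
  then have "null (?d \<cdot> y \<cdot> hf \<cdot> j (q A'))" by (rule null_right) (use tg ts ty tf O in simp_all)
  then have n: "null (Diff C (adj A' B' (hg \<cdot> y \<cdot> hf)) (s \<cdot> adj A B y \<cdot> k))"
    using tg ts ty tf tk O F(3) by (simp add: adj_def)
  have yf: "y \<cdot> hf \<in> Hom C (r (q A')) (r (q B))" using ty tf by (simp add: Hom_iff)
  have "Ho_comp C core p j A' B (htp (r (q A)) (r (q B)) y) (Ho_map C core p j f) = htp (r (q A')) (r (q B)) (y \<cdot> hf)"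
    unfolding F(1) Ho_comp_def RQ_def Ro_def Qo_def by (rule htp_comp[OF F(2) y])
  moreover have "Ho_comp C core p j A' B' (Ho_map C core p j g) (htp (r (q A')) (r (q B)) (y \<cdot> hf)) = htp (r (q A')) (r (q B')) (hg \<cdot> y \<cdot> hf)"
    unfolding G(1) Ho_comp_def RQ_def Ro_def Qo_def by (rule htp_comp[OF yf G(2)])
  moreover have "hg \<cdot> y \<cdot> hf \<in> Hom C (r (q A')) (r (q B'))" using ty tf tg by (simp add: Hom_iff)
  ultimately show thesis using that n by metis
qed

text \<open>The inverse of the connecting map, written as a fibre: the arrows \<open>y\<close> over
  a given extension class form exactly one homotopy class, so no choice of a preimage is
  made.\<close>

definition Phi :: "'a \<Rightarrow> 'a \<Rightarrow> 'b \<Rightarrow> 'b \<Rightarrow> 'b list set \<Rightarrow> 'b set" where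
  "Phi A B u v e = {y \<in> Hom C (r (q A)) (r (q B)). push_class C u v (adj A B y) = e}"

text \<open>All sets in the union coincide when \<open>x\<close> is a homotopy class, so the union
  is merely a way to name their common value.\<close>

definition Psi :: "'a \<Rightarrow> 'a \<Rightarrow> 'b \<Rightarrow> 'b \<Rightarrow> 'b set \<Rightarrow> 'b list set" where
  "Psi A B k l x = (\<Union>y\<in>x. pull_class C k l (adj A B y))"

text \<open>Equality of push-out classes means that the difference factors through \<open>u\<close>.
  As the suspension is cofibrant, the middle object lies in \<open>\<Q> \<inter> \<W>\<close>, and
  \<open>null_iff_factors\<close> turns this into nullity.\<close>

lemma push_class_null:
  assumes "cofibrant_suspension C \<Q> \<W> (q A) u v" "A \<in> Ob C" "h \<in> Ar C" "Dom C h = q A" "Cod C h \<in> \<R>"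
    "h' \<in> Ar C" "Dom C h' = q A" "Cod C h' = Cod C h"
  shows "push_class C u v h = push_class C u v h' \<longleftrightarrow> null (Diff C h' h)"
proof -
  have s: "short_exact C u v" "Dom C u = q A" "Cod C u \<in> \<W>" "Cod C v \<in> \<Q>"
    using assms(1) by (auto simp: cofibrant_suspension_def suspension_def)
  have "Cod C u \<in> \<Q>" using Q_extension[OF s(1)] s assms(2) by simp
  then show ?thesis
    using push_class_eq_iff[OF s(1), of h h'] null_iff_factors[OF s(1) _ s(3,4), of "Diff C h' h"] assms s by simp
qed

lemma pull_class_null:
  assumes "fibrant_loop C \<W> \<R> (r B) k l" "B \<in> Ob C" "h \<in> Ar C" "Cod C h = r B" "Dom C h \<in> \<Q>"
    "h' \<in> Ar C" "Cod C h' = r B" "Dom C h' = Dom C h"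
  shows "pull_class C k l h = pull_class C k l h' \<longleftrightarrow> null (Diff C h' h)"
proof -
  have s: "short_exact C k l" "Cod C l = r B" "Dom C l \<in> \<W>" "Dom C k \<in> \<R>"
    using assms(1) by (auto simp: fibrant_loop_def loop_def)
  have "Dom C l \<in> \<R>" using R_extension[OF s(1)] s assms(2) short_exactD(3)[OF s(1)] by simp
  then show ?thesis
    using pull_class_eq_iff[OF s(1), of h h'] null_iff_factors'[OF s(1) _ s(3,4), of "Diff C h' h"] assms s by simp
qed

section \<open>The two isomorphisms for fixed objects\<close>

context
  fixes A B assumes AB: "A \<in> Ob C" "B \<in> Ob C"
begin

lemma push_class_adj_eq_iff:
  assumes "cofibrant_suspension C \<Q> \<W> (q A) u v" "y \<in> Hom C (r (q A)) (r (q B))" "y' \<in> Hom C (r (q A)) (r (q B))"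
  shows "push_class C u v (adj A B y) = push_class C u v (adj A B y') \<longleftrightarrow>
    htp (r (q A)) (r (q B)) y = htp (r (q A)) (r (q B)) y'"
  using push_class_null[OF assms(1), of "adj A B y" "adj A B y'"] null_adj_Diff[OF AB assms(3,2)]
    htp_eq_iff[OF assms(2,3)] AB assms by simp

lemma pull_class_adj_eq_iff:
  assumes "fibrant_loop C \<W> \<R> (r B) k l" "y \<in> Hom C (r (q A)) (r (q B))" "y' \<in> Hom C (r (q A)) (r (q B))"
  shows "pull_class C k l (adj A B y) = pull_class C k l (adj A B y') \<longleftrightarrow>
    htp (r (q A)) (r (q B)) y = htp (r (q A)) (r (q B)) y'"
  using pull_class_null[OF assms(1), of "adj A B y" "adj A B y'"] null_adj_Diff[OF AB assms(3,2)]
    htp_eq_iff[OF assms(2,3)] AB assms by simp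

lemma carrier_Ext_suspension:
  assumes "cofibrant_suspension C \<Q> \<W> (q A) u v"
  shows "carrier (Ext C 1 (Cod C v) (r B)) = (\<lambda>y. push_class C u v (adj A B y)) ` Hom C (r (q A)) (r (q B))"
proof (intro equalityI subsetI)
  have s: "short_exact C u v" "Dom C u = q A" "Cod C u \<in> \<W>" "Cod C v \<in> \<Q>"
    using assms by (auto simp: cofibrant_suspension_def suspension_def)
  {
    fix e assume "e \<in> carrier (Ext C 1 (Cod C v) (r B))"
    moreover have "Cod C u \<in> \<Q>" using Q_extension[OF s(1)] s AB by simp
    \<comment> \<open>With the middle object in \<open>\<Q> \<inter> \<W>\<close> and RB fibrant,
      Ext^1 vanishes and the connecting map is onto.\<close>
    then have "splits C (Cod C u) (r B)" using splits_QW_R s AB by simp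
    ultimately obtain h where h: "h \<in> Ar C" "Dom C h = q A" "Cod C h = r B" "e = push_class C u v h"
      using push_class_surj[OF s(1), of "r B" e] s(2) by metis
    obtain y where y: "y \<in> Hom C (r (q A)) (r (q B))" "null (Diff C h (adj A B y))"
      using adj_surj[OF AB h(1-3)] .
    have "e = push_class C u v (adj A B y)"
      unfolding h(4) using push_class_null[OF assms AB(1), of "adj A B y" h] y h AB by simp
    then show "e \<in> (\<lambda>y. push_class C u v (adj A B y)) ` Hom C (r (q A)) (r (q B))" using y by blast
  next
    fix e assume "e \<in> (\<lambda>y. push_class C u v (adj A B y)) ` Hom C (r (q A)) (r (q B))"
    then obtain y where "y \<in> Hom C (r (q A)) (r (q B))" "e = push_class C u v (adj A B y)" by blast
    then show "e \<in> carrier (Ext C 1 (Cod C v) (r B))"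
      using push_class_carrier[OF s(1), of "adj A B y"] s(2) AB by simp
  }
qed

lemma carrier_Ext_loop:
  assumes "fibrant_loop C \<W> \<R> (r B) k l"
  shows "carrier (Ext C 1 (q A) (Dom C k)) = (\<lambda>y. pull_class C k l (adj A B y)) ` Hom C (r (q A)) (r (q B))"
proof (intro equalityI subsetI)
  have s: "short_exact C k l" "Cod C l = r B" "Dom C l \<in> \<W>" "Dom C k \<in> \<R>"
    using assms by (auto simp: fibrant_loop_def loop_def)
  {
    fix e assume "e \<in> carrier (Ext C 1 (q A) (Dom C k))"
    moreover have "Dom C l \<in> \<R>" using R_extension[OF s(1)] s AB short_exactD(3)[OF s(1)] by simp
    then have "splits C (q A) (Dom C l)" using splits_Q_RW s AB by simp
    ultimately obtain h where h: "h \<in> Ar C" "Dom C h = q A" "Cod C h = r B" "e = pull_class C k l h"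
      using pull_class_surj[OF s(1), of "q A" e] s(2) by metis
    obtain y where y: "y \<in> Hom C (r (q A)) (r (q B))" "null (Diff C h (adj A B y))"
      using adj_surj[OF AB h(1-3)] .
    have "e = pull_class C k l (adj A B y)"
      unfolding h(4) using pull_class_null[OF assms AB(2), of "adj A B y" h] y h AB by simp
    then show "e \<in> (\<lambda>y. pull_class C k l (adj A B y)) ` Hom C (r (q A)) (r (q B))" using y by blast
  next
    fix e assume "e \<in> (\<lambda>y. pull_class C k l (adj A B y)) ` Hom C (r (q A)) (r (q B))"
    then obtain y where "y \<in> Hom C (r (q A)) (r (q B))" "e = pull_class C k l (adj A B y)" by blast
    then show "e \<in> carrier (Ext C 1 (q A) (Dom C k))"
      using pull_class_carrier[OF s(1), of "adj A B y"] s(2) AB by simp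
  }
qed

lemma Phi_push_class:
  assumes "cofibrant_suspension C \<Q> \<W> (q A) u v" "y \<in> Hom C (r (q A)) (r (q B))"
  shows "Phi A B u v (push_class C u v (adj A B y)) = htp (r (q A)) (r (q B)) y"
proof -
  have "z \<in> Phi A B u v (push_class C u v (adj A B y)) \<longleftrightarrow> z \<in> htp (r (q A)) (r (q B)) y" for z
  proof (cases "z \<in> Hom C (r (q A)) (r (q B))")
    case True
    then show ?thesis
      using push_class_adj_eq_iff[OF assms(1) True assms(2)] htp_eq_iff[OF assms(2) True] assms(2)
      unfolding Phi_def mem_Collect_eq mem_htp by metis
  qed (simp add: Phi_def homotopy_iff)
  then show ?thesis by blast
qed

lemma Psi_htp:
  assumes "fibrant_loop C \<W> \<R> (r B) k l" "y \<in> Hom C (r (q A)) (r (q B))"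
  shows "Psi A B k l (htp (r (q A)) (r (q B)) y) = pull_class C k l (adj A B y)"
proof -
  have "pull_class C k l (adj A B z) = pull_class C k l (adj A B y)" if "z \<in> htp (r (q A)) (r (q B)) y" for z
    using that pull_class_adj_eq_iff[OF assms(1), of y z] htp_eq_iff[of y _ _ z] unfolding mem_htp by metis
  then show ?thesis unfolding Psi_def using htp_self[OF assms(2)] by blast
qed

lemma Phi_iso:
  assumes "cofibrant_suspension C \<Q> \<W> (q A) u v"
  shows "Phi A B u v \<in> iso (Ext C 1 (Cod C v) (r B)) (stable_Hom C core (r (q A)) (r (q B)))"
proof (rule iso_via_parametrization[where m = "Add C", OF carrier_Ext_suspension[OF assms] carrier_stable_Hom push_class_adj_eq_iff[OF assms]])
  have s: "short_exact C u v" "Dom C u = q A" using assms by (auto simp: cofibrant_suspension_def suspension_def)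
  fix y y' assume y: "y \<in> Hom C (r (q A)) (r (q B))" "y' \<in> Hom C (r (q A)) (r (q B))"
  show "y \<oplus> y' \<in> Hom C (r (q A)) (r (q B))" using y by (simp add: Hom_iff)
  show "push_class C u v (adj A B y) \<otimes>\<^bsub>Ext C 1 (Cod C v) (r B)\<^esub> push_class C u v (adj A B y') = push_class C u v (adj A B (y \<oplus> y'))"
    using push_class_Add[OF s(1), of "adj A B y" "adj A B y'"] s(2) y AB by (simp add: Ext_def adj_Add)
  show "htp (r (q A)) (r (q B)) y \<otimes>\<^bsub>stable_Hom C core (r (q A)) (r (q B))\<^esub> htp (r (q A)) (r (q B)) y' = htp (r (q A)) (r (q B)) (y \<oplus> y')"
    by (rule mult_stable_Hom[OF y])
qed (assumption | rule Phi_push_class[OF assms])+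

lemma Psi_iso:
  assumes "fibrant_loop C \<W> \<R> (r B) k l"
  shows "Psi A B k l \<in> iso (stable_Hom C core (r (q A)) (r (q B))) (Ext C 1 (q A) (Dom C k))"
proof (rule iso_via_parametrization[where m = "Add C", OF carrier_stable_Hom carrier_Ext_loop[OF assms] pull_class_adj_eq_iff[OF assms, symmetric]])
  have s: "short_exact C k l" "Cod C l = r B" using assms by (auto simp: fibrant_loop_def loop_def)
  fix y y' assume y: "y \<in> Hom C (r (q A)) (r (q B))" "y' \<in> Hom C (r (q A)) (r (q B))"
  show "y \<oplus> y' \<in> Hom C (r (q A)) (r (q B))" using y by (simp add: Hom_iff)
  show "pull_class C k l (adj A B y) \<otimes>\<^bsub>Ext C 1 (q A) (Dom C k)\<^esub> pull_class C k l (adj A B y') = pull_class C k l (adj A B (y \<oplus> y'))"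
    using pull_class_Add[OF s(1), of "adj A B y" "adj A B y'"] s(2) y AB by (simp add: Ext_def adj_Add)
  show "htp (r (q A)) (r (q B)) y \<otimes>\<^bsub>stable_Hom C core (r (q A)) (r (q B))\<^esub> htp (r (q A)) (r (q B)) y' = htp (r (q A)) (r (q B)) (y \<oplus> y')"
    by (rule mult_stable_Hom[OF y])
qed (assumption | rule Psi_htp[OF assms])+

end

section \<open>Naturality in both variables\<close>

context
  fixes A A' B B' f g k s
  assumes f: "f \<in> Hom C A' A" "Q_lift C p f k" and g: "g \<in> Hom C B B'" "R_ext C j g s"
begin

lemma naturality_types:
  "A \<in> Ob C" "A' \<in> Ob C" "B \<in> Ob C" "B' \<in> Ob C"
  "k \<in> Ar C" "Dom C k = q A'" "Cod C k = q A" "s \<in> Ar C" "Dom C s = r B" "Cod C s = r B'"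
  using f g by (auto simp: Hom_iff Q_lift_def R_ext_def Qo_def Ro_def)

text \<open>Writing \<open>e\<close> as the push-out class of \<open>adj A B y\<close>, the
  left-hand argument becomes that of \<open>s \<cdot> adj A B y \<cdot> k\<close>. By
  \<open>adj_natural\<close> this differs from \<open>adj A' B' z\<close> by a null arrow, where
  \<open>z\<close> represents the right-hand side, and push-out classes do not see null
  arrows.\<close>

lemma Phi_natural:
  assumes "cofibrant_suspension C \<Q> \<W> (q A) u v" "cofibrant_suspension C \<Q> \<W> (q A') u' v'"
    "mor C [u', v'] [u, v] k t" "e \<in> carrier (Ext C 1 (Cod C v) (r B))"
  shows "Phi A' B' u' v' (Ext_push C 1 (Cod C v') s (Ext_pull C 1 (r B) t e)) =
    Ho_comp C core p j A' B' (Ho_map C core p j g) (Ho_comp C core p j A' B (Phi A B u v e) (Ho_map C core p j f))"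
proof -
  note O = naturality_types
  have se: "short_exact C u v" "Dom C u = q A" "short_exact C u' v'" "Dom C u' = q A'"
    using assms(1,2) by (auto simp: cofibrant_suspension_def suspension_def)
  obtain y where y: "y \<in> Hom C (r (q A)) (r (q B))" "e = push_class C u v (adj A B y)"
    using assms(4) carrier_Ext_suspension[OF O(1,3) assms(1)] by blast
  obtain z where z: "z \<in> Hom C (r (q A')) (r (q B'))"
    "Ho_comp C core p j A' B' (Ho_map C core p j g) (Ho_comp C core p j A' B (htp (r (q A)) (r (q B)) y) (Ho_map C core p j f))
      = htp (r (q A')) (r (q B')) z"
    "null (Diff C (adj A' B' z) (s \<cdot> adj A B y \<cdot> k))" using adj_natural[OF f g y(1)] .
  have "Ext_push C 1 (Cod C v') s (Ext_pull C 1 (r B) t e) = push_class C u' v' (s \<cdot> adj A B y \<cdot> k)"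
    unfolding y(2) using push_class_natural[OF se(1,3) assms(3), of "adj A B y" s] se O y(1) by simp
  also have "\<dots> = push_class C u' v' (adj A' B' z)"
    using push_class_null[OF assms(2), of "s \<cdot> adj A B y \<cdot> k" "adj A' B' z"] O y(1) z(1,3) by simp
  finally show ?thesis
    using Phi_push_class[OF O(2,4) assms(2) z(1)] Phi_push_class[OF O(1,3) assms(1) y(1)] y(2) z(2) by simp
qed

lemma Psi_natural:
  assumes "fibrant_loop C \<W> \<R> (r B) i l" "fibrant_loop C \<W> \<R> (r B') i' l'"
    "mor C [i, l] [i', l'] t s" "x \<in> carrier (stable_Hom C core (r (q A)) (r (q B)))"
  shows "Psi A' B' i' l' (Ho_comp C core p j A' B' (Ho_map C core p j g)
      (Ho_comp C core p j A' B x (Ho_map C core p j f))) =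
    Ext_push C 1 (q A') t (Ext_pull C 1 (Dom C i) k (Psi A B i l x))"
proof -
  note O = naturality_types
  have se: "short_exact C i l" "Cod C l = r B" "short_exact C i' l'" "Cod C l' = r B'"
    using assms(1,2) by (auto simp: fibrant_loop_def loop_def)
  obtain y where y: "y \<in> Hom C (r (q A)) (r (q B))" "x = htp (r (q A)) (r (q B)) y"
    using assms(4) unfolding carrier_stable_Hom by blast
  obtain z where z: "z \<in> Hom C (r (q A')) (r (q B'))"
    "Ho_comp C core p j A' B' (Ho_map C core p j g) (Ho_comp C core p j A' B (htp (r (q A)) (r (q B)) y) (Ho_map C core p j f))
      = htp (r (q A')) (r (q B')) z"
    "null (Diff C (adj A' B' z) (s \<cdot> adj A B y \<cdot> k))" using adj_natural[OF f g y(1)] .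
  have "Ext_push C 1 (q A') t (Ext_pull C 1 (Dom C i) k (pull_class C i l (adj A B y))) = pull_class C i' l' (s \<cdot> adj A B y \<cdot> k)"
    using pull_class_natural[OF se(1,3) assms(3), of "adj A B y" k] se O y(1) by simp
  also have "\<dots> = pull_class C i' l' (adj A' B' z)"
    using pull_class_null[OF assms(2), of "s \<cdot> adj A B y \<cdot> k" "adj A' B' z"] O y(1) z(1,3) by simp
  finally show ?thesis
    using Psi_htp[OF O(2,4) assms(2) z(1)] Psi_htp[OF O(1,3) assms(1) y(1)] unfolding y(2) z(2) by simp
qed

end

end

section \<open>Translation of the cotorsion pairs into splitting conditions, and the final
  statement\<close>

lemma abelian_model_of_hereditary:
  assumes "abelian_category C" "hereditary_abelian_model_structure C \<Q> \<W> \<R>"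
  shows "abelian_model C \<Q> \<W> \<R>"
proof -
  interpret abelian_category C by fact
  have sp: "\<Y> = {Y \<in> Ob C. \<forall>X\<in>\<X>. splits C X Y}" "\<X> = {X \<in> Ob C. \<forall>Y\<in>\<Y>. splits C X Y}"
    if "cotorsion_pair C \<X> \<Y>" for \<X> \<Y>
  proof -
    have ob: "\<X> \<subseteq> Ob C" "\<Y> \<subseteq> Ob C" and eq: "\<Y> = {Y \<in> Ob C. \<forall>X\<in>\<X>. Ext_vanishes C 1 X Y}"
      "\<X> = {X \<in> Ob C. \<forall>Y\<in>\<Y>. Ext_vanishes C 1 X Y}"
      using that unfolding cotorsion_pair_def by blast+
    show "\<Y> = {Y \<in> Ob C. \<forall>X\<in>\<X>. splits C X Y}"
      by (subst eq(1)) (use ob Ext_vanishes_iff_splits in blast)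
    show "\<X> = {X \<in> Ob C. \<forall>Y\<in>\<Y>. splits C X Y}"
      by (subst eq(2)) (use ob Ext_vanishes_iff_splits in blast)
  qed
  show ?thesis
    using assms(2) unfolding hereditary_abelian_model_structure_def
    by (intro abelian_model.intro assms(1) abelian_model_axioms.intro sp) (elim conjE; assumption)+
qed

text \<open>Suspensions and loop objects are functorial only after a morphism between the chosen
  sequences has been selected. Hence the maps take the sequence as an argument, and naturality
  ranges over all lifts \<open>q\<close>, all extensions \<open>r\<close> and all such morphisms;
  with identities for \<open>f\<close> and \<open>g\<close> it also compares two suspensions of one
  object.\<close>

theorem corollary7p5:
  fixes C :: "('o, 'm) cat"
    and \<Q> \<W> \<R> \<omega> :: "'o set"
    and p j :: "'o \<Rightarrow> 'm"
  assumes "abelian_category C"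
    and "hereditary_abelian_model_structure C \<Q> \<W> \<R>"
    and "\<omega> = \<Q> \<inter> \<W> \<inter> \<R>"
    and "\<And>A. A \<in> Ob C \<Longrightarrow> cofibrant_replacement C \<Q> \<W> \<R> A (p A)"
    and "\<And>A. A \<in> Ob C \<Longrightarrow> fibrant_replacement C \<Q> \<W> \<R> A (j A)"
  shows "\<exists>(\<Phi> :: 'o \<Rightarrow> 'o \<Rightarrow> 'm \<Rightarrow> 'm \<Rightarrow> 'm list set \<Rightarrow> 'm set)
          (\<Psi> :: 'o \<Rightarrow> 'o \<Rightarrow> 'm \<Rightarrow> 'm \<Rightarrow> 'm set \<Rightarrow> 'm list set).
    (\<forall>A\<in>Ob C. \<forall>B\<in>Ob C.
       (\<forall>u v. cofibrant_suspension C \<Q> \<W> (Qo C p A) u v \<longrightarrow>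
          \<Phi> A B u v \<in> iso (Ext C 1 (Cod C v) (Ro C j B)) (Ho C \<omega> p j A B)) \<and>
       (\<forall>k l. fibrant_loop C \<W> \<R> (Ro C j B) k l \<longrightarrow>
          \<Psi> A B k l \<in> iso (Ho C \<omega> p j A B) (Ext C 1 (Qo C p A) (Dom C k)))) \<and>
    (\<forall>A\<in>Ob C. \<forall>A'\<in>Ob C. \<forall>B\<in>Ob C. \<forall>B'\<in>Ob C.
     \<forall>f\<in>Hom C A' A. \<forall>g\<in>Hom C B B'. \<forall>q r. Q_lift C p f q \<and> R_ext C j g r \<longrightarrow>
       (\<forall>u v u' v' w s.
          cofibrant_suspension C \<Q> \<W> (Qo C p A) u v \<and>
          cofibrant_suspension C \<Q> \<W> (Qo C p A') u' v' \<and>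
          seq_morphism C [u', v'] [u, v] [q, w, s] \<longrightarrow>
          (\<forall>e\<in>carrier (Ext C 1 (Cod C v) (Ro C j B)).
             \<Phi> A' B' u' v' (Ext_push C 1 (Cod C v') r (Ext_pull C 1 (Ro C j B) s e)) =
             Ho_comp C \<omega> p j A' B' (Ho_map C \<omega> p j g)
               (Ho_comp C \<omega> p j A' B (\<Phi> A B u v e) (Ho_map C \<omega> p j f)))) \<and>
       (\<forall>k l k' l' w t.
          fibrant_loop C \<W> \<R> (Ro C j B) k l \<and>
          fibrant_loop C \<W> \<R> (Ro C j B') k' l' \<and>
          seq_morphism C [k, l] [k', l'] [t, w, r] \<longrightarrow>
          (\<forall>x\<in>carrier (Ho C \<omega> p j A B).
             \<Psi> A' B' k' l' (Ho_comp C \<omega> p j A' B' (Ho_map C \<omega> p j g)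
               (Ho_comp C \<omega> p j A' B x (Ho_map C \<omega> p j f))) =
             Ext_push C 1 (Qo C p A') t (Ext_pull C 1 (Dom C k) q (\<Psi> A B k l x)))))"
proof -
  interpret abelian_model C \<Q> \<W> \<R> using assms(1,2) by (rule abelian_model_of_hereditary)
  interpret replaced_model C \<Q> \<W> \<R> p j using assms(4,5) by unfold_locales
  show ?thesis unfolding assms(3) Qo_def Ro_def Ho_def RQ_def
  proof (intro exI[of _ Phi] exI[of _ Psi] conjI ballI allI impI)
    fix A B u v assume "A \<in> Ob C" "B \<in> Ob C" "cofibrant_suspension C \<Q> \<W> (q A) u v"
    then show "Phi A B u v \<in> iso (Ext C 1 (Cod C v) (r B)) (stable_Hom C core (r (q A)) (r (q B)))"
      by (rule Phi_iso)
  next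
    fix A B k l assume "A \<in> Ob C" "B \<in> Ob C" "fibrant_loop C \<W> \<R> (r B) k l"
    then show "Psi A B k l \<in> iso (stable_Hom C core (r (q A)) (r (q B))) (Ext C 1 (q A) (Dom C k))"
      by (rule Psi_iso)
  next
    fix A A' B B' f g k s u v u' v' w t e
    assume "f \<in> Hom C A' A" "g \<in> Hom C B B'" "Q_lift C p f k \<and> R_ext C j g s"
      and a: "cofibrant_suspension C \<Q> \<W> (q A) u v \<and> cofibrant_suspension C \<Q> \<W> (q A') u' v' \<and>
          seq_morphism C [u', v'] [u, v] [k, w, t]" and e: "e \<in> carrier (Ext C 1 (Cod C v) (r B))"
    moreover have "mor C [u', v'] [u, v] k t" using a unfolding mor_def by blast
    ultimately show "Phi A' B' u' v' (Ext_push C 1 (Cod C v') s (Ext_pull C 1 (r B) t e)) =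
        Ho_comp C core p j A' B' (Ho_map C core p j g) (Ho_comp C core p j A' B (Phi A B u v e) (Ho_map C core p j f))"
      by (elim conjE, intro Phi_natural)
  next
    fix A A' B B' f g k s i l i' l' w t x
    assume "f \<in> Hom C A' A" "g \<in> Hom C B B'" "Q_lift C p f k \<and> R_ext C j g s"
      and a: "fibrant_loop C \<W> \<R> (r B) i l \<and> fibrant_loop C \<W> \<R> (r B') i' l' \<and>
          seq_morphism C [i, l] [i', l'] [t, w, s]" and x: "x \<in> carrier (stable_Hom C core (r (q A)) (r (q B)))"
    moreover have "mor C [i, l] [i', l'] t s" using a unfolding mor_def by blast
    ultimately show "Psi A' B' i' l' (Ho_comp C core p j A' B' (Ho_map C core p j g)
        (Ho_comp C core p j A' B x (Ho_map C core p j f))) =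
      Ext_push C 1 (q A') t (Ext_pull C 1 (Dom C i) k (Psi A B i l x))"
      by (elim conjE, intro Psi_natural)
  qed
qed

end
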